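(* Let $k\ge1$, $\boldsymbol{\alpha}=(\alpha_1,\dots,\alpha_k)\in(0,+\infty)^k$, $\beta\in(0,+\infty)$, $\alpha_0=\sum_{i=1}^k\alpha_i$. Let $\mathbf{X}_n=(X_{1n},\dots,X_{kn})$, $n\in[N]$, be a random sample from the Multivariate Gamma distribution $\mathcal{MG}_k(\boldsymbol{\alpha},\beta)$ and $\mathbf{Z}_n=(Z_{1n},\dots,Z_{kn}):=\Delta\mathbf{X}_n$, $n\in[N]$. The maximum likelihood estimator (MLE) $(\hat{\boldsymbol{\alpha}},\hat\beta)$ of $(\boldsymbol{\alpha},\beta)$, derived (whenever it exists) as the unique solution in $(0,+\infty)^{k+1}$ of the equation system $$\hat\alpha_0\hat\beta=\overline{X_k},\qquad \overline{\log Z_i}=\psi(\hat\alpha_i)+\log\hat\beta,\quad i\in[k],\qquad \hat\alpha_0:=\sum_{i=1}^k\hat\alpha_i,$$ is a moment-type estimator with asymptotic variance-covariance matrix $$\begin{bmatrix}\mathbf{V}_{11} & \beta^{-1}\mathbf{1}_{k\times1}\\ \beta^{-1}\mathbf{1}_{1\times k} & \alpha_0\beta^{-2}\end{bmatrix}^{-1},$$ where $\mathbf{V}_{11}$ is the $k\times k$ diagonal matrix with entries $(\mathbf{V}_{11})_{ii}=\psi_1(\alpha_i)$, $i\in[k]$.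
   Context: Notation: $[k]=\{1,\dots,k\}$; a random sample is an i.i.d. sample; $\overline{h(\mathbf{X})}:=\frac1N\sum_{n=1}^N h(\mathbf{X}_n)$, so $\overline{X_k}=\frac1N\sum_n X_{kn}$ and $\overline{\log Z_i}=\frac1N\sum_n\log Z_{in}$. $\mathbf{1}_{a\times b}$ is the $a\times b$ all-ones matrix. $\Delta\mathbf{x}:=(x_1,x_2-x_1,\dots,x_k-x_{k-1})$. $\Gamma$ is the gamma function, $\psi(a)=\frac{d}{da}\log\Gamma(a)$ the digamma function and $\psi_1=\psi'$ the trigamma function. Multivariate Gamma distribution: $\mathbf{X}\sim\mathcal{MG}_k(\boldsymbol{\alpha},\beta)$ has Lebesgue density on $\mathbb{R}^k$ $f(\mathbf{x};\boldsymbol{\alpha},\beta)=\frac{1}{\beta^{\alpha_0}\prod_{i=1}^k\Gamma(\alpha_i)}e^{-x_k/\beta}x_1^{\alpha_1-1}\prod_{i=2}^k(x_i-x_{i-1})^{\alpha_i-1}$ on $\{\mathbf{x}\in(0,+\infty)^k:x_1<x_2<\dots<x_k\}$. Moment-type estimator: for a parametric family with support $\mathbf{S}\subset\mathbb{R}^k$ and parameter space $\boldsymbol{\Theta}\subset\mathbb{R}^d$, let $h:\mathbf{S}\to\mathbb{R}^m$ be such that $e_h:\boldsymbol{\Theta}\to\mathbb{R}^m$, $e_h(\boldsymbol{\theta})=\mathbb{E}_{\boldsymbol{\theta}}(h(\mathbf{X}))$, is injective, and let $g:\mathbb{R}^m\to\mathbb{R}^d$ satisfy $g|_{e_h(\boldsymbol{\Theta})}=e_h^{-1}$.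 The estimator $\tilde{\boldsymbol{\theta}}_N=g(\overline{h(\mathbf{X})})$ is called a moment-type estimator of $\boldsymbol{\theta}$; it exists as long as $\tilde{\boldsymbol{\theta}}_N\in\boldsymbol{\Theta}$. An estimator $\tilde{\boldsymbol{\theta}}_N$ that exists with probability tending to 1 as $N\to\infty$ has asymptotic variance-covariance matrix $\boldsymbol{\Sigma}$ if $\sqrt{N}(\tilde{\boldsymbol{\theta}}_N-\boldsymbol{\theta})$ converges in law, under $\boldsymbol{\theta}$, to the centered normal distribution with covariance matrix $\boldsymbol{\Sigma}$ as $N\to\infty$. Here $\boldsymbol{\theta}=(\boldsymbol{\alpha},\beta)$, $\boldsymbol{\Theta}=(0,+\infty)^{k+1}$. *)

theory Defs
  imports "HOL-Probability.Probability"
begin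

section \<open>Estimators in a parametric family\<close>

text \<open>A sample of size \<open>N\<close> is the restriction to \<open>{1..N}\<close> of a sequence \<open>x 1, x 2, \<dots>\<close>.\<close>

definition sample_mean :: "nat \<Rightarrow> (nat \<Rightarrow> 'b::real_vector) \<Rightarrow> 'b" where
  "sample_mean N y = (1 / real N) *\<^sub>R (\<Sum>n=1..N. y n)"

definition likelihood :: "('p \<Rightarrow> 'a \<Rightarrow> real) \<Rightarrow> nat \<Rightarrow> (nat \<Rightarrow> 'a) \<Rightarrow> 'p \<Rightarrow> real" where
  "likelihood f N x \<theta> = (\<Prod>n=1..N. f \<theta> (x n))"

definition maximizes_likelihood ::
  "('p \<Rightarrow> 'a \<Rightarrow> real) \<Rightarrow> 'p set \<Rightarrow> nat \<Rightarrow> (nat \<Rightarrow> 'a) \<Rightarrow> 'p \<Rightarrow> bool" where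
  "maximizes_likelihood f \<Theta> N x \<theta> \<longleftrightarrow>
     \<theta> \<in> \<Theta> \<and> (\<forall>\<theta>'\<in>\<Theta>. likelihood f N x \<theta>' \<le> likelihood f N x \<theta>)"

text \<open>An estimator is a map of type \<open>nat \<Rightarrow> (nat \<Rightarrow> 'a) \<Rightarrow> 'p option\<close>; the value \<open>None\<close> means that
  the estimator does not exist for the sample in question.\<close>

definition mle :: "('p \<Rightarrow> 'a \<Rightarrow> real) \<Rightarrow> 'p set \<Rightarrow> nat \<Rightarrow> (nat \<Rightarrow> 'a) \<Rightarrow> 'p option" where
  "mle f \<Theta> N x =
     (if \<exists>!\<theta>. maximizes_likelihood f \<Theta> N x \<theta>
      then Some (THE \<theta>. maximizes_likelihood f \<Theta> N x \<theta>) else None)"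

text \<open>Here \<open>P \<theta>\<close> is the distribution with parameter \<open>\<theta>\<close>.  As \<open>h\<close> is a function on the support
  \<open>S\<close>, its values outside \<open>S\<close> do not enter.\<close>

definition moment_type_estimator ::
  "('p \<Rightarrow> 'a measure) \<Rightarrow> 'a set \<Rightarrow> 'p set \<Rightarrow> ('a \<Rightarrow> 'm::euclidean_space) \<Rightarrow> ('m \<Rightarrow> 'p) \<Rightarrow>
    (nat \<Rightarrow> (nat \<Rightarrow> 'a) \<Rightarrow> 'p option) \<Rightarrow> bool" where
  "moment_type_estimator P S \<Theta> h g T \<longleftrightarrow>
     (\<forall>\<theta>\<in>\<Theta>. set_integrable (P \<theta>) S h) \<and>
     inj_on (\<lambda>\<theta>. LINT x:S|P \<theta>. h x) \<Theta> \<and>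
     (\<forall>\<theta>\<in>\<Theta>. g (LINT x:S|P \<theta>. h x) = \<theta>) \<and>
     (\<forall>N\<ge>1. \<forall>x. (\<forall>n\<in>{1..N}. x n \<in> S) \<longrightarrow>
        T N x = (let t = g (sample_mean N (\<lambda>n. h (x n))) in if t \<in> \<Theta> then Some t else None))"

text \<open>\<open>\<mu>\<close> is the (possibly degenerate) centered normal distribution with covariance matrix \<open>V\<close>,
  i.e. each linear functional \<open>t \<bullet> x\<close> has the centered normal law of variance \<open>t \<bullet> (V *v t)\<close>.
  Symmetry of \<open>V\<close> is required because the quadratic form only sees the symmetric part.\<close>

definition centered_normal :: "real^'d^'d \<Rightarrow> (real^'d) measure \<Rightarrow> bool" where
  "centered_normal V \<mu> \<longleftrightarrow>
     prob_space \<mu> \<and> sets \<mu> = sets borel \<and> transpose V = V \<and>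
     (\<forall>t. let v = t \<bullet> (V *v t) in
        0 \<le> v \<and>
        distr \<mu> borel (\<lambda>x. t \<bullet> x) =
          (if v = 0 then return borel 0
           else density lborel (\<lambda>s. ennreal (normal_density 0 (sqrt v) s))))"

text \<open>The estimator \<open>T\<close>, applied to the random sequence \<open>X\<close>, exists with probability tending to 1,
  and \<open>sqrt N (T - \<theta>)\<close> converges in law to the centered normal distribution with covariance
  matrix \<open>V\<close>.  The integrals are restricted to the event that \<open>T\<close> exists; as its probability tends
  to 1, this is convergence in law for any assignment of values to \<open>T\<close> off that event.\<close>

definition asymptotic_covariance ::
  "'w measure \<Rightarrow> (nat \<Rightarrow> 'w \<Rightarrow> 'a) \<Rightarrow> (nat \<Rightarrow> (nat \<Rightarrow> 'a) \<Rightarrow> (real^'d) option) \<Rightarrow>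
    real^'d \<Rightarrow> real^'d^'d \<Rightarrow> bool" where
  "asymptotic_covariance M X T \<theta> V \<longleftrightarrow>
     (let T' = (\<lambda>N \<omega>. T N (\<lambda>n. X n \<omega>));
          E = (\<lambda>N. {\<omega> \<in> space M. T' N \<omega> \<noteq> None})
      in (\<forall>N\<ge>1. E N \<in> sets M \<and>
            (\<lambda>\<omega>. the (T' N \<omega>)) \<in> borel_measurable (restrict_space M (E N))) \<and>
         (\<lambda>N. measure M (E N)) \<longlonglongrightarrow> 1 \<and>
         (\<exists>\<mu>. centered_normal V \<mu> \<and>
            (\<forall>\<phi>::real^'d \<Rightarrow> real. continuous_on UNIV \<phi> \<and> bounded (range \<phi>) \<longrightarrow>
               (\<lambda>N. LINT \<omega>:E N|M. \<phi> (sqrt (real N) *\<^sub>R (the (T' N \<omega>) - \<theta>)))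
                 \<longlonglongrightarrow> (LINT y|\<mu>. \<phi> y))))"


section \<open>The multivariate Gamma distribution\<close>

text \<open>A finite linearly ordered index type \<open>'n\<close> plays the role of \<open>{1,\<dots>,k}\<close>, so that
  \<open>Min UNIV\<close> is the index 1, \<open>Max UNIV\<close> is the index \<open>k\<close>, and \<open>prev_index i\<close> is \<open>i - 1\<close> for
  \<open>i \<noteq> Min UNIV\<close>.\<close>

definition prev_index :: "'n::{finite,linorder} \<Rightarrow> 'n" where
  "prev_index i = Max {j. j < i}"

definition increments :: "real^'n::{finite,linorder} \<Rightarrow> real^'n::{finite,linorder}" where
  "increments x = (\<chi> i. if i = Min UNIV then x $ i else x $ i - x $ prev_index i)"

definition mg_support :: "(real^'n::{finite,linorder}) set" where
  "mg_support = {x. (\<forall>i. 0 < x $ i) \<and> (\<forall>i j. i < j \<longrightarrow> x $ i < x $ j)}"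

definition mg_density :: "real^'n::{finite,linorder} \<Rightarrow> real \<Rightarrow> real^'n::{finite,linorder} \<Rightarrow> real" where
  "mg_density \<alpha> \<beta> x =
     (if x \<in> mg_support then
        1 / (\<beta> powr (\<Sum>i\<in>UNIV. \<alpha> $ i) * (\<Prod>i\<in>UNIV. Gamma (\<alpha> $ i)))
        * exp (- (x $ Max UNIV) / \<beta>)
        * (x $ Min UNIV) powr (\<alpha> $ Min UNIV - 1)
        * (\<Prod>i\<in>UNIV - {Min UNIV}. (x $ i - x $ prev_index i) powr (\<alpha> $ i - 1))
      else 0)"

definition multivariate_gamma :: "real^'n::{finite,linorder} \<Rightarrow> real \<Rightarrow> (real^'n::{finite,linorder}) measure" where
  "multivariate_gamma \<alpha> \<beta> = density lborel (\<lambda>x. ennreal (mg_density \<alpha> \<beta> x))"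

text \<open>Parameters \<open>(\<alpha>, \<beta>)\<close> are vectors indexed by \<open>'n + unit\<close>: the entries at \<open>Inl i\<close> form \<open>\<alpha>\<close>,
  and the entry at \<open>Inr ()\<close> is \<open>\<beta>\<close>.\<close>

definition param :: "real^'n \<Rightarrow> real \<Rightarrow> real^('n + unit)" where
  "param \<alpha> \<beta> = (\<chi> j. case j of Inl i \<Rightarrow> \<alpha> $ i | Inr _ \<Rightarrow> \<beta>)"

definition shape_of :: "real^('n + unit) \<Rightarrow> real^'n" where
  "shape_of \<theta> = (\<chi> i. \<theta> $ Inl i)"

definition scale_of :: "real^('n::finite + unit) \<Rightarrow> real" where
  "scale_of \<theta> = \<theta> $ Inr ()"

definition mg_params :: "(real^('n::finite + unit)) set" where
  "mg_params = {\<theta>. \<forall>j. 0 < \<theta> $ j}"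

definition mg_family :: "real^('n + unit) \<Rightarrow> real^'n::{finite,linorder} \<Rightarrow> real" where
  "mg_family \<theta> = mg_density (shape_of \<theta>) (scale_of \<theta>)"

definition mg_equations ::
  "nat \<Rightarrow> (nat \<Rightarrow> real^'n::{finite,linorder}) \<Rightarrow> real^('n + unit) \<Rightarrow> bool" where
  "mg_equations N x \<theta> \<longleftrightarrow>
     (\<Sum>i\<in>UNIV. shape_of \<theta> $ i) * scale_of \<theta> = sample_mean N (\<lambda>n. x n $ Max UNIV) \<and>
     (\<forall>i. sample_mean N (\<lambda>n. ln (increments (x n) $ i)) = Digamma (shape_of \<theta> $ i) + ln (scale_of \<theta>))"

definition mg_mle ::
  "nat \<Rightarrow> (nat \<Rightarrow> real^'n::{finite,linorder}) \<Rightarrow> (real^('n + unit)) option" where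
  "mg_mle = mle mg_family mg_params"

text \<open>The block matrix whose inverse is the asymptotic variance-covariance matrix; the trigamma
  function is \<open>Polygamma 1\<close>.\<close>

definition mg_block_matrix :: "real^'n \<Rightarrow> real \<Rightarrow> real^('n + unit)^('n + unit)" where
  "mg_block_matrix \<alpha> \<beta> =
     (\<chi> r c. case r of
        Inl i \<Rightarrow> (case c of
            Inl j \<Rightarrow> (if i = j then Polygamma 1 (\<alpha> $ i) else 0)
          | Inr _ \<Rightarrow> 1 / \<beta>)
      | Inr _ \<Rightarrow> (case c of
            Inl _ \<Rightarrow> 1 / \<beta>
          | Inr _ \<Rightarrow> (\<Sum>i\<in>UNIV. \<alpha> $ i) / \<beta>\<^sup>2))"

end

theory Submission
  imports Defs
begin

text \<open>The multivariate Gamma laws form an exponential family.  With the statistic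
\<open>h(x) = (ln z\<^sub>1, \<dots>, ln z\<^sub>k, x\<^sub>k)\<close>, where \<open>z\<close> denotes the increments of \<open>x\<close>, the log-density is affine in
\<open>h\<close> with natural parameters \<open>(\<alpha>, - 1 / \<beta>)\<close> and log-partition function
\<open>\<Sum>\<^sub>i (ln \<Gamma>(\<alpha>\<^sub>i) + \<alpha>\<^sub>i ln \<beta>)\<close>.  The likelihood equations say that the sample mean of \<open>h\<close> equals its
expectation \<open>e(\<theta>)\<close>.

The log-partition function is strictly convex in the natural parameters, coordinate by coordinate;
this reduces to the inequality \<open>\<psi>\<^sub>1(a) > 1 / a\<close> (\<open>Polygamma_1_gt_inverse\<close>,
\<open>gamma_log_partition_bregman_gt\<close>).  Strict convexity shows at the same time that a solution of the
likelihood equations is the strict maximum of the likelihood (\<open>mg_log_lik_maximal_iff\<close>), that the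
solution is unique and \<open>e\<close> is injective (\<open>inj_on_mg_mean\<close>), and hence that the maximum likelihood
estimator is \<open>e\<^sup>-\<^sup>1\<close> applied to the sample mean of \<open>h\<close> (\<open>mg_mle_moment_type\<close>).

The mean and covariance of \<open>h\<close> come from normalization alone.  Once the density is known to have mass 1
for all parameters (\<open>nn_integral_mg_density\<close>), the Laplace transform of \<open>h\<close> is a quotient of
normalizing constants, and its derivatives are the moments (\<open>mg_score_moments\<close>).

For the asymptotic law, replace \<open>h - e(\<theta>)\<close> by the score \<open>s\<close> in the parameters \<open>(\<alpha>, \<beta>)\<close>, which only
divides the last component by \<open>\<beta>\<^sup>2\<close>.  Its covariance is the block matrix \<open>B\<close> of the statement, and \<open>B\<close>
is also the derivative of the correspondingly scaled map \<open>e\<close> at \<open>\<theta>\<close>.  The estimator is a local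
inverse of this map evaluated at the mean score, so the delta method yields the covariance
\<open>B\<^sup>-\<^sup>1 B B\<^sup>-\<^sup>1 = B\<^sup>-\<^sup>1\<close> (\<open>asymptotic_covariance_inverse_moment_map\<close>).  The necessary multivariate
central limit theorem (\<open>multivariate_clt\<close>) is derived from the one on the line by the Cramer--Wold
device (\<open>cramer_wold\<close>), for which trigonometric polynomials replace characteristic functions.\<close>

section \<open>Convergence in law of random vectors\<close>

definition converges_in_law ::
  "'w measure \<Rightarrow> (nat \<Rightarrow> 'w \<Rightarrow> 'b::topological_space) \<Rightarrow> 'b measure \<Rightarrow> bool" where
  "converges_in_law M Y \<mu> \<longleftrightarrow>
     (\<forall>\<phi>::'b \<Rightarrow> real. continuous_on UNIV \<phi> \<and> bounded (range \<phi>) \<longrightarrow>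
        (\<lambda>N. LINT \<omega>|M. \<phi> (Y N \<omega>)) \<longlonglongrightarrow> (LINT y|\<mu>. \<phi> y))"

lemma converges_in_lawD:
  fixes \<phi> :: "'b::topological_space \<Rightarrow> real"
  assumes "converges_in_law M Y \<mu>" "continuous_on UNIV \<phi>" "\<And>y. \<bar>\<phi> y\<bar> \<le> B"
  shows "(\<lambda>N. LINT \<omega>|M. \<phi> (Y N \<omega>)) \<longlonglongrightarrow> (LINT y|\<mu>. \<phi> y)"
proof -
  have "bounded (range \<phi>)"
    unfolding bounded_iff using assms(3) by auto
  then show ?thesis using assms unfolding converges_in_law_def by blast
qed

text \<open>The common skeleton of both limit theorems below: expectations of \<open>f N\<close> converge as soon as
\<open>f N\<close> and its candidate limit \<open>g\<close> are both within an error \<open>r\<close> of something whose expectations are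
already known to converge, provided the expected error also converges and is small in the limit.
Tightness of the sequence enters through \<open>r\<close>, which will contain a continuous cutoff function whose
expectation passes to the limit.\<close>

lemma tendsto_integral_by_approximation:
  fixes f :: "nat \<Rightarrow> 'w \<Rightarrow> real" and g :: "'b \<Rightarrow> real"
  assumes f: "\<forall>\<^sub>F N in sequentially. integrable M (f N)" and g: "integrable \<mu> g"
    and approx: "\<And>e. e > 0 \<Longrightarrow> \<exists>q r q' r'.
        (\<forall>N. integrable M (q N)) \<and> (\<forall>N. integrable M (r N)) \<and> integrable \<mu> q' \<and> integrable \<mu> r' \<and>
        (\<lambda>N. LINT \<omega>|M. q N \<omega>) \<longlonglongrightarrow> (LINT y|\<mu>. q' y) \<and> (\<lambda>N. LINT \<omega>|M. r N \<omega>) \<longlonglongrightarrow> (LINT y|\<mu>. r' y) \<and>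
        (\<forall>\<^sub>F N in sequentially. AE \<omega> in M. \<bar>f N \<omega> - q N \<omega>\<bar> \<le> r N \<omega>) \<and>
        (\<forall>y. \<bar>g y - q' y\<bar> \<le> r' y) \<and> (LINT y|\<mu>. r' y) \<le> e"
  shows "(\<lambda>N. LINT \<omega>|M. f N \<omega>) \<longlonglongrightarrow> (LINT y|\<mu>. g y)"
proof (rule tendstoI)
  fix e :: real assume "e > 0"
  then obtain q r q' r' where
    q: "\<And>N. integrable M (q N)" and r: "\<And>N. integrable M (r N)"
    and q': "integrable \<mu> q'" and r': "integrable \<mu> r'"
    and ql: "(\<lambda>N. LINT \<omega>|M. q N \<omega>) \<longlonglongrightarrow> (LINT y|\<mu>. q' y)"
    and rl: "(\<lambda>N. LINT \<omega>|M. r N \<omega>) \<longlonglongrightarrow> (LINT y|\<mu>. r' y)"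
    and fq: "\<forall>\<^sub>F N in sequentially. AE \<omega> in M. \<bar>f N \<omega> - q N \<omega>\<bar> \<le> r N \<omega>"
    and gq: "\<And>y. \<bar>g y - q' y\<bar> \<le> r' y" and small: "(LINT y|\<mu>. r' y) \<le> e/5"
    using approx[of "e/5"] by auto
  have 1: "\<bar>(LINT y|\<mu>. g y) - (LINT y|\<mu>. q' y)\<bar> \<le> (LINT y|\<mu>. r' y)"
  proof -
    have "\<bar>(LINT y|\<mu>. g y) - (LINT y|\<mu>. q' y)\<bar> = \<bar>LINT y|\<mu>. (g y - q' y)\<bar>" using g q' by simp
    also have "\<dots> \<le> (LINT y|\<mu>. \<bar>g y - q' y\<bar>)" by (rule integral_abs_bound)
    also have "\<dots> \<le> (LINT y|\<mu>. r' y)" using g q' r' gq by (intro integral_mono) auto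
    finally show ?thesis .
  qed
  have "\<forall>\<^sub>F N in sequentially. \<bar>(LINT \<omega>|M. q N \<omega>) - (LINT y|\<mu>. q' y)\<bar> < e/5"
    using tendstoD[OF ql, of "e/5"] \<open>e>0\<close> by (simp add: dist_real_def)
  moreover have "\<forall>\<^sub>F N in sequentially. \<bar>(LINT \<omega>|M. r N \<omega>) - (LINT y|\<mu>. r' y)\<bar> < e/5"
    using tendstoD[OF rl, of "e/5"] \<open>e>0\<close> by (simp add: dist_real_def)
  ultimately show "\<forall>\<^sub>F N in sequentially. dist (LINT \<omega>|M. f N \<omega>) (LINT y|\<mu>. g y) < e"
    using fq f
  proof eventually_elim
    case (elim N)
    have "\<bar>(LINT \<omega>|M. f N \<omega>) - (LINT \<omega>|M. q N \<omega>)\<bar> = \<bar>LINT \<omega>|M. (f N \<omega> - q N \<omega>)\<bar>"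
      using elim q by simp
    also have "\<dots> \<le> (LINT \<omega>|M. \<bar>f N \<omega> - q N \<omega>\<bar>)" by (rule integral_abs_bound)
    also have "\<dots> \<le> (LINT \<omega>|M. r N \<omega>)" using elim q r by (intro integral_mono_AE) auto
    finally show ?case using elim 1 small \<open>e > 0\<close> unfolding dist_real_def by linarith
  qed
qed

text \<open>Tightness of a single law, phrased with a continuous cutoff instead of a tail probability so that
convergence in law can be applied to it.\<close>

lemma cutoff_integral_small:
  fixes h :: "'b \<Rightarrow> real"
  assumes "prob_space \<mu>" "h \<in> borel_measurable \<mu>" "e > 0"
  shows "\<exists>R>0. (LINT y|\<mu>. min 1 (max 0 (h y - R))) \<le> e"
proof -
  interpret prob_space \<mu> by fact
  have "(\<lambda>n. LINT y|\<mu>. min 1 (max 0 (h y - real (Suc n)))) \<longlonglongrightarrow> (LINT y|\<mu>. 0)"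
  proof (rule integral_dominated_convergence[where w="\<lambda>_. 1"])
    show "AE y in \<mu>. (\<lambda>n. min 1 (max 0 (h y - real (Suc n)))) \<longlonglongrightarrow> 0"
    proof (intro AE_I2 tendsto_eventually)
      fix y
      obtain m where "h y < real m" using reals_Archimedean2 by blast
      then show "\<forall>\<^sub>F n in sequentially. min 1 (max 0 (h y - real (Suc n))) = 0"
        by (intro eventually_sequentiallyI[of m]) auto
    qed
  qed (use assms in auto)
  then have "\<forall>\<^sub>F n in sequentially. dist (LINT y|\<mu>. min 1 (max 0 (h y - real (Suc n)))) 0 < e"
    using \<open>e>0\<close> by (auto dest: tendstoD)
  then obtain n where "dist (LINT y|\<mu>. min 1 (max 0 (h y - real (Suc n)))) 0 < e"
    by (auto simp: eventually_sequentially)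
  then show ?thesis by (intro exI[of _ "real (Suc n)"]) auto
qed

text \<open>The continuous mapping theorem for maps \<open>\<psi> N\<close> that vary with \<open>N\<close>: local uniform convergence is
enough since, up to a small error, \<open>Y N\<close> lives in a fixed ball.  Only values of \<open>\<psi> N\<close> on bounded
sets matter, which is what makes the delta method work with an estimator that exists only locally.\<close>

lemma converges_in_law_locally_uniform:
  fixes Y :: "nat \<Rightarrow> 'w \<Rightarrow> 'b::euclidean_space"
  assumes "prob_space M" "prob_space \<mu>" "sets \<mu> = sets borel"
    and Y: "\<And>N. Y N \<in> borel_measurable M" and conv: "converges_in_law M Y \<mu>"
    and f: "\<And>N. N \<ge> 1 \<Longrightarrow> f N \<in> borel_measurable M"
    and B: "\<And>N \<omega>. \<bar>f N \<omega>\<bar> \<le> B"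
    and g: "continuous_on UNIV g" "\<And>y. \<bar>g y\<bar> \<le> (B::real)"
    and fg: "\<And>N. N \<ge> 1 \<Longrightarrow> AE \<omega> in M. f N \<omega> = \<psi> N (Y N \<omega>)"
    and unif: "\<And>R. uniform_limit (cball 0 R) \<psi> g sequentially"
  shows "(\<lambda>N. LINT \<omega>|M. f N \<omega>) \<longlonglongrightarrow> (LINT y|\<mu>. g y)"
proof (rule tendsto_integral_by_approximation)
  interpret M: prob_space M by fact
  interpret \<mu>: prob_space \<mu> by fact
  note [measurable] = Y
  have gm[measurable]: "g \<in> borel_measurable borel" using g(1) by (rule borel_measurable_continuous_onI)
  have meas\<mu>: "h \<in> borel_measurable \<mu>" if "h \<in> borel_measurable borel" for h :: "'b \<Rightarrow> real"
    using that measurable_cong_sets[OF assms(3) refl] by blast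
  show "\<forall>\<^sub>F N in sequentially. integrable M (f N)"
    using eventually_ge_at_top[of 1]
    by eventually_elim (rule M.integrable_const_bound[where B=B], use B f in auto)
  show "integrable \<mu> g"
    by (rule \<mu>.integrable_const_bound[where B=B]) (use g meas\<mu>[OF gm] in auto)
  have B0: "B \<ge> 0" using g(2)[of 0] by linarith
  fix e :: real assume "e > 0"
  define d where "d = e / (2 * (2 * B + 1))"
  have "d > 0" using \<open>e>0\<close> B0 by (simp add: d_def)
  obtain R where R: "R > 0" "(LINT y|\<mu>. min 1 (max 0 (norm y - R))) \<le> d"
    using cutoff_integral_small[OF \<open>prob_space \<mu>\<close> meas\<mu>[OF borel_measurable_norm] \<open>d > 0\<close>]
    by blast
  define cut :: "'b \<Rightarrow> real" where "cut y = min 1 (max 0 (norm y - R))" for y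
  \<comment> \<open>on the ball of radius \<open>R + 1\<close> the first summand bounds the error; outside it the cutoff is 1 and the second one bounds the error\<close>
  define r :: "'b \<Rightarrow> real" where "r y = e/2 + 2 * B * cut y" for y
  have cut_c: "continuous_on UNIV cut" unfolding cut_def by (intro continuous_intros)
  have cut_b: "0 \<le> cut y" "cut y \<le> 1" for y by (auto simp: cut_def)
  have rc: "continuous_on UNIV r" unfolding r_def by (intro continuous_intros cut_c)
  then have rm[measurable]: "r \<in> borel_measurable borel" by (rule borel_measurable_continuous_onI)
  have cut_m[measurable]: "cut \<in> borel_measurable borel" using cut_c by (rule borel_measurable_continuous_onI)
  have rb: "\<bar>r y\<bar> \<le> e/2 + 2 * B" for y
    using cut_b[of y] B0 \<open>e>0\<close> mult_left_mono[OF cut_b(2)[of y], of "2*B"] unfolding r_def by auto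
  show "\<exists>q r q' r'.
        (\<forall>N. integrable M (q N)) \<and> (\<forall>N. integrable M (r N)) \<and> integrable \<mu> q' \<and> integrable \<mu> r' \<and>
        (\<lambda>N. LINT \<omega>|M. q N \<omega>) \<longlonglongrightarrow> (LINT y|\<mu>. q' y) \<and> (\<lambda>N. LINT \<omega>|M. r N \<omega>) \<longlonglongrightarrow> (LINT y|\<mu>. r' y) \<and>
        (\<forall>\<^sub>F N in sequentially. AE \<omega> in M. \<bar>f N \<omega> - q N \<omega>\<bar> \<le> r N \<omega>) \<and>
        (\<forall>y. \<bar>g y - q' y\<bar> \<le> r' y) \<and> (LINT y|\<mu>. r' y) \<le> e"
  proof (intro exI conjI allI)
    show "integrable M (\<lambda>\<omega>. g (Y N \<omega>))" for N
      by (rule M.integrable_const_bound[where B=B]) (use g in auto)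
    show "integrable M (\<lambda>\<omega>. r (Y N \<omega>))" for N
      by (rule M.integrable_const_bound[where B="e/2+2*B"]) (use rb in auto)
    show "integrable \<mu> g" by fact
    show "integrable \<mu> r"
      by (rule \<mu>.integrable_const_bound[where B="e/2+2*B"]) (use rb meas\<mu>[OF rm] in auto)
    show "(\<lambda>N. LINT \<omega>|M. g (Y N \<omega>)) \<longlonglongrightarrow> (LINT y|\<mu>. g y)"
      by (rule converges_in_lawD[OF conv g])
    show "(\<lambda>N. LINT \<omega>|M. r (Y N \<omega>)) \<longlonglongrightarrow> (LINT y|\<mu>. r y)"
      by (rule converges_in_lawD[OF conv rc rb])
    show "\<bar>g y - g y\<bar> \<le> r y" for y using cut_b[of y] B0 \<open>e>0\<close> by (simp add: r_def)
    have "integrable \<mu> cut"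
      by (rule \<mu>.integrable_const_bound[where B=1]) (use cut_b meas\<mu>[OF cut_m] in auto)
    then have "(LINT y|\<mu>. r y) = e/2 + 2 * B * (LINT y|\<mu>. cut y)"
      unfolding r_def by (simp add: \<mu>.prob_space)
    also have "\<dots> \<le> e/2 + 2 * B * d"
      using R(2) B0 unfolding cut_def by (intro add_left_mono mult_left_mono) auto
    also have "\<dots> \<le> e"
    proof -
      have "2 * B * d = e/2 * (2*B/(2*B+1))" using B0 by (simp add: d_def field_simps)
      also have "\<dots> \<le> e/2 * 1" using B0 \<open>e>0\<close> by (intro mult_left_mono) auto
      finally show ?thesis by simp
    qed
    finally show "(LINT y|\<mu>. r y) \<le> e" .
    have "\<forall>\<^sub>F N in sequentially. \<forall>y\<in>cball 0 (R+1). dist (\<psi> N y) (g y) < e/2"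
      using unif[of "R+1"] half_gt_zero[OF \<open>e>0\<close>] unfolding uniform_limit_iff by blast
    then show "\<forall>\<^sub>F N in sequentially. AE \<omega> in M. \<bar>f N \<omega> - g (Y N \<omega>)\<bar> \<le> r (Y N \<omega>)"
      using eventually_ge_at_top[of 1]
    proof eventually_elim
      case (elim N)
      show ?case using fg[OF elim(2)]
      proof eventually_elim
        case (elim \<omega>)
        show ?case
        proof (cases "norm (Y N \<omega>) \<le> R + 1")
          case True
          then have "\<bar>f N \<omega> - g (Y N \<omega>)\<bar> < e/2"
            using \<open>\<forall>y\<in>cball 0 (R+1). _\<close> elim by (auto simp: dist_real_def)
          moreover have "0 \<le> 2 * B * cut (Y N \<omega>)" using cut_b B0 by simp
          ultimately show ?thesis unfolding r_def by linarith
        next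
          case False
          then have "cut (Y N \<omega>) = 1" by (simp add: cut_def)
          then show ?thesis using B[of N \<omega>] g(2)[of "Y N \<omega>"] \<open>e > 0\<close> by (simp add: r_def)
        qed
      qed
    qed
  qed
qed

text \<open>Trigonometric polynomials with arbitrary frequencies.  They form an algebra, and their expectations
only involve the laws of the one-dimensional projections \<open>t \<bullet> x\<close>.\<close>

inductive_set trig_polys :: "('b::real_inner \<Rightarrow> real) set" where
  cos: "(\<lambda>x. a * cos (t \<bullet> x)) \<in> trig_polys"
| sin: "(\<lambda>x. a * sin (t \<bullet> x)) \<in> trig_polys"
| add: "f \<in> trig_polys \<Longrightarrow> g \<in> trig_polys \<Longrightarrow> (\<lambda>x. f x + g x) \<in> trig_polys"

lemma trig_polys_const: "(\<lambda>x. c) \<in> trig_polys"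
  using trig_polys.cos[of c 0] by simp

lemma trig_polys_sum: "(\<And>i. i \<in> I \<Longrightarrow> f i \<in> trig_polys) \<Longrightarrow> (\<lambda>x. \<Sum>i\<in>I. f i x) \<in> trig_polys"
  by (induction I rule: infinite_finite_induct) (auto intro: trig_polys_const trig_polys.add)

lemma trig_polys_cos_mult:
  assumes "g \<in> trig_polys"
  shows "(\<lambda>x. a * cos (t \<bullet> x) * g x) \<in> trig_polys"
  using assms
proof induction
  case (cos b s)
  have "(\<lambda>x. a * cos (t \<bullet> x) * (b * cos (s \<bullet> x))) =
     (\<lambda>x. (a * b / 2) * cos ((t - s) \<bullet> x) + (a * b / 2) * cos ((t + s) \<bullet> x))"
    by (rule ext) (simp add: inner_diff_left inner_add_left cos_add cos_diff field_simps)
  then show ?case by (simp only: trig_polys.intros)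
next
  case (sin b s)
  have "(\<lambda>x. a * cos (t \<bullet> x) * (b * sin (s \<bullet> x))) =
     (\<lambda>x. (a * b / 2) * sin ((s + t) \<bullet> x) + (a * b / 2) * sin ((s - t) \<bullet> x))"
    by (rule ext) (simp add: inner_diff_left inner_add_left sin_add sin_diff field_simps)
  then show ?case by (simp only: trig_polys.intros)
next
  case (add f g)
  then show ?case using trig_polys.add[OF add.IH] by (simp add: distrib_left)
qed

lemma trig_polys_sin_mult:
  assumes "g \<in> trig_polys"
  shows "(\<lambda>x. a * sin (t \<bullet> x) * g x) \<in> trig_polys"
  using assms
proof induction
  case (cos b s)
  have "(\<lambda>x. a * sin (t \<bullet> x) * (b * cos (s \<bullet> x))) =
     (\<lambda>x. (a * b / 2) * sin ((t + s) \<bullet> x) + (a * b / 2) * sin ((t - s) \<bullet> x))"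
    by (rule ext) (simp add: inner_diff_left inner_add_left sin_add sin_diff field_simps)
  then show ?case by (simp only: trig_polys.intros)
next
  case (sin b s)
  have "(\<lambda>x. a * sin (t \<bullet> x) * (b * sin (s \<bullet> x))) =
     (\<lambda>x. (a * b / 2) * cos ((t - s) \<bullet> x) + (- a * b / 2) * cos ((t + s) \<bullet> x))"
    by (rule ext) (simp add: inner_diff_left inner_add_left cos_add cos_diff field_simps)
  then show ?case by (simp only: trig_polys.intros)
next
  case (add f g)
  then show ?case using trig_polys.add[OF add.IH] by (simp add: distrib_left)
qed

lemma trig_polys_mult:
  assumes "f \<in> trig_polys" "g \<in> trig_polys"
  shows "(\<lambda>x. f x * g x) \<in> trig_polys"
  using assms(1)
proof induction
  case (add f1 f2)
  then show ?case using trig_polys.add[OF add.IH] by (simp add: distrib_right)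
qed (use assms(2) trig_polys_cos_mult trig_polys_sin_mult in auto)

lemma trig_polys_continuous_bounded:
  assumes "p \<in> trig_polys"
  shows "continuous_on UNIV p" "\<exists>C. \<forall>x. \<bar>p x\<bar> \<le> C"
  using assms
proof induction
  case (cos a t)
  { case 1 show ?case by (intro continuous_intros) }
  { case 2 show ?case by (intro exI[of _ "\<bar>a\<bar>"]) (simp add: abs_mult mult_left_le) }
next
  case (sin a t)
  { case 1 show ?case by (intro continuous_intros) }
  { case 2 show ?case by (intro exI[of _ "\<bar>a\<bar>"]) (simp add: abs_mult mult_left_le) }
next
  case (add f g)
  { case 1 show ?case using add by (intro continuous_intros) auto }
  { case 2
    obtain C D where "\<forall>x. \<bar>f x\<bar> \<le> C" "\<forall>x. \<bar>g x\<bar> \<le> D" using add by blast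
    then show ?case by (intro exI[of _ "C + D"]) (metis abs_triangle_ineq add_mono order_trans) }
qed

text \<open>A bounded continuous function is approximated on a cube by a trigonometric polynomial that is
bounded everywhere by almost the same constant.  Both come at once from the substitution
\<open>w $ i = sin (x $ i / R)\<close>: the function \<open>w \<mapsto> \<phi> (R arcsin w)\<close> is continuous on the cube
\<open>[-1, 1]^d\<close>, hence uniformly close there to a polynomial (Stone--Weierstrass), and \<open>sin\<close> maps all of
space into that cube.\<close>

lemma trig_approximation:
  fixes \<phi> :: "real^'d \<Rightarrow> real"
  assumes \<phi>: "continuous_on UNIV \<phi>" "\<And>x. \<bar>\<phi> x\<bar> \<le> B" and "R > 0" "e > 0"
  obtains p where "p \<in> trig_polys" "\<And>x. \<bar>p x\<bar> \<le> B + e" "\<And>x. (\<forall>i. \<bar>x $ i\<bar> \<le> R) \<Longrightarrow> \<bar>\<phi> x - p x\<bar> \<le> e"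
proof -
  define cube :: "(real^'d) set" where "cube = cbox (\<chi> i. - 1) (\<chi> i. 1)"
  define \<rho> :: "real^'d \<Rightarrow> real^'d" where "\<rho> w = (\<chi> i. R * arcsin (w $ i))" for w
  define S :: "real^'d \<Rightarrow> real^'d" where "S x = (\<chi> i. sin (x $ i / R))" for x
  have cube: "w \<in> cube \<longleftrightarrow> (\<forall>i. -1 \<le> w $ i \<and> w $ i \<le> 1)" for w
    by (simp add: cube_def mem_box_cart)
  have "continuous_on cube \<rho>"
    unfolding \<rho>_def by (intro continuous_intros) (auto simp: cube)
  then have "continuous_on cube (\<lambda>w. \<phi> (\<rho> w))"
    by (rule continuous_on_compose2[OF \<phi>(1)]) auto
  moreover have "compact cube" by (simp add: cube_def)
  ultimately obtain q where q: "real_polynomial_function q" "\<And>w. w \<in> cube \<Longrightarrow> \<bar>\<phi> (\<rho> w) - q w\<bar> < e"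
    using Stone_Weierstrass_real_polynomial_function[of cube "\<lambda>w. \<phi> (\<rho> w)" e] \<open>e>0\<close> by blast
  have S: "S x \<in> cube" for x by (simp add: S_def cube)
  have "(\<lambda>x. q (S x)) \<in> trig_polys"
    using q(1)
  proof induction
    case (linear f)
    have "f (S x) = (\<Sum>i\<in>UNIV. f (axis i 1) * sin (((1/R) *\<^sub>R axis i 1) \<bullet> x))" for x
    proof -
      have "f (S x) = f (\<Sum>i\<in>UNIV. S x $ i *\<^sub>R axis i 1)"
        using basis_expansion[of "S x"] by (simp add: scalar_mult_eq_scaleR)
      also have "\<dots> = (\<Sum>i\<in>UNIV. S x $ i * f (axis i 1))"
        using linear by (simp add: linear_sum linear_cmul bounded_linear.linear)
      finally show ?thesis by (simp add: S_def inner_axis' mult.commute)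
    qed
    then show ?case by (simp only: trig_polys_sum trig_polys.sin)
  next
    case (const c) show ?case by (rule trig_polys_const)
  next
    case (add f g) then show ?case using trig_polys.add by blast
  next
    case (mult f g) then show ?case using trig_polys_mult by blast
  qed
  moreover have "\<bar>q (S x)\<bar> \<le> B + e" for x
    using q(2)[OF S[of x]] \<phi>(2)[of "\<rho> (S x)"] by linarith
  moreover have "\<bar>\<phi> x - q (S x)\<bar> \<le> e" if "\<forall>i. \<bar>x $ i\<bar> \<le> R" for x
  proof -
    have "R * arcsin (sin (x $ i / R)) = x $ i" for i
    proof -
      have "\<bar>x $ i / R\<bar> \<le> 1" using that \<open>R>0\<close> by simp
      \<comment> \<open>\<open>arcsin\<close> inverts \<open>sin\<close> only up to \<open>pi / 2\<close>, and \<open>x $ i / R\<close> stays within 1\<close>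
      moreover have "1 \<le> pi/2" using pi_ge_two by simp
      ultimately have "arcsin (sin (x $ i / R)) = x $ i / R"
        by (intro arcsin_sin) linarith+
      then show ?thesis using \<open>R>0\<close> by simp
    qed
    then have "\<rho> (S x) = x" by (simp add: \<rho>_def S_def vec_eq_iff)
    then show ?thesis using q(2)[OF S[of x]] by simp
  qed
  ultimately show thesis by (rule that)
qed

text \<open>The Cramer--Wold device.  The hypothesis gives convergence of the expectations of trigonometric
polynomials, and also of the coordinatewise cutoff functions; the latter control the mass outside a
cube, on which trigonometric polynomials are uniformly dense.\<close>

theorem cramer_wold:
  fixes Y :: "nat \<Rightarrow> 'w \<Rightarrow> real^'d"
  assumes "prob_space M" "prob_space \<mu>" "sets \<mu> = sets borel"
    and Y: "\<And>N. Y N \<in> borel_measurable M"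
    and proj: "\<And>t. converges_in_law M (\<lambda>N \<omega>. t \<bullet> Y N \<omega>) (distr \<mu> borel (\<lambda>y. t \<bullet> y))"
  shows "converges_in_law M Y \<mu>"
  unfolding converges_in_law_def
proof (intro allI impI, elim conjE)
  fix \<phi> :: "real^'d \<Rightarrow> real"
  assume \<phi>: "continuous_on UNIV \<phi>" and bd: "bounded (range \<phi>)"
  interpret M: prob_space M by fact
  interpret \<mu>: prob_space \<mu> by fact
  note [measurable] = Y
  have meas\<mu>: "h \<in> borel_measurable \<mu>" if "h \<in> borel_measurable borel" for h :: "real^'d \<Rightarrow> real"
    using that measurable_cong_sets[OF assms(3) refl] by blast
  obtain B where B: "\<And>x. \<bar>\<phi> x\<bar> \<le> B" using bd unfolding bounded_iff by auto
  have B0: "B \<ge> 0" using B[of 0] by linarith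
  have cm: "h \<in> borel_measurable borel" if "continuous_on UNIV h" for h :: "real^'d \<Rightarrow> real"
    using that by (rule borel_measurable_continuous_onI)
  have int: "integrable M (\<lambda>\<omega>. h (Y N \<omega>))" "integrable \<mu> h"
    if "continuous_on UNIV h" "\<And>x. \<bar>h x\<bar> \<le> C" for h :: "real^'d \<Rightarrow> real" and C N
    using cm[OF that(1)] meas\<mu>[OF cm[OF that(1)]] that
    by (auto intro: M.integrable_const_bound[where B=C] \<mu>.integrable_const_bound[where B=C])
  have proj': "(\<lambda>N. LINT \<omega>|M. k (t \<bullet> Y N \<omega>)) \<longlonglongrightarrow> (LINT y|\<mu>. k (t \<bullet> y))"
    if "continuous_on UNIV k" "\<And>x. \<bar>k x\<bar> \<le> C" for k :: "real \<Rightarrow> real" and C t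
  proof -
    have "(\<lambda>y. t \<bullet> y) \<in> borel_measurable \<mu>" by (rule meas\<mu>) measurable
    then have "(LINT s|distr \<mu> borel (\<lambda>y. t \<bullet> y). k s) = (LINT y|\<mu>. k (t \<bullet> y))"
      using that(1) by (intro integral_distr borel_measurable_continuous_onI)
    then show ?thesis using converges_in_lawD[OF proj that, of t] by simp
  qed
  have trig: "(\<lambda>N. LINT \<omega>|M. p (Y N \<omega>)) \<longlonglongrightarrow> (LINT y|\<mu>. p y)" if "p \<in> trig_polys" for p
    using that
  proof induction
    case (cos a t)
    show ?case by (rule proj'[of "\<lambda>s. a * cos s" "\<bar>a\<bar>"])
        (auto intro!: continuous_intros simp: abs_mult mult_left_le)
  next
    case (sin a t)
    show ?case by (rule proj'[of "\<lambda>s. a * sin s" "\<bar>a\<bar>"])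
        (auto intro!: continuous_intros simp: abs_mult mult_left_le)
  next
    case (add f g)
    obtain C D where "\<forall>x. \<bar>f x\<bar> \<le> C" "\<forall>x. \<bar>g x\<bar> \<le> D" using add trig_polys_continuous_bounded by meson
    then have "integrable M (\<lambda>\<omega>. f (Y N \<omega>))" "integrable \<mu> f" "integrable M (\<lambda>\<omega>. g (Y N \<omega>))" "integrable \<mu> g" for N
      using int trig_polys_continuous_bounded add by metis+
    then show ?case using tendsto_add[OF add.IH] by simp
  qed
  show "(\<lambda>N. LINT \<omega>|M. \<phi> (Y N \<omega>)) \<longlonglongrightarrow> (LINT y|\<mu>. \<phi> y)"
  proof (rule tendsto_integral_by_approximation)
    show "\<forall>\<^sub>F N in sequentially. integrable M (\<lambda>\<omega>. \<phi> (Y N \<omega>))" "integrable \<mu> \<phi>"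
      using int[OF \<phi> B] by auto
    fix e :: real assume "e > 0"
    define d where "d = e / (2 * (2 * B + e))"
    have "d > 0" using \<open>e>0\<close> B0 by (simp add: d_def)
    define d' where "d' = d / real CARD('d)"
    have "d' > 0" using \<open>d>0\<close> by (simp add: d'_def)
    have "\<exists>R>0. (LINT y|\<mu>. min 1 (max 0 (\<bar>y $ i\<bar> - R))) \<le> d'" for i
      by (rule cutoff_integral_small[OF \<open>prob_space \<mu>\<close> _ \<open>d' > 0\<close>]) (rule meas\<mu>, measurable)
    then obtain Ri where Ri: "\<And>i. Ri i > 0" "\<And>i. (LINT y|\<mu>. min 1 (max 0 (\<bar>y $ i\<bar> - Ri i))) \<le> d'" by metis
    define cut where "cut i y = min 1 (max 0 (\<bar>y $ i\<bar> - Ri i))" for i and y :: "real^'d"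
    define R where "R = Max (range Ri) + 1"
    have RiR: "Ri i + 1 \<le> R" for i unfolding R_def by simp
    have "R > 0" using RiR[of undefined] Ri(1)[of undefined] by linarith
    obtain p where p: "p \<in> trig_polys" "\<And>x. \<bar>p x\<bar> \<le> B + e/2"
      "\<And>x. (\<forall>i. \<bar>x $ i\<bar> \<le> R) \<Longrightarrow> \<bar>\<phi> x - p x\<bar> \<le> e/2"
      using trig_approximation[OF \<phi> B \<open>R>0\<close>, of "e/2"] \<open>e>0\<close> by auto
    define r where "r y = e/2 + (2 * B + e) * (\<Sum>i\<in>UNIV. cut i y)" for y
    have cut_c: "continuous_on UNIV (cut i)" for i unfolding cut_def by (intro continuous_intros)
    have cut_b: "\<bar> cut i y\<bar> \<le> 1" "0 \<le> cut i y" for i y unfolding cut_def by auto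
    have cut_lim: "(\<lambda>N. LINT \<omega>|M. cut i (Y N \<omega>)) \<longlonglongrightarrow> (LINT y|\<mu>. cut i y)" for i
    proof -
      have "continuous_on UNIV (\<lambda>s. min 1 (max 0 (\<bar>s\<bar> - Ri i)))" by (intro continuous_intros)
      then show ?thesis using proj'[of "\<lambda>s. min 1 (max 0 (\<bar>s\<bar> - Ri i))" 1 "axis i 1"]
        by (simp add: cut_def inner_axis')
    qed
    note cut_int = int[OF cut_c cut_b(1)]
    have rM: "integrable M (\<lambda>\<omega>. r (Y N \<omega>))" "integrable \<mu> r" for N
      unfolding r_def using cut_int by (auto intro!: integrable_add integrable_mult_right integrable_sum)
    have rint: "(LINT \<omega>|M. r (Y N \<omega>)) = e/2 + (2 * B + e) * (\<Sum>i\<in>UNIV. LINT \<omega>|M. cut i (Y N \<omega>))" for N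
      unfolding r_def using cut_int by (simp add: M.prob_space)
    have rint': "(LINT y|\<mu>. r y) = e/2 + (2 * B + e) * (\<Sum>i\<in>UNIV. LINT y|\<mu>. cut i y)"
      unfolding r_def using cut_int by (simp add: \<mu>.prob_space)
    have pr: "\<bar>\<phi> y - p y\<bar> \<le> r y" for y
    proof (cases "\<forall>i. \<bar>y $ i\<bar> \<le> R")
      case True
      then show ?thesis using p(3)[of y] B0 \<open>e>0\<close> cut_b(2)
        unfolding r_def by (smt (verit) mult_nonneg_nonneg sum_nonneg)
    next
      case False
      then obtain i where i: "\<bar>y $ i\<bar> > R" by (auto simp: not_le)
      then have "cut i y = 1" using RiR[of i] by (simp add: cut_def)
      moreover have "cut i y \<le> (\<Sum>i\<in>UNIV. cut i y)" by (rule member_le_sum) (use cut_b in auto)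
      ultimately have "(2 * B + e) * 1 \<le> (2 * B + e) * (\<Sum>i\<in>UNIV. cut i y)"
        using B0 \<open>e>0\<close> by (intro mult_left_mono) auto
      moreover have "\<bar>\<phi> y - p y\<bar> \<le> e/2 + (2 * B + e) * 1"
        using abs_triangle_ineq4[of "\<phi> y" "p y"] add_mono[OF B[of y] p(2)[of y]] \<open>e>0\<close> by simp
      ultimately show ?thesis unfolding r_def by linarith
    qed
    have "(LINT y|\<mu>. cut i y) \<le> d'" for i
      using Ri(2)[of i] unfolding cut_def .
    then have "(LINT y|\<mu>. r y) \<le> e/2 + (2 * B + e) * (\<Sum>i\<in>(UNIV::'d set). d')"
      unfolding rint' using B0 \<open>e>0\<close>
      by (intro add_left_mono mult_left_mono sum_mono) auto
    also have "(\<Sum>i\<in>(UNIV::'d set). d') = d" by (simp add: d'_def)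
    also have "e/2 + (2 * B + e) * d = e" using B0 \<open>e>0\<close> by (simp add: d_def field_simps)
    finally have rsmall: "(LINT y|\<mu>. r y) \<le> e" .
    have "(\<lambda>N. LINT \<omega>|M. r (Y N \<omega>)) \<longlonglongrightarrow> (LINT y|\<mu>. r y)"
      unfolding rint rint' by (intro tendsto_intros cut_lim)
    then show "\<exists>q r q' r'.
        (\<forall>N. integrable M (q N)) \<and> (\<forall>N. integrable M (r N)) \<and> integrable \<mu> q' \<and> integrable \<mu> r' \<and>
        (\<lambda>N. LINT \<omega>|M. q N \<omega>) \<longlonglongrightarrow> (LINT y|\<mu>. q' y) \<and> (\<lambda>N. LINT \<omega>|M. r N \<omega>) \<longlonglongrightarrow> (LINT y|\<mu>. r' y) \<and>
        (\<forall>\<^sub>F N in sequentially. AE \<omega> in M. \<bar>\<phi> (Y N \<omega>) - q N \<omega>\<bar> \<le> r N \<omega>) \<and>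
        (\<forall>y. \<bar>\<phi> y - q' y\<bar> \<le> r' y) \<and> (LINT y|\<mu>. r' y) \<le> e"
      using trig[OF p(1)] int[OF trig_polys_continuous_bounded(1)[OF p(1)] p(2)] rM pr rsmall
      by (intro exI[of _ "\<lambda>N \<omega>. p (Y N \<omega>)"] exI[of _ "\<lambda>N \<omega>. r (Y N \<omega>)"] exI[of _ p] exI[of _ r]) auto
  qed
qed

section \<open>The multivariate central limit theorem\<close>

lemma (in prob_space) indep_sets_reindex:
  assumes "indep_sets F I" "inj_on f J" "f ` J \<subseteq> I"
  shows "indep_sets (\<lambda>j. F (f j)) J"
  unfolding indep_sets_def
proof (intro conjI ballI allI impI)
  show "F (f j) \<subseteq> events" if "j \<in> J" for j
    using assms that by (auto simp: indep_sets_def)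
next
  fix K A assume K: "K \<subseteq> J" "K \<noteq> {}" "finite K" and A: "A \<in> (\<Pi> j\<in>K. F (f j))"
  have inj: "inj_on f K" using assms(2) K(1) inj_on_subset by blast
  define g where "g = the_inv_into K f"
  have g: "g (f j) = j" if "j \<in> K" for j
    using that inj by (simp add: g_def the_inv_into_f_f)
  have "prob (\<Inter>i\<in>f ` K. A (g i)) = (\<Prod>i\<in>f ` K. prob (A (g i)))"
  proof -
    have "\<forall>B\<in>(\<Pi> i\<in>f ` K. F i). prob (\<Inter>i\<in>f ` K. B i) = (\<Prod>i\<in>f ` K. prob (B i))"
    proof -
      have "f ` K \<subseteq> I" "f ` K \<noteq> {}" "finite (f ` K)" using K assms(3) by auto
      then show ?thesis using assms(1) unfolding indep_sets_def by blast
    qed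
    moreover have "(\<lambda>i. A (g i)) \<in> (\<Pi> i\<in>f ` K. F i)"
      using A g by (auto simp: Pi_iff)
    ultimately show ?thesis by (rule bspec)
  qed
  also have "\<dots> = (\<Prod>j\<in>K. prob (A j))"
    using inj g by (simp add: prod.reindex)
  also have "(\<Inter>i\<in>f ` K. A (g i)) = (\<Inter>j\<in>K. A j)"
    using g by auto
  finally show "prob (\<Inter>j\<in>K. A j) = (\<Prod>j\<in>K. prob (A j))" .
qed

lemma (in prob_space) indep_vars_reindex:
  assumes "indep_vars M' X I" "inj_on f J" "f ` J \<subseteq> I"
  shows "indep_vars (\<lambda>j. M' (f j)) (\<lambda>j. X (f j)) J"
  using assms indep_sets_reindex[OF _ assms(2,3)] unfolding indep_vars_def2 by auto

lemma (in product_prob_space) indep_vars_PiM_coordinates: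
  assumes "I \<noteq> {}"
  shows "prob_space.indep_vars (PiM I M) M (\<lambda>i \<omega>. \<omega> i) I"
proof (subst prob_space.indep_vars_iff_distr_eq_PiM')
  have "distr (PiM I M) (PiM I M) (\<lambda>x. \<lambda>i\<in>I. x i) = distr (PiM I M) (PiM I M) (\<lambda>x. x)"
    by (rule distr_cong) (auto simp: space_PiM)
  also have "\<dots> = PiM I M" by simp
  also have "\<dots> = (\<Pi>\<^sub>M i\<in>I. distr (PiM I M) (M i) (\<lambda>\<omega>. \<omega> i))"
    by (intro PiM_cong) (simp_all add: PiM_component)
  finally show "distr (PiM I M) (PiM I M) (\<lambda>x. \<lambda>i\<in>I. x i) = (\<Pi>\<^sub>M i\<in>I. distr (PiM I M) (M i) (\<lambda>\<omega>. \<omega> i))" .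
qed (use assms P.prob_space_axioms in auto)

text \<open>A normal law with a Gram matrix \<open>A\<^sup>T A\<close> as covariance is the law of \<open>A\<^sup>T g\<close> for a standard Gaussian
vector \<open>g\<close>, since \<open>t \<bullet> A\<^sup>T g = (A t) \<bullet> g\<close> is a sum of independent normals of total variance \<open>|A t|\<^sup>2\<close>.\<close>

lemma centered_normal_exists:
  fixes A :: "real^'d^'e"
  shows "\<exists>\<mu>. centered_normal (transpose A ** A) \<mu>"
proof -
  define \<gamma> where "\<gamma> = PiM (UNIV :: 'e set) (\<lambda>_. std_normal_distribution)"
  interpret std: prob_space std_normal_distribution by (rule prob_space_normal_density) simp
  interpret P: product_prob_space "\<lambda>_::'e. std_normal_distribution" UNIV
    by unfold_locales
  interpret \<gamma>: prob_space \<gamma> unfolding \<gamma>_def by (rule P.P.prob_space_axioms)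
  define G :: "('e \<Rightarrow> real) \<Rightarrow> real^'d" where "G g = transpose A *v (\<chi> i. g i)" for g
  have coord[measurable]: "(\<lambda>g. g i) \<in> borel_measurable \<gamma>" for i
    unfolding \<gamma>_def by (subst measurable_cong_sets[OF refl, of borel std_normal_distribution]) auto
  have inner_G: "t \<bullet> G g = (\<Sum>i\<in>UNIV. (A *v t) $ i * g i)" for t g
  proof -
    have "t \<bullet> G g = (A *v t) \<bullet> (\<chi> i. g i)"
      unfolding G_def by (simp add: dot_lmul_matrix[symmetric] vector_transpose_matrix inner_commute)
    then show ?thesis by (simp add: inner_vec_def)
  qed
  have G[measurable]: "G \<in> borel_measurable \<gamma>"
    unfolding borel_measurable_euclidean_space[of G]
    by (subst inner_commute, subst inner_G) measurable
  have dens: "distributed \<gamma> lborel (\<lambda>g. g i) (normal_density 0 1)" for i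
  proof -
    have "distr \<gamma> lborel (\<lambda>g. g i) = distr \<gamma> std_normal_distribution (\<lambda>g. g i)"
      by (rule distr_cong) auto
    also have "\<dots> = std_normal_distribution"
      unfolding \<gamma>_def by (rule P.PiM_component) simp
    finally show ?thesis by (simp add: distributed_def)
  qed
  have indep: "\<gamma>.indep_vars (\<lambda>_. borel) (\<lambda>i g. c i * g i) UNIV" for c
  proof -
    have "\<gamma>.indep_vars (\<lambda>_. std_normal_distribution) (\<lambda>i g. g i) UNIV"
      unfolding \<gamma>_def by (rule P.indep_vars_PiM_coordinates) simp
    then show ?thesis by (rule \<gamma>.indep_vars_compose2[where Y="\<lambda>i s. c i * s"]) auto
  qed
  have quad: "t \<bullet> ((transpose A ** A) *v t) = (\<Sum>i\<in>UNIV. ((A *v t) $ i)\<^sup>2)" for t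
  proof -
    have "t \<bullet> ((transpose A ** A) *v t) = (A *v t) \<bullet> (A *v t)"
      by (simp add: matrix_vector_mul_assoc[symmetric] dot_lmul_matrix[symmetric] vector_transpose_matrix)
        (rule inner_commute)
    then show ?thesis by (simp add: inner_vec_def power2_eq_square)
  qed
  have "distr (distr \<gamma> borel G) borel (\<lambda>x. t \<bullet> x) =
          (if v = 0 then return borel 0 else density lborel (\<lambda>s. ennreal (normal_density 0 (sqrt v) s)))"
    if v: "v = t \<bullet> ((transpose A ** A) *v t)" for t v
  proof -
    have *: "distr (distr \<gamma> borel G) borel (\<lambda>x. t \<bullet> x) = distr \<gamma> borel (\<lambda>g. \<Sum>i\<in>UNIV. (A *v t) $ i * g i)"
      by (subst distr_distr) (auto simp: comp_def inner_G)
    \<comment> \<open>a vanishing coefficient would contribute a degenerate normal variable, so these are dropped from the sum\<close>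
    define I where "I = {i. (A *v t) $ i \<noteq> 0}"
    have **: "(\<lambda>g. \<Sum>i\<in>UNIV. (A *v t) $ i * g i) = (\<lambda>g. \<Sum>i\<in>I. (A *v t) $ i * g i)"
      by (rule ext, rule sum.mono_neutral_right) (auto simp: I_def)
    show ?thesis
    proof (cases "I = {}")
      case True
      then have "v = 0" unfolding v quad by (auto simp: I_def)
      moreover have "distr \<gamma> borel (\<lambda>g. \<Sum>i\<in>I. (A *v t) $ i * g i) = return borel 0"
        using True by (simp add: \<gamma>.distr_const)
      ultimately show ?thesis unfolding * ** by simp
    next
      case False
      have v': "v = (\<Sum>i\<in>I. \<bar>(A *v t) $ i\<bar>\<^sup>2)"
        unfolding v quad power2_abs by (rule sum.mono_neutral_right) (auto simp: I_def)
      have "v > 0" unfolding v' using False by (intro sum_pos) (auto simp: I_def)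
      have "distributed \<gamma> lborel (\<lambda>g. \<Sum>i\<in>I. (A *v t) $ i * g i)
          (normal_density (\<Sum>i\<in>I. 0) (sqrt (\<Sum>i\<in>I. \<bar>(A *v t) $ i\<bar>\<^sup>2)))"
      proof (rule \<gamma>.sum_indep_normal)
        show "\<gamma>.indep_vars (\<lambda>_. borel) (\<lambda>i g. (A *v t) $ i * g i) I"
          using indep by (rule \<gamma>.indep_vars_subset) auto
        show "distributed \<gamma> lborel (\<lambda>g. (A *v t) $ i * g i) (normal_density 0 \<bar>(A *v t) $ i\<bar>)" if "i \<in> I" for i
          using \<gamma>.normal_density_affine[OF dens[of i], of "(A *v t) $ i" 0] that by (simp add: I_def)
      qed (use False in \<open>auto simp: I_def\<close>)
      then have "distr \<gamma> lborel (\<lambda>g. \<Sum>i\<in>I. (A *v t) $ i * g i) = density lborel (\<lambda>s. ennreal (normal_density 0 (sqrt v) s))"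
        unfolding v' by (simp add: distributed_def)
      also have "distr \<gamma> lborel (\<lambda>g. \<Sum>i\<in>I. (A *v t) $ i * g i) = distr \<gamma> borel (\<lambda>g. \<Sum>i\<in>I. (A *v t) $ i * g i)"
        by (rule distr_cong) auto
      finally show ?thesis unfolding * ** using \<open>v > 0\<close> by simp
    qed
  qed
  moreover have "0 \<le> t \<bullet> ((transpose A ** A) *v t)" for t
    unfolding quad by (simp add: sum_nonneg)
  moreover have "transpose (transpose A ** A) = transpose A ** A"
    by (simp add: matrix_transpose_mul)
  ultimately have "centered_normal (transpose A ** A) (distr \<gamma> borel G)"
    unfolding centered_normal_def Let_def by (auto intro!: \<gamma>.prob_space_distr)
  then show ?thesis by blast
qed

text \<open>Apply the central limit theorem on the line to every projection and combine the results by
Cramer--Wold.\<close>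

theorem multivariate_clt:
  fixes \<xi> :: "nat \<Rightarrow> 'w \<Rightarrow> real^'d"
  assumes "prob_space M" and indep: "prob_space.indep_vars M (\<lambda>_. borel) \<xi> {1..}"
    and ident: "\<And>n. n \<ge> 1 \<Longrightarrow> distr M borel (\<xi> n) = \<nu>"
    and mean: "\<And>t. (LINT y|\<nu>. t \<bullet> y) = 0"
    and second_int: "\<And>t. integrable \<nu> (\<lambda>y. (t \<bullet> y)\<^sup>2)"
    and second: "\<And>t. (LINT y|\<nu>. (t \<bullet> y)\<^sup>2) = t \<bullet> (V *v t)"
    and gauss: "centered_normal V \<mu>"
  shows "converges_in_law M (\<lambda>N \<omega>. sqrt (real N) *\<^sub>R sample_mean N (\<lambda>n. \<xi> n \<omega>)) \<mu>"
proof (rule cramer_wold)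
  interpret prob_space M by fact
  have \<xi>[measurable]: "\<xi> n \<in> borel_measurable M" if "n \<ge> 1" for n
    using indep that by (auto simp: indep_vars_def2)
  have \<xi>S[measurable]: "\<xi> (Suc n) \<in> borel_measurable M" for n by (rule \<xi>) simp
  show "prob_space M" "prob_space \<mu>" "sets \<mu> = sets borel"
    using gauss assms(1) by (auto simp: centered_normal_def)
  have shift: "(\<Sum>n=1..N. f n) = (\<Sum>n<N. f (Suc n))" for f :: "nat \<Rightarrow> real^'d" and N
    by (simp add: sum.atLeast1_atMost_eq)
  show "(\<lambda>\<omega>. sqrt (real N) *\<^sub>R sample_mean N (\<lambda>n. \<xi> n \<omega>)) \<in> borel_measurable M" for N
    unfolding sample_mean_def shift by measurable
  fix t
  define v where "v = t \<bullet> (V *v t)"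
  define X where "X n \<omega> = t \<bullet> \<xi> (Suc n) \<omega>" for n \<omega>
  have X[measurable]: "X n \<in> borel_measurable M" for n unfolding X_def by measurable
  have v0: "0 \<le> v" and law: "distr \<mu> borel (\<lambda>x. t \<bullet> x) =
          (if v = 0 then return borel 0 else density lborel (\<lambda>s. ennreal (normal_density 0 (sqrt v) s)))"
    using gauss unfolding centered_normal_def Let_def v_def by auto
  have E: "(LINT \<omega>|M. f (\<xi> (Suc n) \<omega>)) = (LINT y|\<nu>. f y)" "integrable M (\<lambda>\<omega>. f (\<xi> (Suc n) \<omega>)) = integrable \<nu> f"
    if "f \<in> borel_measurable borel" for f :: "real^'d \<Rightarrow> real" and n
    using that ident[of "Suc n", symmetric] by (simp_all add: integral_distr integrable_distr_eq)
  have EX: "expectation (X n) = 0" for n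
    unfolding X_def using E(1)[of "\<lambda>y. t \<bullet> y" n] mean by simp
  have EX2: "integrable M (\<lambda>\<omega>. (X n \<omega>)\<^sup>2)" "expectation (\<lambda>\<omega>. (X n \<omega>)\<^sup>2) = v" for n
    unfolding X_def v_def using E[of "\<lambda>y. (t \<bullet> y)\<^sup>2" n] second second_int by simp_all
  have proj: "t \<bullet> (sqrt (real N) *\<^sub>R sample_mean N (\<lambda>n. \<xi> n \<omega>)) = (\<Sum>n<N. X n \<omega>) / sqrt (real N)" for N \<omega>
  proof -
    have "t \<bullet> (sqrt (real N) *\<^sub>R sample_mean N (\<lambda>n. \<xi> n \<omega>)) = (sqrt (real N) / real N) * (\<Sum>n<N. X n \<omega>)"
      unfolding sample_mean_def shift X_def by (simp add: inner_sum_right)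
    also have "sqrt (real N) / real N = inverse (sqrt (real N))" by (simp add: sqrt_divide_self_eq)
    finally show ?thesis by (simp only: divide_inverse mult.commute)
  qed
  show "converges_in_law M (\<lambda>N \<omega>. t \<bullet> (sqrt (real N) *\<^sub>R sample_mean N (\<lambda>n. \<xi> n \<omega>))) (distr \<mu> borel (\<lambda>y. t \<bullet> y))"
    unfolding converges_in_law_def proj
  proof (intro allI impI, elim conjE)
    fix \<phi> :: "real \<Rightarrow> real" assume \<phi>: "continuous_on UNIV \<phi>" and bd: "bounded (range \<phi>)"
    obtain B where B: "\<And>x. \<bar>\<phi> x\<bar> \<le> B" using bd unfolding bounded_iff by auto
    have [measurable]: "\<phi> \<in> borel_measurable borel" using \<phi> by (rule borel_measurable_continuous_onI)
    show "(\<lambda>N. expectation (\<lambda>\<omega>. \<phi> ((\<Sum>n<N. X n \<omega>) / sqrt (real N)))) \<longlonglongrightarrow> (LINT y|distr \<mu> borel (\<lambda>y. t \<bullet> y). \<phi> y)"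
    \<comment> \<open>in a direction of variance 0 both sides are point masses at 0; the scalar theorem needs a positive variance\<close>
    proof (cases "v = 0")
      case True
      have "AE \<omega> in M. X n \<omega> = 0" for n
        using integral_nonneg_eq_0_iff_AE[OF EX2(1)[of n]] EX2(2)[of n] True by auto
      then have "AE \<omega> in M. \<forall>n. X n \<omega> = 0" by (simp add: AE_all_countable)
      then have "expectation (\<lambda>\<omega>. \<phi> ((\<Sum>n<N. X n \<omega>) / sqrt (real N))) = expectation (\<lambda>\<omega>. \<phi> 0)" for N
        by (intro integral_cong_AE) (auto elim!: eventually_mono)
      then show ?thesis using True unfolding law by (simp add: prob_space integral_return)
    next
      case False
      then have v: "v > 0" using v0 by simp
      define S where "S N \<omega> = (\<Sum>n<N. X n \<omega>) / sqrt (real N * (sqrt v)\<^sup>2)" for N \<omega>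
      have S[measurable]: "S N \<in> borel_measurable M" for N unfolding S_def by measurable
      have weak: "weak_conv_m (\<lambda>N. distr M borel (S N)) std_normal_distribution"
        unfolding S_def[abs_def]
      proof (rule central_limit_theorem_zero_mean)
        have "indep_vars (\<lambda>_. borel) (\<lambda>n. \<xi> (Suc n)) UNIV"
          using indep_vars_reindex[OF indep, of Suc UNIV] by auto
        then show "indep_vars (\<lambda>_. borel) X UNIV"
          unfolding X_def[abs_def] by (rule indep_vars_compose2) auto
        show "distr M borel (X n) = distr \<nu> borel (\<lambda>y. t \<bullet> y)" for n
          unfolding X_def[abs_def] ident[of "Suc n", simplified, symmetric]
          by (subst distr_distr) (auto simp: comp_def)
        show "sqrt v > 0" using v by simp
        show "expectation (X n) = 0" for n by (rule EX)
        show "integrable M (\<lambda>\<omega>. (X n \<omega>)\<^sup>2)" for n by (rule EX2)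
        show "variance (X n) = (sqrt v)\<^sup>2" for n using v EX2(2)[of n] by (simp add: EX)
      qed
      have "isCont (\<lambda>s. \<phi> (sqrt v * s)) x" for x
      proof -
        have "isCont \<phi> (sqrt v * x)" using \<phi> by (simp add: continuous_on_eq_continuous_at)
        then show ?thesis by (rule isCont_o2[rotated]) (intro continuous_intros)
      qed
      then have "(\<lambda>N. LINT s|distr M borel (S N). \<phi> (sqrt v * s)) \<longlonglongrightarrow> (LINT s|std_normal_distribution. \<phi> (sqrt v * s))"
        by (rule weak_conv_imp_integral_bdd_continuous_conv[OF real_distribution_distr[OF S] real_dist_normal_dist weak])
          (use B in simp)
      moreover have "(LINT s|distr M borel (S N). \<phi> (sqrt v * s)) = expectation (\<lambda>\<omega>. \<phi> ((\<Sum>n<N. X n \<omega>) / sqrt (real N)))" for N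
      proof -
        have "sqrt v * S N \<omega> = (\<Sum>n<N. X n \<omega>) / sqrt (real N)" for \<omega>
          using v by (simp add: S_def real_sqrt_mult)
        then show ?thesis by (subst integral_distr) simp_all
      qed
      moreover have "(LINT s|std_normal_distribution. \<phi> (sqrt v * s)) = (LINT y|distr \<mu> borel (\<lambda>y. t \<bullet> y). \<phi> y)"
      proof -
        have "(LINT y|distr \<mu> borel (\<lambda>y. t \<bullet> y). \<phi> y) = (LINT s|lborel. normal_density 0 (sqrt v) s * \<phi> s)"
          using False v unfolding law by (simp add: integral_density)
        also have "\<dots> = sqrt v * (LINT s|lborel. normal_density 0 (sqrt v) (0 + sqrt v * s) * \<phi> (0 + sqrt v * s))"
          using v by (subst lborel_integral_real_affine[of "sqrt v" _ 0]) simp_all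
        also have "\<dots> = (LINT s|lborel. sqrt v * (normal_density 0 (sqrt v) (sqrt v * s) * \<phi> (sqrt v * s)))"
          by simp
        also have "\<dots> = (LINT s|lborel. std_normal_density s * \<phi> (sqrt v * s))"
          using v by (intro Bochner_Integration.integral_cong refl)
             (simp add: normal_density_def real_sqrt_mult power_mult_distrib)
        also have "\<dots> = (LINT s|std_normal_distribution. \<phi> (sqrt v * s))"
          by (simp add: integral_density)
        finally show ?thesis by simp
      qed
      ultimately show ?thesis by simp
    qed
  qed
qed

section \<open>The delta method for inverse moment maps\<close>

text \<open>If \<open>V\<close> is the inverse of the covariance matrix \<open>B\<close>, then applying \<open>V\<close> turns the covariance into
\<open>V B V = V\<close>.  This is why the inverse of the information matrix appears as the limit covariance.\<close>

lemma centered_normal_linear_image: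
  fixes B V :: "real^'d^'d"
  assumes \<mu>: "centered_normal B \<mu>" and V: "transpose V = V" "B ** V = mat 1"
  shows "centered_normal V (distr \<mu> borel (\<lambda>y. V *v y))"
proof -
  interpret \<mu>: prob_space \<mu> using \<mu> by (simp add: centered_normal_def)
  have sets: "sets \<mu> = sets borel" using \<mu> by (simp add: centered_normal_def)
  have meas: "(\<lambda>y. V *v y) \<in> borel_measurable \<mu>"
    using borel_measurable_continuous_onI[of "\<lambda>y. V *v y"] measurable_cong_sets[OF sets refl]
    by (blast intro: continuous_intros matrix_vector_mult_linear_continuous_on)
  have sym: "t \<bullet> (V *v y) = (V *v t) \<bullet> y" for t y
    using V(1) by (metis dot_lmul_matrix vector_transpose_matrix)
  have quad: "(V *v t) \<bullet> (B *v (V *v t)) = t \<bullet> (V *v t)" for t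
    using V(2) by (simp add: matrix_vector_mul_assoc inner_commute)
  have "distr (distr \<mu> borel (\<lambda>y. V *v y)) borel (\<lambda>x. t \<bullet> x) = distr \<mu> borel (\<lambda>y. (V *v t) \<bullet> y)" for t
    using meas by (subst distr_distr) (auto simp: comp_def sym)
  then show ?thesis
    using \<mu> V(1) meas quad unfolding centered_normal_def Let_def
    by (auto intro!: \<mu>.prob_space_distr) (metis quad)+
qed

text \<open>Differentiability at a point is precisely local uniform convergence of the rescaled differences to
the derivative.  The default value 0 off \<open>U\<close> disappears in the limit, since every ball shrinks into
\<open>U\<close> under the scaling by \<open>1 / sqrt N\<close>.\<close>

lemma scaled_difference_uniform_limit:
  fixes G :: "real^'d \<Rightarrow> real^'d" and \<phi> :: "real^'d \<Rightarrow> real"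
  assumes deriv: "(G has_derivative D) (at 0)" and G0: "G 0 = \<theta>"
    and U: "open U" "0 \<in> U" and \<phi>: "continuous_on UNIV \<phi>"
  shows "uniform_limit (cball 0 R)
     (\<lambda>N y. if (1 / sqrt (real N)) *\<^sub>R y \<in> U
            then \<phi> (sqrt (real N) *\<^sub>R (G ((1 / sqrt (real N)) *\<^sub>R y) - \<theta>)) else 0)
     (\<lambda>y. \<phi> (D y)) sequentially"
  unfolding uniform_limit_iff
proof (intro allI impI)
  fix e :: real assume "e > 0"
  define R' where "R' = max R 1"
  have R': "R' > 0" "R \<le> R'" by (auto simp: R'_def)
  interpret D: bounded_linear D using deriv by (rule has_derivative_bounded_linear)
  obtain K where K: "K > 0" "\<And>y. norm (D y) \<le> norm y * K" using D.pos_bounded by blast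
  have "uniformly_continuous_on (cball 0 (R' * K + 1)) \<phi>"
    using \<phi> by (intro compact_uniformly_continuous) (auto intro: continuous_on_subset)
  then obtain d where d: "d > 0"
    "\<And>x y. x \<in> cball 0 (R' * K + 1) \<Longrightarrow> y \<in> cball 0 (R' * K + 1) \<Longrightarrow> dist y x < d \<Longrightarrow> dist (\<phi> y) (\<phi> x) < e"
    using \<open>e > 0\<close> unfolding uniformly_continuous_on_def by metis
  \<comment> \<open>chosen such that a relative error \<open>\<eta>\<close> on a ball of radius \<open>R'\<close> is below the modulus of continuity \<open>d\<close> and below 1\<close>
  define \<eta> where "\<eta> = min d 1 / (2 * R')"
  have \<eta>: "\<eta> > 0" "\<eta> * R' < d" "\<eta> * R' \<le> 1" using d(1) R' by (auto simp: \<eta>_def min_def field_simps)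
  obtain \<delta> where \<delta>: "\<delta> > 0" "\<And>z. norm z < \<delta> \<Longrightarrow> norm (G z - \<theta> - D z) \<le> \<eta> * norm z"
    using deriv \<eta>(1) G0 unfolding has_derivative_at_alt by fastforce
  obtain \<rho> where \<rho>: "\<rho> > 0" "ball 0 \<rho> \<subseteq> U" using U open_contains_ball by blast
  have "(\<lambda>N. R' / sqrt (real N)) \<longlonglongrightarrow> 0" by real_asymp
  then have "\<forall>\<^sub>F N in sequentially. R' / sqrt (real N) < min \<delta> \<rho>"
    using \<delta>(1) \<rho>(1) by (intro order_tendstoD) auto
  then show "\<forall>\<^sub>F N in sequentially. \<forall>y\<in>cball 0 R. dist
      (if (1 / sqrt (real N)) *\<^sub>R y \<in> U then \<phi> (sqrt (real N) *\<^sub>R (G ((1 / sqrt (real N)) *\<^sub>R y) - \<theta>)) else 0) (\<phi> (D y)) < e"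
    using eventually_ge_at_top[of 1]
  proof eventually_elim
    case (elim N)
    show ?case
    proof
      fix y :: "real^'d" assume y: "y \<in> cball 0 R"
      define z where "z = (1 / sqrt (real N)) *\<^sub>R y"
      have N: "sqrt (real N) > 0" using elim by simp
      have ny: "norm y \<le> R'" using y R' by simp
      have "norm z = norm y / sqrt (real N)" by (simp add: z_def)
      also have "\<dots> \<le> R' / sqrt (real N)" using ny by (intro divide_right_mono) auto
      finally have nz: "norm z < \<delta>" "norm z < \<rho>" using elim by auto
      have zU: "z \<in> U" using nz \<rho> by auto
      have yz: "y = sqrt (real N) *\<^sub>R z" using N by (simp add: z_def)
      have "norm (sqrt (real N) *\<^sub>R (G z - \<theta>) - D y) = sqrt (real N) * norm (G z - \<theta> - D z)"
        using N by (simp add: yz D.scaleR flip: scaleR_diff_right)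
      also have "\<dots> \<le> sqrt (real N) * (\<eta> * norm z)"
        using \<delta>(2)[OF nz(1)] by (intro mult_left_mono) auto
      also have "\<dots> = \<eta> * norm y" using N by (simp add: yz)
      also have "\<dots> \<le> \<eta> * R'" using ny \<eta> by (intro mult_left_mono) auto
      finally have close: "norm (sqrt (real N) *\<^sub>R (G z - \<theta>) - D y) \<le> \<eta> * R'" .
      have "norm (D y) \<le> R' * K"
        using K(2)[of y] ny K(1) mult_right_mono[of "norm y" R' K] by linarith
      moreover have "norm (sqrt (real N) *\<^sub>R (G z - \<theta>)) \<le> R' * K + 1"
        using close \<eta>(3) calculation norm_triangle_sub[of "sqrt (real N) *\<^sub>R (G z - \<theta>)" "D y"] by linarith
      ultimately have "dist (\<phi> (sqrt (real N) *\<^sub>R (G z - \<theta>))) (\<phi> (D y)) < e"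
        using close \<eta>(2) by (intro d(2)) (auto simp: dist_norm)
      then show "dist (if (1 / sqrt (real N)) *\<^sub>R y \<in> U then \<phi> (sqrt (real N) *\<^sub>R (G ((1 / sqrt (real N)) *\<^sub>R y) - \<theta>)) else 0) (\<phi> (D y)) < e"
        using zU by (simp add: z_def)
    qed
  qed
qed

text \<open>The delta method for an estimator that inverts a moment map \<open>m\<close> at the mean score.  By invariance of
domain the injective continuous map \<open>m\<close> is a homeomorphism onto an open set \<open>U\<close>, so its inverse \<open>G\<close> is
measurable and has derivative \<open>B\<^sup>-\<^sup>1\<close> at \<open>0 = m \<theta>\<close>.  The mean score times \<open>sqrt N\<close> has a normal limit with covariance \<open>B\<close>, and the covariance of
the estimator is \<open>B\<^sup>-\<^sup>1 B B\<^sup>-\<^sup>1 = B\<^sup>-\<^sup>1\<close>.  That the derivative of \<open>m\<close> coincides with the covariance of the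
score is the hypothesis that makes the formula so simple.

The event that the estimator exists is the event that the mean score falls into \<open>U\<close> (up to a null
set).  Its probability tends to 1 by the same limit theorem, applied to the test function 1.\<close>

theorem asymptotic_covariance_inverse_moment_map:
  fixes X :: "nat \<Rightarrow> 'w \<Rightarrow> 'a" and s :: "'a \<Rightarrow> real^'d" and m :: "real^'d \<Rightarrow> real^'d"
    and B :: "real^'d^'d" and L :: "real^'d^'e"
  assumes "prob_space M"
    and indep: "prob_space.indep_vars M (\<lambda>_. borel) (\<lambda>n \<omega>. s (X n \<omega>)) {1..}"
    and ident: "\<And>n. n \<ge> 1 \<Longrightarrow> distr M borel (\<lambda>\<omega>. s (X n \<omega>)) = \<nu>"
    and mean: "\<And>t. (LINT y|\<nu>. t \<bullet> y) = 0"
    and second_int: "\<And>t. integrable \<nu> (\<lambda>y. (t \<bullet> y)\<^sup>2)"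
    and second: "\<And>t. (LINT y|\<nu>. (t \<bullet> y)\<^sup>2) = t \<bullet> (B *v t)"
    and B: "B = transpose L ** L" "invertible B"
    and m: "open \<Theta>" "\<theta> \<in> \<Theta>" "continuous_on \<Theta> m" "inj_on m \<Theta>" "m \<theta> = 0"
      "(m has_derivative (\<lambda>u. B *v u)) (at \<theta>)"
    and S: "\<And>n. n \<ge> 1 \<Longrightarrow> {\<omega> \<in> space M. X n \<omega> \<in> S} \<in> sets M" "\<And>n. n \<ge> 1 \<Longrightarrow> AE \<omega> in M. X n \<omega> \<in> S"
    and T: "\<And>N \<omega>. N \<ge> 1 \<Longrightarrow> T N (\<lambda>n. X n \<omega>) =
        (if (\<forall>n\<in>{1..N}. X n \<omega> \<in> S) \<and> sample_mean N (\<lambda>n. s (X n \<omega>)) \<in> m ` \<Theta>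
         then Some (inv_into \<Theta> m (sample_mean N (\<lambda>n. s (X n \<omega>)))) else None)"
  shows "asymptotic_covariance M X T \<theta> (matrix_inv B)"
proof -
  interpret prob_space M by fact
  define V where "V = matrix_inv B"
  have BV: "B ** V = mat 1" "V ** B = mat 1"
    
    using someI_ex[OF B(2)[unfolded invertible_def]] by (auto simp: V_def matrix_inv_def)
  have symB: "transpose B = B" unfolding B(1) by (simp add: matrix_transpose_mul)
  have symV: "transpose V = V"
  proof -
    have "transpose V ** B = mat 1" using arg_cong[OF BV(1), of transpose] symB by (simp add: matrix_transpose_mul)
    then have "transpose V ** (B ** V) = V" by (simp add: matrix_mul_assoc)
    then show ?thesis by (simp add: BV)
  qed
  obtain \<mu>\<^sub>0 where \<mu>\<^sub>0: "centered_normal B \<mu>\<^sub>0" using centered_normal_exists[of L] B(1) by auto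
  define \<mu> where "\<mu> = distr \<mu>\<^sub>0 borel (\<lambda>y. V *v y)"
  have \<mu>: "centered_normal V \<mu>"
    unfolding \<mu>_def by (rule centered_normal_linear_image[OF \<mu>\<^sub>0 symV BV(1)])
  have sets0: "prob_space \<mu>\<^sub>0" "sets \<mu>\<^sub>0 = sets borel" using \<mu>\<^sub>0 by (auto simp: centered_normal_def)
  interpret \<mu>: prob_space \<mu> using \<mu> by (simp add: centered_normal_def)
  define mean_s where "mean_s N \<omega> = sample_mean N (\<lambda>n. s (X n \<omega>))" for N \<omega>
  define Y where "Y N \<omega> = sqrt (real N) *\<^sub>R mean_s N \<omega>" for N \<omega>
  have Y: "converges_in_law M Y \<mu>\<^sub>0"
    unfolding Y_def mean_s_def by (rule multivariate_clt[OF assms(1) indep ident mean second_int second \<mu>\<^sub>0])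
  have "(\<lambda>\<omega>. s (X n \<omega>)) \<in> borel_measurable M" if "n \<ge> 1" for n
    using indep that by (auto simp: indep_vars_def2)
  then have mean_s[measurable]: "mean_s N \<in> borel_measurable M" for N
    unfolding mean_s_def sample_mean_def by (intro borel_measurable_scaleR borel_measurable_sum) auto
  have Ym[measurable]: "Y N \<in> borel_measurable M" for N unfolding Y_def by measurable
  define U where "U = m ` \<Theta>"
  define G where "G = inv_into \<Theta> m"
  have U: "open U" "0 \<in> U" unfolding U_def using m by (auto intro: invariance_of_domain intro!: image_eqI[of 0 m \<theta>])
  have G0: "G 0 = \<theta>" unfolding G_def m(5)[symmetric] by (rule inv_into_f_f) fact+
  obtain g where g: "homeomorphism \<Theta> U m g"
    using invariance_of_domain_homeomorphism[OF m(1,3) _ m(4)] unfolding U_def by auto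
  have "G y = g y" if "y \<in> U" for y
    unfolding G_def using g that m(4) by (intro inv_into_f_eq) (auto simp: homeomorphism_def)
  then have G: "continuous_on U G" using g continuous_on_cong[OF refl, of U G g] by (auto simp: homeomorphism_def)
  have "(G has_derivative (\<lambda>u. V *v u)) (at (m \<theta>))"
  proof (rule has_derivative_inverse_basic_x[OF m(6)])
    show "(\<lambda>u. V *v u) \<circ> (\<lambda>u. B *v u) = id" by (auto simp: fun_eq_iff matrix_vector_mul_assoc BV)
    show "continuous (at (m \<theta>)) G" using G U m(5) continuous_on_eq_continuous_at by metis
    show "m (G y) = y" if "y \<in> U" for y using that unfolding G_def U_def by (rule f_inv_into_f)
  qed (use U G0 m(5) in \<open>auto intro: matrix_vector_mul_bounded_linear\<close>)
  then have derG: "(G has_derivative (\<lambda>u. V *v u)) (at 0)" using m(5) by simp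
  define E where "E N = {\<omega> \<in> space M. T N (\<lambda>n. X n \<omega>) \<noteq> None}" for N
  have E: "E N = {\<omega> \<in> space M. (\<forall>n\<in>{1..N}. X n \<omega> \<in> S) \<and> mean_s N \<omega> \<in> U}" if "N \<ge> 1" for N
    using T[OF that] by (auto simp: E_def mean_s_def U_def)
  have Em: "E N \<in> sets M" if "N \<ge> 1" for N
  proof -
    have "{\<omega> \<in> space M. \<forall>n\<in>{1..N}. X n \<omega> \<in> S} \<in> sets M"
      using S(1) by (intro sets.sets_Collect_finite_All) auto
    moreover have "{\<omega> \<in> space M. mean_s N \<omega> \<in> U} \<in> sets M"
      using measurable_sets[OF mean_s[of N], of U] U(1) by (simp add: vimage_def Int_def conj_commute)
    moreover have "E N = {\<omega> \<in> space M. \<forall>n\<in>{1..N}. X n \<omega> \<in> S} \<inter> {\<omega> \<in> space M. mean_s N \<omega> \<in> U}"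
      unfolding E[OF that] by auto
    ultimately show ?thesis by simp
  qed
  have TE: "the (T N (\<lambda>n. X n \<omega>)) = G (mean_s N \<omega>)" if "N \<ge> 1" "\<omega> \<in> E N" for N \<omega>
    using T[OF that(1)] that(2) unfolding E[OF that(1)] by (auto simp: mean_s_def U_def G_def)
  have GE: "(\<lambda>\<omega>. G (mean_s N \<omega>)) \<in> borel_measurable (restrict_space M (E N))" if "N \<ge> 1" for N
  proof -
    have "mean_s N \<in> measurable (restrict_space M (E N)) (restrict_space borel U)"
      using E[OF that] by (intro measurable_restrict_space3) auto
    then show ?thesis
      using borel_measurable_continuous_on_restrict[OF G] by (rule measurable_compose)
  qed
  have meas: "(\<lambda>\<omega>. the (T N (\<lambda>n. X n \<omega>))) \<in> borel_measurable (restrict_space M (E N))" if "N \<ge> 1" for N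
    using GE[OF that] by (subst measurable_cong[where g="\<lambda>\<omega>. G (mean_s N \<omega>)"]) (auto simp: TE[OF that] space_restrict_space)
  have lim: "(\<lambda>N. LINT \<omega>:E N|M. \<phi> (sqrt (real N) *\<^sub>R (the (T N (\<lambda>n. X n \<omega>)) - \<theta>))) \<longlonglongrightarrow> (LINT y|\<mu>. \<phi> y)"
    if \<phi>: "continuous_on UNIV \<phi>" and bd: "bounded (range \<phi>)" for \<phi> :: "real^'d \<Rightarrow> real"
  proof -
    obtain C where C: "\<And>x. \<bar>\<phi> x\<bar> \<le> C" using bd unfolding bounded_iff by auto
    have [measurable]: "\<phi> \<in> borel_measurable borel" using \<phi> by (rule borel_measurable_continuous_onI)
    define f where "f N \<omega> = indicator (E N) \<omega> *\<^sub>R \<phi> (sqrt (real N) *\<^sub>R (the (T N (\<lambda>n. X n \<omega>)) - \<theta>))" for N \<omega>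
    define \<psi> where "\<psi> N y = (if (1 / sqrt (real N)) *\<^sub>R y \<in> U
            then \<phi> (sqrt (real N) *\<^sub>R (G ((1 / sqrt (real N)) *\<^sub>R y) - \<theta>)) else 0)" for N y
    have "(\<lambda>N. LINT \<omega>|M. f N \<omega>) \<longlonglongrightarrow> (LINT y|\<mu>\<^sub>0. \<phi> (V *v y))"
    proof (rule converges_in_law_locally_uniform[OF assms(1) sets0 Ym Y])
      show "f N \<in> borel_measurable M" if "N \<ge> 1" for N
      proof -
        have "(\<lambda>\<omega>. \<phi> (sqrt (real N) *\<^sub>R (the (T N (\<lambda>n. X n \<omega>)) - \<theta>))) \<in> borel_measurable (restrict_space M (E N))"
          using meas[OF that] by measurable
        then show ?thesis unfolding f_def[abs_def]
          using Em[OF that] by (subst (asm) borel_measurable_restrict_space_iff) auto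
      qed
      show "\<bar>f N \<omega>\<bar> \<le> C" for N \<omega>
        using C[of "sqrt (real N) *\<^sub>R (the (T N (\<lambda>n. X n \<omega>)) - \<theta>)"] C[of 0] by (auto simp: f_def indicator_def)
      show "continuous_on UNIV (\<lambda>y. \<phi> (V *v y))"
        by (rule continuous_on_compose2[OF \<phi>]) (auto intro: matrix_vector_mult_linear_continuous_on)
      show "\<bar>\<phi> (V *v y)\<bar> \<le> C" for y by (rule C)
      show "AE \<omega> in M. f N \<omega> = \<psi> N (Y N \<omega>)" if "N \<ge> 1" for N
      proof -
        have "AE \<omega> in M. \<forall>n\<in>{1..N}. X n \<omega> \<in> S"
          using S(2) by (intro AE_finite_allI) auto
        then show ?thesis
        proof (rule AE_mp, intro AE_I2 impI)
          fix \<omega> assume \<omega>: "\<omega> \<in> space M" "\<forall>n\<in>{1..N}. X n \<omega> \<in> S"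
          have "(1 / sqrt (real N)) *\<^sub>R Y N \<omega> = mean_s N \<omega>" using that by (simp add: Y_def)
          moreover have "\<omega> \<in> E N \<longleftrightarrow> mean_s N \<omega> \<in> U" using \<omega> E[OF that] by auto
          ultimately show "f N \<omega> = \<psi> N (Y N \<omega>)"
            using TE[OF that, of \<omega>] by (simp add: f_def \<psi>_def)
        qed
      qed
      show "uniform_limit (cball 0 R) \<psi> (\<lambda>y. \<phi> (V *v y)) sequentially" for R
        unfolding \<psi>_def[abs_def] by (rule scaled_difference_uniform_limit[OF derG G0 U \<phi>])
    qed
    moreover have "(LINT y|\<mu>. \<phi> y) = (LINT y|\<mu>\<^sub>0. \<phi> (V *v y))"
    proof -
      have "(\<lambda>y. V *v y) \<in> borel_measurable \<mu>\<^sub>0"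
        using borel_measurable_continuous_onI[of "\<lambda>y. V *v y"] measurable_cong_sets[OF sets0(2) refl]
        by (blast intro: matrix_vector_mult_linear_continuous_on)
      then show ?thesis unfolding \<mu>_def by (rule integral_distr) measurable
    qed
    ultimately show ?thesis unfolding f_def set_lebesgue_integral_def by simp
  qed
  have "(\<lambda>N. measure M (E N)) \<longlonglongrightarrow> 1"
  proof -
    have "(\<lambda>N. LINT \<omega>:E N|M. (1::real)) \<longlonglongrightarrow> (LINT y|\<mu>. 1)" using lim[of "\<lambda>_. 1"] by auto
    moreover have "\<forall>\<^sub>F N in sequentially. (LINT \<omega>:E N|M. (1::real)) = measure M (E N)"
      using eventually_ge_at_top[of 1]
      by eventually_elim (use Em sets.sets_into_space in \<open>auto simp: set_lebesgue_integral_def Int_absorb2\<close>)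
    ultimately show ?thesis by (simp add: \<mu>.prob_space tendsto_cong)
  qed
  then show ?thesis
    unfolding asymptotic_covariance_def Let_def E_def[symmetric] V_def[symmetric]
    using Em meas \<mu> lim by blast
qed

section \<open>Moments from the Laplace transform\<close>

lemma abs_exp_minus_one_le: "\<bar>exp y - 1\<bar> \<le> \<bar>y\<bar> * exp \<bar>y\<bar>" for y :: real
proof (cases "y \<ge> 0")
  case True
  have "1 - y \<le> exp (- y)" using exp_ge_add_one_self[of "- y"] by simp
  then have "exp y * (1 - y) \<le> exp y * exp (- y)" by (intro mult_left_mono) auto
  then show ?thesis using True by (simp add: exp_minus algebra_simps)
next
  case False
  have "1 - exp y \<le> \<bar>y\<bar> * 1" using False exp_ge_add_one_self[of y] by linarith
  also have "\<dots> \<le> \<bar>y\<bar> * exp \<bar>y\<bar>" by (intro mult_left_mono) auto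
  finally show ?thesis using False by simp
qed

lemma abs_mult_exp_abs_le:
  fixes y e :: real assumes "e > 0"
  shows "\<bar>y\<bar> * exp (e * \<bar>y\<bar>) \<le> (exp (2 * e * y) + exp (- 2 * e * y)) / e"
proof -
  have "e * \<bar>y\<bar> \<le> exp (e * \<bar>y\<bar>)" using exp_ge_add_one_self[of "e * \<bar>y\<bar>"] by linarith
  then have "e * \<bar>y\<bar> * exp (e * \<bar>y\<bar>) \<le> exp (e * \<bar>y\<bar>) * exp (e * \<bar>y\<bar>)" by (intro mult_right_mono) auto
  also have "\<dots> = exp (2 * e * \<bar>y\<bar>)" by (simp flip: exp_add)
  also have "\<dots> \<le> exp (2 * e * y) + exp (- 2 * e * y)" by (cases "y \<ge> 0") auto
  finally show ?thesis using assms by (simp add: field_simps)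
qed

text \<open>Differentiation under the integral sign for \<open>s \<mapsto> \<integral> w exp (s L)\<close>, including the integrability of the
derivative of the integrand.  The difference quotients are dominated, up to a constant, by
the absolute value of the integrand at the two parameters \<open>s + 2 e\<close> and \<open>s - 2 e\<close>.  The weight \<open>w\<close> may change sign, so that the lemma can be
iterated with \<open>w = L\<close>.\<close>

lemma exponential_integral_derivative:
  fixes w L :: "'a \<Rightarrow> real"
  assumes [measurable]: "w \<in> borel_measurable \<mu>" "L \<in> borel_measurable \<mu>"
    and int: "\<And>s. \<bar>s\<bar> < d \<Longrightarrow> integrable \<mu> (\<lambda>x. w x * exp (s * L x))"
    and val: "\<And>s. \<bar>s\<bar> < d \<Longrightarrow> (LINT x|\<mu>. w x * exp (s * L x)) = F s"
    and s: "\<bar>s\<bar> < d" and deriv: "(F has_real_derivative D) (at s)"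
  shows "integrable \<mu> (\<lambda>x. w x * L x * exp (s * L x))"
    and "(LINT x|\<mu>. w x * L x * exp (s * L x)) = D"
proof -
  \<comment> \<open>leaves room for \<open>2 e\<close> on both sides of \<open>s\<close> within the interval of convergence\<close>
  define e where "e = (d - \<bar>s\<bar>) / 3"
  have "3 * e = d - \<bar>s\<bar>" by (simp add: e_def)
  then have e: "e > 0" "\<bar>s + 2 * e\<bar> < d" "\<bar>s - 2 * e\<bar> < d" using s by linarith+
  define h where "h n = e / real (Suc n)" for n
  have h: "0 < h n" "h n \<le> e" for n using e(1) by (auto simp: h_def field_simps)
  have hne: "h n \<noteq> 0" for n using h(1)[of n] by simp
  have sh: "\<bar>s + h n\<bar> < d" for n using h[of n] e by linarith
  have h0: "h \<longlonglongrightarrow> 0" unfolding h_def by real_asymp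
  define f where "f n x = w x * exp (s * L x) * ((exp (h n * L x) - 1) / h n)" for n x
  define W where "W x = \<bar>w x * exp ((s + 2 * e) * L x)\<bar> / e + \<bar>w x * exp ((s - 2 * e) * L x)\<bar> / e" for x
  have W: "integrable \<mu> W" unfolding W_def
    using int[OF e(2)] int[OF e(3)] by (intro Bochner_Integration.integrable_add integrable_divide integrable_abs) auto
  have lim: "(\<lambda>n. f n x) \<longlonglongrightarrow> w x * L x * exp (s * L x)" for x
  proof -
    have "((\<lambda>t. exp (t * L x)) has_real_derivative L x) (at 0)"
      by (auto intro!: derivative_eq_intros)
    then have "((\<lambda>t. (exp (t * L x) - 1) / t) \<longlongrightarrow> L x) (at 0)"
      by (simp add: has_field_derivative_iff)
    then have "(\<lambda>n. (exp (h n * L x) - 1) / h n) \<longlonglongrightarrow> L x"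
      by (rule filterlim_compose) (use h0 hne in \<open>auto simp: filterlim_at\<close>)
    then have "(\<lambda>n. f n x) \<longlonglongrightarrow> w x * exp (s * L x) * L x"
      unfolding f_def by (intro tendsto_intros)
    then show ?thesis by (simp add: mult_ac)
  qed
  have bound: "norm (f n x) \<le> W x" for n x
  proof -
    have "\<bar>(exp (h n * L x) - 1) / h n\<bar> \<le> \<bar>L x\<bar> * exp (h n * \<bar>L x\<bar>)"
      using abs_exp_minus_one_le[of "h n * L x"] h[of n] by (simp add: abs_mult field_simps)
    also have "\<dots> \<le> \<bar>L x\<bar> * exp (e * \<bar>L x\<bar>)"
      using h[of n] by (intro mult_left_mono) (auto intro: mult_right_mono)
    also have "\<dots> \<le> (exp (2 * e * L x) + exp (- 2 * e * L x)) / e"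
      by (rule abs_mult_exp_abs_le) fact
    finally have "\<bar>f n x\<bar> \<le> \<bar>w x\<bar> * exp (s * L x) * ((exp (2 * e * L x) + exp (- 2 * e * L x)) / e)"
      unfolding f_def abs_mult by (intro mult_mono) auto
    also have "\<dots> = W x"
    proof -
      have "exp ((s + 2 * e) * L x) = exp (s * L x) * exp (2 * e * L x)"
        "exp ((s - 2 * e) * L x) = exp (s * L x) * exp (- 2 * e * L x)"
        by (simp_all add: exp_add[symmetric] algebra_simps)
      then show ?thesis by (simp only: W_def abs_mult abs_exp_cancel add_divide_distrib distrib_left times_divide_eq_right mult.assoc)
    qed
    finally show ?thesis by simp
  qed
  have fm: "f n \<in> borel_measurable \<mu>" for n unfolding f_def by measurable
  have lm: "(\<lambda>x. w x * L x * exp (s * L x)) \<in> borel_measurable \<mu>" by measurable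
  show "integrable \<mu> (\<lambda>x. w x * L x * exp (s * L x))"
    by (rule integrable_dominated_convergence[where s=f and w=W]) (use lm fm W lim bound in auto)
  have "(\<lambda>n. LINT x|\<mu>. f n x) \<longlonglongrightarrow> (LINT x|\<mu>. w x * L x * exp (s * L x))"
    by (rule integral_dominated_convergence[where s=f and w=W]) (use lm fm W lim bound in auto)
  moreover have "(LINT x|\<mu>. f n x) = (F (s + h n) - F s) / h n" for n
  proof -
    have "f n = (\<lambda>x. (w x * exp ((s + h n) * L x) - w x * exp (s * L x)) / h n)"
      by (rule ext) (simp add: f_def field_simps exp_add)
    then show ?thesis using int[OF s] int[OF sh] val[OF s] val[OF sh] by simp
  qed
  moreover have "(\<lambda>n. (F (s + h n) - F s) / h n) \<longlonglongrightarrow> D"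
  proof -
    have "((\<lambda>t. (F (s + t) - F s) / t) \<longlongrightarrow> D) (at 0)"
      using deriv by (simp add: DERIV_def)
    then show ?thesis
      by (rule filterlim_compose) (use h0 hne in \<open>auto simp: filterlim_at\<close>)
  qed
  ultimately show "(LINT x|\<mu>. w x * L x * exp (s * L x)) = D"
    using LIMSEQ_unique by simp
qed

text \<open>The first two moments of \<open>L\<close> are the first two derivatives of its Laplace transform at 0.\<close>

lemma moments_of_laplace_transform:
  fixes L :: "'a \<Rightarrow> real"
  assumes L: "L \<in> borel_measurable \<mu>" and "d > 0"
    and int: "\<And>s. \<bar>s\<bar> < d \<Longrightarrow> integrable \<mu> (\<lambda>x. exp (s * L x))"
    and val: "\<And>s. \<bar>s\<bar> < d \<Longrightarrow> (LINT x|\<mu>. exp (s * L x)) = F s"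
    and F': "\<And>s. \<bar>s\<bar> < d \<Longrightarrow> (F has_real_derivative F' s) (at s)"
    and F'': "(F' has_real_derivative D) (at 0)"
  shows "integrable \<mu> L" "(LINT x|\<mu>. L x) = F' 0" "integrable \<mu> (\<lambda>x. (L x)\<^sup>2)" "(LINT x|\<mu>. (L x)\<^sup>2) = D"
proof -
  have 1: "integrable \<mu> (\<lambda>x. L x * exp (s * L x))" "(LINT x|\<mu>. L x * exp (s * L x)) = F' s"
    if "\<bar>s\<bar> < d" for s
    using exponential_integral_derivative[of "\<lambda>_. 1" \<mu> L d F s, OF _ L] int val that F'[OF that] by simp_all
  have 2: "integrable \<mu> (\<lambda>x. L x * L x * exp (0 * L x))" "(LINT x|\<mu>. L x * L x * exp (0 * L x)) = D"
    using exponential_integral_derivative[of L \<mu> L d F' 0, OF L L 1] \<open>d>0\<close> F'' by simp_all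
  show "integrable \<mu> L" "(LINT x|\<mu>. L x) = F' 0" "integrable \<mu> (\<lambda>x. (L x)\<^sup>2)" "(LINT x|\<mu>. (L x)\<^sup>2) = D"
    using 1[of 0] 2 \<open>d>0\<close> by (simp_all add: power2_eq_square)
qed

section \<open>Convexity of the gamma log-partition function\<close>

text \<open>The inequality on which everything about the gamma family rests: it makes the log-partition function
strictly convex and the information matrix invertible.  It holds because
\<open>1 / y\<^sup>2 > 1 / y - 1 / (y + 1)\<close>, and the right-hand sides telescope to \<open>1 / x\<close> along \<open>y = x + k\<close>.\<close>

lemma Polygamma_1_gt_inverse:
  assumes "x > (0::real)"
  shows "1 / x < Polygamma 1 x"
proof -
  define f where "f k = 1 / (x + real k)" for k
  have f0: "f \<longlonglongrightarrow> 0" unfolding f_def by real_asymp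
  have tel: "(\<lambda>k. f k - f (Suc k)) sums (1 / x)"
    using telescope_sums'[OF f0] by (simp add: f_def)
  have s2: "summable (\<lambda>k. inverse ((x + real k)\<^sup>2))"
    using Polygamma_converges'[of x 2] assms by simp
  have P: "Polygamma 1 x = (\<Sum>k. inverse ((x + real k)\<^sup>2))"
    by (simp add: Polygamma_def numeral_2_eq_2)
  have pos: "0 < inverse ((x + real k)\<^sup>2) - (f k - f (Suc k))" for k
  proof -
    define y where "y = x + real k"
    have y: "y > 0" using assms by (simp add: y_def add_pos_nonneg)
    have "inverse (y\<^sup>2) - (1 / y - 1 / (y + 1)) = 1 / (y\<^sup>2 * (y + 1))"
      using y by (simp add: divide_simps power2_eq_square)
    moreover have "1 / (y\<^sup>2 * (y + 1)) > 0" using y by simp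
    moreover have "f k = 1 / y" "f (Suc k) = 1 / (y + 1)" by (simp_all add: f_def y_def add_ac)
    ultimately show ?thesis by (simp add: y_def)
  qed
  have "0 < (\<Sum>k. inverse ((x + real k)\<^sup>2) - (f k - f (Suc k)))"
    using pos by (intro suminf_pos summable_diff s2 sums_summable[OF tel]) auto
  also have "\<dots> = Polygamma 1 x - 1 / x"
    using suminf_diff[OF s2 sums_summable[OF tel]] sums_unique[OF tel] P by simp
  finally show ?thesis by simp
qed

text \<open>By \<open>Polygamma_1_gt_inverse\<close>, subtracting \<open>x ln x - x\<close> from \<open>ln \<Gamma>\<close> leaves a strictly convex
function, so the graph of the difference lies strictly above its tangents.\<close>

lemma ln_Gamma_bregman_gt:
  fixes a b :: real assumes "a > 0" "b > 0" "a \<noteq> b"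
  shows "b * ln (b / a) - b + a < ln_Gamma b - ln_Gamma a - Digamma a * (b - a)"
proof -
  define g where "g x = ln_Gamma x - (x * ln x - x)" for x :: real
  define g' where "g' x = Digamma x - ln x" for x :: real
  have g: "(g has_real_derivative g' x) (at x)" if "x > 0" for x
    unfolding g_def g'_def using that by (auto intro!: derivative_eq_intros)
  have g': "(g' has_real_derivative Polygamma 1 x - 1 / x) (at x)" if "x > 0" for x
    unfolding g'_def using that by (auto intro!: derivative_eq_intros simp: divide_inverse)
  have mono: "g' x < g' y" if "0 < x" "x < y" for x y
  proof (rule DERIV_pos_imp_increasing[OF \<open>x < y\<close>])
    fix z assume "x \<le> z" "z \<le> y"
    then have "z > 0" using that by linarith
    then show "\<exists>y. (g' has_real_derivative y) (at z) \<and> 0 < y"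
      using g' Polygamma_1_gt_inverse[of z] by (intro exI[of _ "Polygamma 1 z - 1 / z"]) auto
  qed
  have "g' a * (b - a) < g b - g a"
  proof (cases "a < b")
    case True
    obtain z where z: "a < z" "z < b" "g b - g a = (b - a) * g' z"
      using MVT2[OF True, of g g'] g assms by force
    then show ?thesis using mono[of a z] assms(1) True by (simp add: mult.commute)
  next
    case False
    then have "b < a" using assms by simp
    obtain z where z: "b < z" "z < a" "g a - g b = (a - b) * g' z"
      using MVT2[OF \<open>b < a\<close>, of g g'] g assms by force
    then have "(a - b) * g' z < (a - b) * g' a" using mono[of z a] assms \<open>b < a\<close> by simp
    then show ?thesis using z(3) by (simp add: algebra_simps)
  qed
  then show ?thesis using assms by (simp add: g_def g'_def ln_div algebra_simps)
qed

text \<open>Strict convexity of the log-partition function \<open>ln \<Gamma>(a) + a ln b\<close> of the gamma distributions with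
respect to their natural parameters \<open>(a, 1 / b)\<close>, as a tangent inequality.  The gap splits into the
gap of \<open>ln_Gamma_bregman_gt\<close> and \<open>a' (r - 1 - ln r)\<close> with \<open>r = a b / (a' b')\<close>; the first is
positive unless \<open>a = a'\<close>, the second unless \<open>r = 1\<close>.\<close>

lemma gamma_log_partition_bregman_gt:
  fixes a a' b b' :: real
  assumes pos: "a > 0" "a' > 0" "b > 0" "b' > 0" and neq: "a \<noteq> a' \<or> b \<noteq> b'"
  shows "ln_Gamma a + a * ln b + (Digamma a + ln b) * (a' - a) - a * b * (1 / b' - 1 / b)
       < ln_Gamma a' + a' * ln b'"
proof -
  define r where "r = (a * b) / (a' * b')"
  have r: "r > 0" using pos by (simp add: r_def)
  have lr: "ln r = ln a + ln b - ln a' - ln b'" using pos by (simp add: r_def ln_div ln_mult)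
  have "a' * r = a * b / b'" using pos by (simp add: r_def)
  have key: "ln_Gamma a' + a' * ln b' - (ln_Gamma a + a * ln b + (Digamma a + ln b) * (a' - a) - a * b * (1 / b' - 1 / b))
     = (ln_Gamma a' - ln_Gamma a - Digamma a * (a' - a) - (a' * ln (a' / a) - a' + a)) + a' * (r - 1 - ln r)"
    using pos \<open>a' * r = a * b / b'\<close> unfolding right_diff_distrib[of a'] lr by (simp add: ln_div algebra_simps)
  have 1: "0 \<le> a' * (r - 1 - ln r)" using ln_le_minus_one[OF r] pos by simp
  show ?thesis
  proof (cases "a = a'")
    case True
    then have "r \<noteq> 1" using neq pos by (auto simp: r_def)
    then have "ln r < r - 1" using ln_le_minus_one[OF r] ln_eq_minus_one[OF r] by fastforce
    then have "0 < a' * (r - 1 - ln r)" using pos by simp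
    then show ?thesis using key True pos by simp
  next
    case False
    then show ?thesis using key 1 ln_Gamma_bregman_gt[of a a'] pos by linarith
  qed
qed

section \<open>The multivariate Gamma density and its increments\<close>

lemma prev_index_less:
  fixes i :: "'n::{finite,linorder}"
  assumes "i \<noteq> Min UNIV"
  shows "prev_index i < i"
proof -
  have "Min UNIV < i" using assms by (simp add: order_less_le)
  then have "prev_index i \<in> {j. j < i}" unfolding prev_index_def by (intro Max_in) auto
  then show ?thesis by simp
qed

lemma sum_increments_atMost: "(\<Sum>i\<in>{..k}. increments x $ i) = x $ k"
proof (induction "card {..<k}" arbitrary: k rule: less_induct)
  case less
  show ?case
  proof (cases "k = Min UNIV")
    case True
    then have "{..k} = {k}" by (auto intro: order_antisym)
    then show ?thesis using True by (simp add: increments_def)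
  next
    case False
    let ?j = "prev_index k"
    have j: "?j < k" by (rule prev_index_less) fact
    have le: "i \<le> ?j" if "i < k" for i using that unfolding prev_index_def by (intro Max_ge) auto
    have "{..k} = insert k {..?j}" using j le by force
    moreover have "card {..<?j} < card {..<k}" using j by (intro psubset_card_mono) auto
    ultimately show ?thesis using less j False by (simp add: increments_def)
  qed
qed

lemma sum_increments: "(\<Sum>i\<in>UNIV. increments x $ i) = x $ Max UNIV"
proof -
  have "{..Max UNIV} = (UNIV :: 'a set)" by auto
  then show ?thesis using sum_increments_atMost[of x "Max UNIV"] by simp
qed

lemma mg_support_iff_increments: "x \<in> mg_support \<longleftrightarrow> (\<forall>i. 0 < increments x $ i)"
proof
  assume "x \<in> mg_support"
  then show "\<forall>i. 0 < increments x $ i" using prev_index_less by (auto simp: mg_support_def increments_def)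
next
  assume pos: "\<forall>i. 0 < increments x $ i"
  have "0 < x $ k" for k
    unfolding sum_increments_atMost[of x k, symmetric] using pos by (intro sum_pos) auto
  moreover have "x $ i < x $ j" if "i < j" for i j
    unfolding sum_increments_atMost[of x, symmetric]
    using pos that by (intro sum_strict_mono2[of _ _ j]) (auto intro: less_imp_le)
  ultimately show "x \<in> mg_support" by (simp add: mg_support_def)
qed

text \<open>In terms of the increments the density is that of independent gamma variables, because the
increments sum up to the last coordinate.\<close>

lemma mg_density_eq_exp:
  assumes "\<forall>i. 0 < \<alpha> $ i" "0 < \<beta>" "x \<in> mg_support"
  shows "mg_density \<alpha> \<beta> x = exp ((\<Sum>i\<in>UNIV. (\<alpha> $ i - 1) * ln (increments x $ i) - ln_Gamma (\<alpha> $ i) - \<alpha> $ i * ln \<beta>)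
           - x $ Max UNIV / \<beta>)"
proof -
  have z: "increments x $ i > 0" for i using assms(3) mg_support_iff_increments by blast
  have "(x $ Min UNIV) powr (\<alpha> $ Min UNIV - 1) * (\<Prod>i\<in>UNIV - {Min UNIV}. (x $ i - x $ prev_index i) powr (\<alpha> $ i - 1))
     = (\<Prod>i\<in>UNIV. increments x $ i powr (\<alpha> $ i - 1))"
    by (subst (2) prod.remove[of _ "Min UNIV"]) (auto simp: increments_def)
  also have "\<dots> = exp (\<Sum>i\<in>UNIV. (\<alpha> $ i - 1) * ln (increments x $ i))"
    using z by (simp add: powr_def exp_sum less_imp_neq[symmetric])
  finally have 1: "(x $ Min UNIV) powr (\<alpha> $ Min UNIV - 1) * (\<Prod>i\<in>UNIV - {Min UNIV}. (x $ i - x $ prev_index i) powr (\<alpha> $ i - 1))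
     = exp (\<Sum>i\<in>UNIV. (\<alpha> $ i - 1) * ln (increments x $ i))" .
  have 2: "\<beta> powr (\<Sum>i\<in>UNIV. \<alpha> $ i) = exp (\<Sum>i\<in>UNIV. \<alpha> $ i * ln \<beta>)"
    using assms(2) by (simp add: powr_def sum_distrib_right)
  have 3: "(\<Prod>i\<in>UNIV. Gamma (\<alpha> $ i)) = exp (\<Sum>i\<in>UNIV. ln_Gamma (\<alpha> $ i))"
    using assms(1) by (simp add: exp_sum Gamma_real_pos_exp)
  have "mg_density \<alpha> \<beta> x = 1 / (exp (\<Sum>i\<in>UNIV. \<alpha> $ i * ln \<beta>) * exp (\<Sum>i\<in>UNIV. ln_Gamma (\<alpha> $ i)))
      * exp (- x $ Max UNIV / \<beta>) * exp (\<Sum>i\<in>UNIV. (\<alpha> $ i - 1) * ln (increments x $ i))"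
    using assms(3) unfolding mg_density_def 1[symmetric] 2[symmetric] 3[symmetric] by (simp add: mult.assoc)
  moreover have "1 / (exp c * exp b) * exp (- m) * exp a = exp (a - b - c - m)" for a b c m :: real
    by (simp add: exp_diff exp_minus exp_add field_simps)
  ultimately show ?thesis by (simp only: sum_subtractf minus_divide_left[symmetric])
qed

lemma lborel_vec_eq_PiM:
  "(lborel :: (real^'n) measure) = distr (PiM UNIV (\<lambda>_::'n. lborel)) borel (\<lambda>f. \<chi> i. f i)"
proof (rule lborel_eqI)
  interpret product_sigma_finite "\<lambda>_::'n. lborel :: real measure" by unfold_locales
  have Basis: "Basis = range (\<lambda>i::'n. axis i (1::real))" by (auto simp: Basis_vec_def)
  have meas[measurable]: "(\<lambda>f. \<chi> i. f i) \<in> borel_measurable (PiM UNIV (\<lambda>_::'n. lborel :: real measure))"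
    unfolding borel_measurable_euclidean_space[of "\<lambda>f. \<chi> i. f i"] Basis
    by (auto simp: inner_axis)
  fix l u :: "real^'n" assume le: "\<And>b. b \<in> Basis \<Longrightarrow> l \<bullet> b \<le> u \<bullet> b"
  then have lu: "l $ i \<le> u $ i" for i using le[of "axis i 1"] by (simp add: Basis inner_axis)
  have "(\<lambda>f. \<chi> i. f i) -` box l u \<inter> space (PiM UNIV (\<lambda>_::'n. lborel :: real measure)) = PiE UNIV (\<lambda>i. {l $ i <..< u $ i})"
    by (auto simp: space_PiM PiE_iff mem_box_cart)
  then have "emeasure (distr (PiM UNIV (\<lambda>_::'n. lborel)) borel (\<lambda>f. \<chi> i. f i)) (box l u)
     = (\<Prod>i\<in>UNIV. emeasure lborel {l $ i <..< u $ i})"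
    by (subst emeasure_distr) (auto simp: emeasure_PiM)
  also have "\<dots> = ennreal (\<Prod>i\<in>UNIV. u $ i - l $ i)"
    using lu by (simp add: prod_ennreal)
  also have "(\<Prod>i\<in>UNIV. u $ i - l $ i) = (\<Prod>b\<in>Basis. (u - l) \<bullet> b)"
    unfolding Basis by (subst prod.reindex) (auto simp: inj_on_def axis_eq_axis inner_axis)
  finally show "emeasure (distr (PiM UNIV (\<lambda>_::'n. lborel)) borel (\<lambda>f. \<chi> i. f i)) (box l u) = ennreal (\<Prod>b\<in>Basis. (u - l) \<bullet> b)" .
qed simp

text \<open>The map from a vector to its increments preserves Lebesgue measure.  For products this is seen by
integrating out the coordinates one by one, the largest index first: it occurs in a single factor,
from which the previous coordinate disappears by translation invariance.  The coordinate sets in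
the induction are initial segments, closed under \<open>prev_index\<close>.\<close>

lemma nn_integral_prod_increments_PiM:
  fixes \<phi> :: "'n::{finite,linorder} \<Rightarrow> real \<Rightarrow> ennreal" and A :: "'n set"
  defines "c i x \<equiv> if i = Min UNIV then 0 else x (prev_index i)"
  assumes \<phi>[measurable]: "\<And>i. \<phi> i \<in> borel_measurable borel"
    and "finite A" and "\<And>i. i \<in> A \<Longrightarrow> i \<noteq> Min UNIV \<Longrightarrow> prev_index i \<in> A"
  shows "(\<integral>\<^sup>+x. (\<Prod>i\<in>A. \<phi> i (x i - c i x)) \<partial>PiM A (\<lambda>_. lborel)) = (\<Prod>i\<in>A. \<integral>\<^sup>+z. \<phi> i z \<partial>lborel)"
  using assms(3,4)
proof (induction A rule: finite_linorder_max_induct)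
  case empty
  interpret product_sigma_finite "\<lambda>_::'n. lborel :: real measure" by unfold_locales
  show ?case by (simp add: PiM_empty nn_integral_count_space_finite)
next
  case (insert b A)
  interpret product_sigma_finite "\<lambda>_::'n. lborel :: real measure" by unfold_locales
  have b: "b \<notin> A" using insert by auto
  have prevA: "prev_index i \<in> A" if "i \<in> A" "i \<noteq> Min UNIV" for i
  proof -
    have "prev_index i < b" using prev_index_less[OF that(2)] insert.hyps(2) that(1) by force
    then show ?thesis using insert.prems[of i] that by auto
  qed
  have prevb: "prev_index b \<in> A" if "b \<noteq> Min UNIV"
    using insert.prems[of b] prev_index_less[OF that] that by auto
  have meas: "(\<lambda>x. x i - c i x) \<in> borel_measurable (PiM J (\<lambda>_. lborel))"
    if "i \<in> J" "i \<noteq> Min UNIV \<Longrightarrow> prev_index i \<in> J" for i J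
    using that unfolding c_def by (cases "i = Min UNIV") simp_all
  have cm: "c b \<in> borel_measurable (PiM A (\<lambda>_. lborel))"
    using prevb unfolding c_def[abs_def] by (cases "b = Min UNIV") simp_all
  have "(\<lambda>x. \<Prod>i\<in>insert b A. \<phi> i (x i - c i x)) \<in> borel_measurable (PiM (insert b A) (\<lambda>_. lborel))"
    by (intro borel_measurable_prod_ennreal measurable_compose[OF meas \<phi>]) (use insert.prems in auto)
  then have "(\<integral>\<^sup>+x. (\<Prod>i\<in>insert b A. \<phi> i (x i - c i x)) \<partial>PiM (insert b A) (\<lambda>_. lborel))
     = (\<integral>\<^sup>+x. (\<integral>\<^sup>+y. (\<Prod>i\<in>insert b A. \<phi> i ((x(b := y)) i - c i (x(b := y)))) \<partial>lborel) \<partial>PiM A (\<lambda>_. lborel))"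
    using insert.hyps(1) b by (intro product_nn_integral_insert) auto
  also have "\<dots> = (\<integral>\<^sup>+x. (\<integral>\<^sup>+y. (\<Prod>i\<in>A. \<phi> i (x i - c i x)) * \<phi> b (y - c b x) \<partial>lborel) \<partial>PiM A (\<lambda>_. lborel))"
  proof (intro nn_integral_cong)
    fix x :: "'n \<Rightarrow> real" and y :: real
    have "c b (x(b := y)) = c b x" using prev_index_less[of b] by (auto simp: c_def)
    moreover have "\<phi> i ((x(b := y)) i - c i (x(b := y))) = \<phi> i (x i - c i x)" if "i \<in> A" for i
      using that b prevA[OF that] by (auto simp: c_def)
    ultimately show "(\<Prod>i\<in>insert b A. \<phi> i ((x(b := y)) i - c i (x(b := y)))) = (\<Prod>i\<in>A. \<phi> i (x i - c i x)) * \<phi> b (y - c b x)"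
      using b insert.hyps(1) by (simp add: mult.commute)
  qed
  also have "\<dots> = (\<integral>\<^sup>+x. (\<Prod>i\<in>A. \<phi> i (x i - c i x)) * (\<integral>\<^sup>+z. \<phi> b z \<partial>lborel) \<partial>PiM A (\<lambda>_. lborel))"
  proof (intro nn_integral_cong)
    fix x :: "'n \<Rightarrow> real"
    have "(\<integral>\<^sup>+z. \<phi> b z \<partial>lborel) = (\<integral>\<^sup>+y. \<phi> b (y - c b x) \<partial>lborel)"
      using nn_integral_real_affine[of "\<phi> b" 1 "- c b x"] by simp
    then show "(\<integral>\<^sup>+y. (\<Prod>i\<in>A. \<phi> i (x i - c i x)) * \<phi> b (y - c b x) \<partial>lborel)
        = (\<Prod>i\<in>A. \<phi> i (x i - c i x)) * (\<integral>\<^sup>+z. \<phi> b z \<partial>lborel)"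
      by (simp add: nn_integral_cmult)
  qed
  also have "\<dots> = (\<integral>\<^sup>+x. (\<Prod>i\<in>A. \<phi> i (x i - c i x)) \<partial>PiM A (\<lambda>_. lborel)) * (\<integral>\<^sup>+z. \<phi> b z \<partial>lborel)"
    by (intro nn_integral_multc borel_measurable_prod_ennreal measurable_compose[OF meas \<phi>]) (use prevA in auto)
  also have "\<dots> = (\<Prod>i\<in>A. \<integral>\<^sup>+z. \<phi> i z \<partial>lborel) * (\<integral>\<^sup>+z. \<phi> b z \<partial>lborel)"
    using insert.IH prevA by simp
  finally show ?case using b insert.hyps(1) by (simp add: mult.commute)
qed

lemma nn_integral_prod_increments:
  fixes \<phi> :: "'n::{finite,linorder} \<Rightarrow> real \<Rightarrow> ennreal"
  assumes \<phi>[measurable]: "\<And>i. \<phi> i \<in> borel_measurable borel"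
  shows "(\<integral>\<^sup>+x. (\<Prod>i\<in>UNIV. \<phi> i (increments x $ i)) \<partial>lborel) = (\<Prod>i\<in>UNIV. \<integral>\<^sup>+z. \<phi> i z \<partial>lborel)"
proof -
  have Basis: "Basis = range (\<lambda>i::'n. axis i (1::real))" by (auto simp: Basis_vec_def)
  have meas: "(\<lambda>f. \<chi> i. f i) \<in> borel_measurable (PiM UNIV (\<lambda>_::'n. lborel :: real measure))"
    unfolding borel_measurable_euclidean_space[of "\<lambda>f. \<chi> i. f i"] Basis
    by (auto simp: inner_axis)
  have inc: "(\<lambda>x. increments x $ i) \<in> borel_measurable borel" for i :: 'n
    unfolding increments_def by (cases "i = Min UNIV") simp_all
  have "(\<integral>\<^sup>+x. (\<Prod>i\<in>UNIV. \<phi> i (increments x $ i)) \<partial>lborel)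
     = (\<integral>\<^sup>+f. (\<Prod>i\<in>UNIV. \<phi> i (increments (\<chi> i. f i) $ i)) \<partial>PiM UNIV (\<lambda>_. lborel))"
  proof -
    have "(\<lambda>x. \<Prod>i\<in>UNIV. \<phi> i (increments x $ i)) \<in> borel_measurable borel"
      by (intro borel_measurable_prod_ennreal measurable_compose[OF inc \<phi>])
    then show ?thesis by (subst lborel_vec_eq_PiM) (simp add: nn_integral_distr[OF meas])
  qed
  also have "\<dots> = (\<integral>\<^sup>+f. (\<Prod>i\<in>UNIV. \<phi> i (f i - (if i = Min UNIV then 0 else f (prev_index i)))) \<partial>PiM UNIV (\<lambda>_. lborel))"
    by (intro nn_integral_cong prod.cong arg_cong[where f="\<phi> _"]) (auto simp: increments_def)
  also have "\<dots> = (\<Prod>i\<in>UNIV. \<integral>\<^sup>+z. \<phi> i z \<partial>lborel)"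
    by (rule nn_integral_prod_increments_PiM) auto
  finally show ?thesis .
qed

lemma nn_integral_gamma_density:
  fixes a b :: real assumes "a > 0" "b > 0"
  shows "(\<integral>\<^sup>+z. ennreal (if z > 0 then exp ((a - 1) * ln z - ln_Gamma a - a * ln b - z / b) else 0) \<partial>lborel) = 1"
proof -
  have eq: "(if 0 + b * t > 0 then exp ((a - 1) * ln (0 + b * t) - ln_Gamma a - a * ln b - (0 + b * t) / b) else 0)
     = 1 / (b * Gamma a) * (indicator {0..} t * t powr (a - 1) / exp t)" for t
  proof (cases "t > 0")
    case True
    then have "exp ((a - 1) * ln (b * t) - ln_Gamma a - a * ln b - b * t / b)
        = exp ((a - 1) * ln t) * inverse b * inverse (exp (ln_Gamma a)) * inverse (exp t)"
      using assms by (simp add: ln_mult algebra_simps exp_diff exp_add exp_minus exp_ln divide_inverse)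
    then show ?thesis using True assms by (simp add: powr_def Gamma_real_pos_exp divide_inverse)
  next
    case False
    then show ?thesis using assms by (cases "t = 0") (auto simp: zero_less_mult_iff)
  qed
  have "(\<integral>\<^sup>+z. ennreal (if z > 0 then exp ((a - 1) * ln z - ln_Gamma a - a * ln b - z / b) else 0) \<partial>lborel)
     = ennreal b * (\<integral>\<^sup>+t. ennreal (1 / (b * Gamma a) * (indicator {0..} t * t powr (a - 1) / exp t)) \<partial>lborel)"
  proof -
    define f where "f z = ennreal (if z > 0 then exp ((a - 1) * ln z - ln_Gamma a - a * ln b - z / b) else 0)" for z
    have "f \<in> borel_measurable borel" unfolding f_def by measurable
    then have "(\<integral>\<^sup>+z. f z \<partial>lborel) = ennreal \<bar>b\<bar> * (\<integral>\<^sup>+t. f (0 + b * t) \<partial>lborel)"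
      by (rule nn_integral_real_affine) (use assms in auto)
    then show ?thesis using assms unfolding f_def eq by simp
  qed
  also have "\<dots> = ennreal b * (ennreal (1 / (b * Gamma a)) * ennreal (Gamma a))"
    using assms by (subst ennreal_mult', simp, subst nn_integral_cmult) (simp_all add: Gamma_conv_nn_integral_real)
  also have "\<dots> = ennreal (b * (1 / (b * Gamma a) * Gamma a))"
    using assms by (simp add: ennreal_mult[symmetric])
  also have "\<dots> = 1"
  proof -
    have "Gamma a \<noteq> 0" using Gamma_real_pos[OF assms(1)] by linarith
    then show ?thesis using assms by simp
  qed
  finally show ?thesis .
qed

text \<open>The only integral that has to be evaluated.  Knowing that the density has mass 1 for all parameters
gives all moments of the sufficient statistic by exponential tilting.\<close>

lemma nn_integral_mg_density:
  fixes \<alpha> :: "real^'n::{finite,linorder}"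
  assumes "\<forall>i. 0 < \<alpha> $ i" "0 < \<beta>"
  shows "(\<integral>\<^sup>+x. ennreal (mg_density \<alpha> \<beta> x) \<partial>lborel) = 1"
proof -
  define \<phi> where "\<phi> i z = ennreal (if z > 0 then exp ((\<alpha> $ i - 1) * ln z - ln_Gamma (\<alpha> $ i) - \<alpha> $ i * ln \<beta> - z / \<beta>) else 0)" for i z
  have "ennreal (mg_density \<alpha> \<beta> x) = (\<Prod>i\<in>UNIV. \<phi> i (increments x $ i))" for x
  proof (cases "x \<in> mg_support")
    case True
    then have "\<forall>i. 0 < increments x $ i" by (simp add: mg_support_iff_increments)
    then have "(\<Prod>i\<in>UNIV. \<phi> i (increments x $ i)) = ennreal (exp (\<Sum>i\<in>UNIV.
        (\<alpha> $ i - 1) * ln (increments x $ i) - ln_Gamma (\<alpha> $ i) - \<alpha> $ i * ln \<beta> - increments x $ i / \<beta>))"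
      by (simp add: \<phi>_def prod_ennreal exp_sum)
    also have "(\<Sum>i\<in>UNIV. (\<alpha> $ i - 1) * ln (increments x $ i) - ln_Gamma (\<alpha> $ i) - \<alpha> $ i * ln \<beta> - increments x $ i / \<beta>)
      = (\<Sum>i\<in>UNIV. (\<alpha> $ i - 1) * ln (increments x $ i) - ln_Gamma (\<alpha> $ i) - \<alpha> $ i * ln \<beta>) - x $ Max UNIV / \<beta>"
      unfolding sum_increments[of x, symmetric] by (simp add: sum_subtractf sum_divide_distrib)
    finally show ?thesis using mg_density_eq_exp[OF assms True] by simp
  next
    case False
    then obtain i where "\<not> 0 < increments x $ i" by (auto simp: mg_support_iff_increments)
    then have "\<phi> i (increments x $ i) = 0" by (simp add: \<phi>_def)
    then have "(\<Prod>i\<in>UNIV. \<phi> i (increments x $ i)) = 0" by (intro prod_zero) auto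
    then show ?thesis using False by (simp add: mg_density_def)
  qed
  then have "(\<integral>\<^sup>+x. ennreal (mg_density \<alpha> \<beta> x) \<partial>lborel) = (\<Prod>i\<in>UNIV. \<integral>\<^sup>+z. \<phi> i z \<partial>lborel)"
    by (simp only:) (rule nn_integral_prod_increments, simp add: \<phi>_def)
  also have "\<dots> = 1" using assms by (simp add: \<phi>_def nn_integral_gamma_density)
  finally show ?thesis .
qed

section \<open>The multivariate Gamma laws as an exponential family\<close>

text \<open>The sufficient statistic, whose expectation will turn out to be \<open>mg_mean\<close>.\<close>

definition mg_stat :: "real^'n::{finite,linorder} \<Rightarrow> real^('n + unit)" where
  "mg_stat x = (\<chi> j. case j of Inl i \<Rightarrow> ln (increments x $ i) | Inr _ \<Rightarrow> x $ Max UNIV)"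

definition mg_mean :: "real^('n::finite + unit) \<Rightarrow> real^('n + unit)" where
  "mg_mean \<theta> = (\<chi> j. case j of
       Inl i \<Rightarrow> Digamma (\<theta> $ Inl i) + ln (\<theta> $ Inr ())
     | Inr _ \<Rightarrow> (\<Sum>i\<in>UNIV. \<theta> $ Inl i) * \<theta> $ Inr ())"

definition mg_log_partition :: "real^('n::finite + unit) \<Rightarrow> real" where
  "mg_log_partition \<theta> = (\<Sum>i\<in>UNIV. ln_Gamma (\<theta> $ Inl i) + \<theta> $ Inl i * ln (\<theta> $ Inr ()))"

text \<open>The log-density of one observation as a function of the statistic \<open>t\<close>.  As it is affine in \<open>t\<close>, it is
also the mean log-likelihood of a sample if \<open>t\<close> is the sample mean of the statistic.\<close>

definition mg_log_lik :: "real^('n::finite + unit) \<Rightarrow> real^('n + unit) \<Rightarrow> real" where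
  "mg_log_lik \<theta> t = (\<Sum>i\<in>UNIV. (\<theta> $ Inl i - 1) * t $ Inl i) - t $ Inr () / \<theta> $ Inr () - mg_log_partition \<theta>"

text \<open>A straight line in the natural parameters \<open>(\<alpha>, - 1 / \<beta>)\<close>, along which densities are exponentially
tilted by \<open>s * (u \<bullet> mg_stat x)\<close>.\<close>

definition natural_curve :: "real^('n::finite + unit) \<Rightarrow> real^('n + unit) \<Rightarrow> real \<Rightarrow> real^('n + unit)" where
  "natural_curve \<theta> u s = (\<chi> j. case j of
       Inl i \<Rightarrow> \<theta> $ Inl i + s * u $ Inl i
     | Inr _ \<Rightarrow> 1 / (1 / \<theta> $ Inr () - s * u $ Inr ()))"

lemma sum_UNIV_plus_unit: "(\<Sum>j\<in>(UNIV :: ('n::finite + unit) set). f j) = (\<Sum>i\<in>UNIV. f (Inl i)) + f (Inr ())"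
  unfolding UNIV_Plus_UNIV[symmetric] by (subst sum.Plus) (auto simp: UNIV_unit)

lemma inner_vec_plus_unit:
  fixes u v :: "real^('n::finite + unit)"
  shows "u \<bullet> v = (\<Sum>i\<in>UNIV. u $ Inl i * v $ Inl i) + u $ Inr () * v $ Inr ()"
  by (simp add: inner_vec_def sum_UNIV_plus_unit)

lemma mg_family_eq_exp:
  assumes "\<theta> \<in> mg_params" "x \<in> mg_support"
  shows "mg_family \<theta> x = exp (mg_log_lik \<theta> (mg_stat x))"
  using assms mg_density_eq_exp[of "shape_of \<theta>" "scale_of \<theta>" x]
  by (simp add: mg_family_def mg_params_def shape_of_def scale_of_def mg_log_lik_def mg_log_partition_def
      mg_stat_def sum_subtractf sum.distrib algebra_simps)

lemma mg_family_outside: "x \<notin> mg_support \<Longrightarrow> mg_family \<theta> x = 0"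
  by (simp add: mg_family_def mg_density_def)

lemma borel_measurable_increments [measurable]: "(\<lambda>x. increments x $ i) \<in> borel_measurable borel"
  unfolding increments_def by (cases "i = Min UNIV") simp_all

lemma mg_support_borel [measurable]: "(mg_support :: (real^'n::{finite,linorder}) set) \<in> sets borel"
proof -
  have "mg_support = {x. \<forall>i. 0 < increments x $ i}" by (auto simp: mg_support_iff_increments)
  also have "\<dots> \<in> sets borel" by measurable
  finally show ?thesis .
qed

lemma borel_measurable_mg_stat_nth [measurable]:
  fixes j :: "'n::{finite,linorder} + unit"
  shows "(\<lambda>x. mg_stat x $ j) \<in> borel_measurable borel"
  unfolding mg_stat_def by (cases j) simp_all

lemma borel_measurable_mg_stat [measurable]:
  "(mg_stat :: real^'n::{finite,linorder} \<Rightarrow> _) \<in> borel_measurable borel"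
  unfolding borel_measurable_euclidean_space[of mg_stat] by (auto simp: Basis_vec_def inner_axis)

lemma borel_measurable_mg_family [measurable]:
  assumes "\<theta> \<in> mg_params"
  shows "mg_family \<theta> \<in> borel_measurable borel"
proof -
  have "mg_family \<theta> = (\<lambda>x. if x \<in> mg_support then exp (mg_log_lik \<theta> (mg_stat x)) else 0)"
    using mg_family_eq_exp[OF assms] mg_family_outside by fastforce
  moreover have "(\<lambda>x. exp (mg_log_lik \<theta> (mg_stat x))) \<in> borel_measurable borel"
    unfolding mg_log_lik_def by measurable
  ultimately show ?thesis by simp
qed

lemma mg_family_nonneg: "\<theta> \<in> mg_params \<Longrightarrow> 0 \<le> mg_family \<theta> x"
  using mg_family_eq_exp[of \<theta> x] mg_family_outside[of x \<theta>] by (cases "x \<in> mg_support") auto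

lemma has_bochner_integral_mg_family:
  assumes "\<theta> \<in> mg_params"
  shows "has_bochner_integral lborel (mg_family \<theta>) 1"
proof (rule has_bochner_integral_nn_integral)
  show "(\<integral>\<^sup>+x. ennreal (mg_family \<theta> x) \<partial>lborel) = ennreal 1"
    using assms nn_integral_mg_density[of "shape_of \<theta>" "scale_of \<theta>"]
    by (simp add: mg_family_def mg_params_def shape_of_def scale_of_def)
qed (use assms in \<open>auto simp: mg_family_nonneg\<close>)

abbreviation (input) mg_law :: "real^('n + unit) \<Rightarrow> (real^'n::{finite,linorder}) measure" where
  "mg_law \<theta> \<equiv> multivariate_gamma (shape_of \<theta>) (scale_of \<theta>)"

lemma mg_law_eq: "mg_law \<theta> = density lborel (\<lambda>x. ennreal (mg_family \<theta> x))"
  by (simp add: multivariate_gamma_def mg_family_def)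

lemma AE_mg_law_support:
  assumes "\<theta> \<in> mg_params"
  shows "AE x in mg_law \<theta>. x \<in> mg_support"
proof -
  have [measurable]: "mg_family \<theta> \<in> borel_measurable borel" by (rule borel_measurable_mg_family) fact
  show ?thesis unfolding mg_law_eq
    by (subst AE_density, simp) (use mg_family_outside[of _ \<theta>] in force)
qed

lemma integral_mg_law:
  assumes \<theta>: "\<theta> \<in> mg_params" and g: "g \<in> borel_measurable borel"
    and val: "has_bochner_integral lborel (\<lambda>x. mg_family \<theta> x * g x) c"
  shows "integrable (mg_law \<theta>) g" "(LINT x|mg_law \<theta>. g x) = (c :: real)"
proof -
  have [measurable]: "mg_family \<theta> \<in> borel_measurable borel" by (rule borel_measurable_mg_family) fact
  show "integrable (mg_law \<theta>) g" "(LINT x|mg_law \<theta>. g x) = c"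
    unfolding mg_law_eq using g val mg_family_nonneg[OF \<theta>]
    by (simp_all add: integrable_density integral_density has_bochner_integral_iff)
qed

text \<open>Exponential tilting stays within the family.\<close>

lemma mg_log_lik_natural_curve:
  "mg_log_lik \<theta> t + s * (u \<bullet> t) =
     mg_log_lik (natural_curve \<theta> u s) t + mg_log_partition (natural_curve \<theta> u s) - mg_log_partition \<theta>"
  by (simp add: mg_log_lik_def natural_curve_def inner_vec_plus_unit sum.distrib sum_subtractf sum_distrib_left algebra_simps)

lemma natural_curve_in_params:
  assumes "\<theta> \<in> mg_params"
  obtains d where "d > 0" "\<And>s. \<bar>s\<bar> < d \<Longrightarrow> natural_curve \<theta> u s \<in> mg_params"
    "\<And>s i. \<bar>s\<bar> < d \<Longrightarrow> 0 < \<theta> $ Inl i + s * u $ Inl i"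
    "\<And>s. \<bar>s\<bar> < d \<Longrightarrow> 0 < 1 / \<theta> $ Inr () - s * u $ Inr ()"
proof -
  have pos: "0 < \<theta> $ j" for j using assms by (simp add: mg_params_def)
  have "\<forall>\<^sub>F s in nhds 0. 0 < \<theta> $ Inl i + s * u $ Inl i" for i
  proof (rule order_tendstoD(1))
    show "((\<lambda>s. \<theta> $ Inl i + s * u $ Inl i) \<longlongrightarrow> \<theta> $ Inl i + 0 * u $ Inl i) (nhds 0)"
      by (intro tendsto_intros filterlim_ident)
  qed (use pos in simp)
  then have 1: "\<forall>\<^sub>F s in nhds 0. \<forall>i. 0 < \<theta> $ Inl i + s * u $ Inl i" by (rule eventually_all_finite)
  have 2: "\<forall>\<^sub>F s in nhds 0. 0 < 1 / \<theta> $ Inr () - s * u $ Inr ()"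
  proof (rule order_tendstoD(1))
    show "((\<lambda>s. 1 / \<theta> $ Inr () - s * u $ Inr ()) \<longlongrightarrow> 1 / \<theta> $ Inr () - 0 * u $ Inr ()) (nhds 0)"
      by (intro tendsto_intros filterlim_ident)
  qed (use pos in simp)
  obtain d where d: "d > 0" "\<And>s. dist s 0 < d \<Longrightarrow> (\<forall>i. 0 < \<theta> $ Inl i + s * u $ Inl i) \<and> 0 < 1 / \<theta> $ Inr () - s * u $ Inr ()"
    using eventually_conj[OF 1 2] unfolding eventually_nhds_metric by blast
  show thesis
  proof (rule that[OF d(1)])
    show "natural_curve \<theta> u s \<in> mg_params" if "\<bar>s\<bar> < d" for s
      using d(2)[of s] that by (auto simp: mg_params_def natural_curve_def dist_real_def split: sum.split)
  qed (use d(2) in \<open>auto simp: dist_real_def\<close>)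
qed

text \<open>The log-partition function on a natural line and its first derivative; the scale is expressed by the
rate \<open>1 / \<beta>\<close>, which is affine along the line.
The second derivative at 0 is \<open>mg_variance\<close>.\<close>

definition log_partition_along :: "real^('n::finite + unit) \<Rightarrow> real^('n + unit) \<Rightarrow> real \<Rightarrow> real" where
  "log_partition_along \<theta> u s = (\<Sum>i\<in>UNIV. ln_Gamma (\<theta> $ Inl i + s * u $ Inl i)
     - (\<theta> $ Inl i + s * u $ Inl i) * ln (1 / \<theta> $ Inr () - s * u $ Inr ()))"

definition log_partition_along' :: "real^('n::finite + unit) \<Rightarrow> real^('n + unit) \<Rightarrow> real \<Rightarrow> real" where
  "log_partition_along' \<theta> u s = (\<Sum>i\<in>UNIV. u $ Inl i * Digamma (\<theta> $ Inl i + s * u $ Inl i)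
     - u $ Inl i * ln (1 / \<theta> $ Inr () - s * u $ Inr ())
     + (\<theta> $ Inl i + s * u $ Inl i) * u $ Inr () / (1 / \<theta> $ Inr () - s * u $ Inr ()))"

definition mg_variance :: "real^('n::finite + unit) \<Rightarrow> real^('n + unit) \<Rightarrow> real" where
  "mg_variance \<theta> u = (\<Sum>i\<in>UNIV. (u $ Inl i)\<^sup>2 * Polygamma 1 (\<theta> $ Inl i)
     + 2 * u $ Inl i * u $ Inr () * \<theta> $ Inr () + \<theta> $ Inl i * (u $ Inr ())\<^sup>2 * (\<theta> $ Inr ())\<^sup>2)"

lemma log_partition_natural_curve:
  assumes "0 < 1 / \<theta> $ Inr () - s * u $ Inr ()"
  shows "mg_log_partition (natural_curve \<theta> u s) = log_partition_along \<theta> u s"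
  using assms by (simp add: mg_log_partition_def log_partition_along_def natural_curve_def ln_div)

lemma log_partition_along_deriv:
  assumes pos: "\<And>i. 0 < \<theta> $ Inl i + s * u $ Inl i" "0 < 1 / \<theta> $ Inr () - s * u $ Inr ()"
  shows "(log_partition_along \<theta> u has_real_derivative log_partition_along' \<theta> u s) (at s)"
  unfolding log_partition_along_def[abs_def] log_partition_along'_def
proof (rule DERIV_sum)
  fix i
  have "((\<lambda>s. ln_Gamma (\<theta> $ Inl i + s * u $ Inl i)) has_real_derivative Digamma (\<theta> $ Inl i + s * u $ Inl i) * u $ Inl i) (at s)"
    by (rule DERIV_chain2[OF has_field_derivative_ln_Gamma_real]) (auto intro!: pos derivative_eq_intros)
  moreover have "((\<lambda>s. ln (1 / \<theta> $ Inr () - s * u $ Inr ())) has_real_derivative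
      1 / (1 / \<theta> $ Inr () - s * u $ Inr ()) * (- u $ Inr ())) (at s)"
    by (rule DERIV_chain2[OF DERIV_ln_divide], rule pos(2)) (auto intro!: derivative_eq_intros)
  moreover have "((\<lambda>s. \<theta> $ Inl i + s * u $ Inl i) has_real_derivative u $ Inl i) (at s)"
    by (auto intro!: derivative_eq_intros)
  ultimately show "((\<lambda>s. ln_Gamma (\<theta> $ Inl i + s * u $ Inl i)
       - (\<theta> $ Inl i + s * u $ Inl i) * ln (1 / \<theta> $ Inr () - s * u $ Inr ())) has_real_derivative
     u $ Inl i * Digamma (\<theta> $ Inl i + s * u $ Inl i) - u $ Inl i * ln (1 / \<theta> $ Inr () - s * u $ Inr ())
     + (\<theta> $ Inl i + s * u $ Inl i) * u $ Inr () / (1 / \<theta> $ Inr () - s * u $ Inr ())) (at s)"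
    using pos by (auto intro!: derivative_eq_intros)
qed

lemma log_partition_along'_deriv:
  assumes pos: "\<And>i. 0 < \<theta> $ Inl i" "0 < \<theta> $ Inr ()"
  shows "(log_partition_along' \<theta> u has_real_derivative mg_variance \<theta> u) (at 0)"
  unfolding log_partition_along'_def[abs_def] mg_variance_def
proof (rule DERIV_sum)
  fix i
  have npos: "\<theta> $ Inl i + 0 * u $ Inl i \<notin> \<int>\<^sub>\<le>\<^sub>0" using pos(1)[of i] by (auto dest: nonpos_Ints_nonpos)
  have "((\<lambda>s. Digamma (\<theta> $ Inl i + s * u $ Inl i)) has_real_derivative Polygamma (Suc 0) (\<theta> $ Inl i + 0 * u $ Inl i) * u $ Inl i) (at 0)"
    by (rule DERIV_chain2[where f=Digamma], rule has_field_derivative_Polygamma[OF npos]) (auto intro!: derivative_eq_intros)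
  moreover have "((\<lambda>s. ln (1 / \<theta> $ Inr () - s * u $ Inr ())) has_real_derivative
      1 / (1 / \<theta> $ Inr () - 0 * u $ Inr ()) * (- u $ Inr ())) (at 0)"
    by (rule DERIV_chain2[OF DERIV_ln_divide]) (use pos in \<open>auto intro!: derivative_eq_intros\<close>)
  moreover have "((\<lambda>s. (\<theta> $ Inl i + s * u $ Inl i) * u $ Inr () / (1 / \<theta> $ Inr () - s * u $ Inr ())) has_real_derivative
      u $ Inl i * u $ Inr () * \<theta> $ Inr () + \<theta> $ Inl i * (u $ Inr ())\<^sup>2 * (\<theta> $ Inr ())\<^sup>2) (at 0)"
    using pos(2) by (auto intro!: derivative_eq_intros simp: field_simps power2_eq_square)
  ultimately show "((\<lambda>s. u $ Inl i * Digamma (\<theta> $ Inl i + s * u $ Inl i) - u $ Inl i * ln (1 / \<theta> $ Inr () - s * u $ Inr ())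
     + (\<theta> $ Inl i + s * u $ Inl i) * u $ Inr () / (1 / \<theta> $ Inr () - s * u $ Inr ())) has_real_derivative
     (u $ Inl i)\<^sup>2 * Polygamma 1 (\<theta> $ Inl i)
     + 2 * u $ Inl i * u $ Inr () * \<theta> $ Inr () + \<theta> $ Inl i * (u $ Inr ())\<^sup>2 * (\<theta> $ Inr ())\<^sup>2) (at 0)"
    by (rule DERIV_cong[OF DERIV_add[OF DERIV_diff[OF DERIV_cmult DERIV_cmult]]]) (auto simp: power2_eq_square algebra_simps)
qed

lemma log_partition_along'_0:
  assumes "0 < \<theta> $ Inr ()"
  shows "log_partition_along' \<theta> u 0 = u \<bullet> mg_mean \<theta>"
  using assms by (simp add: log_partition_along'_def inner_vec_plus_unit mg_mean_def ln_div
      sum.distrib sum_distrib_left sum_distrib_right algebra_simps)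

text \<open>The tilted densities have mass 1, so the Laplace transform of \<open>u \<bullet> (mg_stat x - mg_mean \<theta>)\<close> is the
exponential of an increment of the log-partition function.  Its first two derivatives at 0 give the
mean and the variance of the score in every direction at once.\<close>

lemma mg_score_moments:
  assumes \<theta>: "\<theta> \<in> mg_params"
  shows "integrable (mg_law \<theta>) (\<lambda>x. u \<bullet> (mg_stat x - mg_mean \<theta>))"
    and "(LINT x|mg_law \<theta>. u \<bullet> (mg_stat x - mg_mean \<theta>)) = 0"
    and "integrable (mg_law \<theta>) (\<lambda>x. (u \<bullet> (mg_stat x - mg_mean \<theta>))\<^sup>2)"
    and "(LINT x|mg_law \<theta>. (u \<bullet> (mg_stat x - mg_mean \<theta>))\<^sup>2) = mg_variance \<theta> u"
proof -
  have pos: "0 < \<theta> $ j" for j using \<theta> by (simp add: mg_params_def)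
  define c where "c = u \<bullet> mg_mean \<theta>"
  define F where "F s = exp (log_partition_along \<theta> u s - mg_log_partition \<theta> - s * c)" for s
  define F' where "F' s = F s * (log_partition_along' \<theta> u s - c)" for s
  obtain d where d: "d > 0" "\<And>s. \<bar>s\<bar> < d \<Longrightarrow> natural_curve \<theta> u s \<in> mg_params"
    "\<And>s i. \<bar>s\<bar> < d \<Longrightarrow> 0 < \<theta> $ Inl i + s * u $ Inl i"
    "\<And>s. \<bar>s\<bar> < d \<Longrightarrow> 0 < 1 / \<theta> $ Inr () - s * u $ Inr ()"
    using natural_curve_in_params[OF \<theta>] by blast
  have curve0: "natural_curve \<theta> u 0 = \<theta>" by (auto simp: natural_curve_def vec_eq_iff split: sum.split)
  have F0: "F 0 = 1"
    using log_partition_natural_curve[OF d(4), of 0] d(1) by (simp add: F_def curve0)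
  have tilt: "has_bochner_integral lborel (\<lambda>x. mg_family \<theta> x * exp (s * (u \<bullet> (mg_stat x - mg_mean \<theta>)))) (F s)"
    if s: "\<bar>s\<bar> < d" for s
  proof -
    have "mg_family \<theta> x * exp (s * (u \<bullet> (mg_stat x - mg_mean \<theta>))) = F s * mg_family (natural_curve \<theta> u s) x" for x
    proof (cases "x \<in> mg_support")
      case True
      have "mg_log_lik \<theta> (mg_stat x) + s * (u \<bullet> (mg_stat x - mg_mean \<theta>))
         = log_partition_along \<theta> u s - mg_log_partition \<theta> - s * c + mg_log_lik (natural_curve \<theta> u s) (mg_stat x)"
        using mg_log_lik_natural_curve[of \<theta> "mg_stat x" s u] log_partition_natural_curve[OF d(4)[OF s]]
        by (simp add: c_def inner_diff_right right_diff_distrib)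
      then show ?thesis
        using mg_family_eq_exp[OF \<theta> True] mg_family_eq_exp[OF d(2)[OF s] True]
        unfolding F_def by (simp flip: exp_add)
    qed (simp add: mg_family_outside)
    then show ?thesis
      using has_bochner_integral_mult_right[OF has_bochner_integral_mg_family[OF d(2)[OF s]], of "F s"] by simp
  qed
  have meas: "(\<lambda>x. u \<bullet> (mg_stat x - mg_mean \<theta>)) \<in> borel_measurable borel" by measurable
  have meas': "(\<lambda>x. u \<bullet> (mg_stat x - mg_mean \<theta>)) \<in> borel_measurable (mg_law \<theta>)"
    using meas by (simp add: multivariate_gamma_def)
  have "(F has_real_derivative F' s) (at s)" if s: "\<bar>s\<bar> < d" for s
  proof -
    have "(log_partition_along \<theta> u has_real_derivative log_partition_along' \<theta> u s) (at s)"
      by (rule log_partition_along_deriv) (use d s in auto)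
    then show ?thesis unfolding F_def[abs_def] F'_def by (auto intro!: derivative_eq_intros)
  qed
  moreover have "(F' has_real_derivative mg_variance \<theta> u) (at 0)"
  proof -
    have c: "log_partition_along' \<theta> u 0 = c" unfolding c_def by (rule log_partition_along'_0) (rule pos)
    have "(F' has_real_derivative F' 0 * (log_partition_along' \<theta> u 0 - c) + mg_variance \<theta> u * F 0) (at 0)"
      unfolding F'_def[abs_def]
      by (rule DERIV_mult) (use calculation[of 0] d(1) log_partition_along'_deriv[of \<theta> u] pos in
        \<open>auto intro!: derivative_eq_intros simp: F'_def\<close>)
    then show ?thesis by (simp add: c F0)
  qed
  moreover have "integrable (mg_law \<theta>) (\<lambda>x. exp (s * (u \<bullet> (mg_stat x - mg_mean \<theta>))))"
    "(LINT x|mg_law \<theta>. exp (s * (u \<bullet> (mg_stat x - mg_mean \<theta>)))) = F s" if "\<bar>s\<bar> < d" for s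
    by (rule integral_mg_law[OF \<theta> _ tilt[OF that]], measurable)+
  moreover have "F' 0 = 0"
    using log_partition_along'_0[of \<theta> u] pos by (simp add: F'_def c_def)
  ultimately show "integrable (mg_law \<theta>) (\<lambda>x. u \<bullet> (mg_stat x - mg_mean \<theta>))"
    and "(LINT x|mg_law \<theta>. u \<bullet> (mg_stat x - mg_mean \<theta>)) = 0"
    and "integrable (mg_law \<theta>) (\<lambda>x. (u \<bullet> (mg_stat x - mg_mean \<theta>))\<^sup>2)"
    and "(LINT x|mg_law \<theta>. (u \<bullet> (mg_stat x - mg_mean \<theta>))\<^sup>2) = mg_variance \<theta> u"
    using moments_of_laplace_transform[where L="\<lambda>x. u \<bullet> (mg_stat x - mg_mean \<theta>)" and \<mu>="mg_law \<theta>"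
      and d=d and F=F and F'=F' and D="mg_variance \<theta> u", OF meas' d(1)] by simp_all
qed

section \<open>Maximum likelihood as a moment-type estimator\<close>

text \<open>If the statistic equals the mean under \<open>\<theta>\<close>, then \<open>\<theta>\<close> is the strict maximum of the log-likelihood: the
difference is a sum over the coordinates of the convexity gaps in
\<open>gamma_log_partition_bregman_gt\<close>.\<close>

lemma mg_log_lik_less:
  assumes \<theta>: "\<theta> \<in> mg_params" and \<theta>': "\<theta>' \<in> mg_params" and neq: "\<theta>' \<noteq> \<theta>"
  shows "mg_log_lik \<theta>' (mg_mean \<theta>) < mg_log_lik \<theta> (mg_mean \<theta>)"
proof -
  define b b' where "b = \<theta> $ Inr ()" and "b' = \<theta>' $ Inr ()"
  define a a' where "a i = \<theta> $ Inl i" and "a' i = \<theta>' $ Inl i" for i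
  have pos: "a i > 0" "a' i > 0" "b > 0" "b' > 0" for i
    using \<theta> \<theta>' by (auto simp: mg_params_def a_def a'_def b_def b'_def)
  define gap where "gap i = (ln_Gamma (a' i) + a' i * ln b') -
     (ln_Gamma (a i) + a i * ln b + (Digamma (a i) + ln b) * (a' i - a i) - a i * b * (1 / b' - 1 / b))" for i
  have "mg_log_lik \<theta> (mg_mean \<theta>) - mg_log_lik \<theta>' (mg_mean \<theta>) = (\<Sum>i\<in>UNIV. gap i)"
  proof -
    have "(\<Sum>i\<in>UNIV. gap i) =
       (\<Sum>i\<in>UNIV. ln_Gamma (a' i) + a' i * ln b') - (\<Sum>i\<in>UNIV. ln_Gamma (a i) + a i * ln b)
       + (\<Sum>i\<in>UNIV. (a i - 1) * (Digamma (a i) + ln b)) - (\<Sum>i\<in>UNIV. (a' i - 1) * (Digamma (a i) + ln b))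
       + (\<Sum>i\<in>UNIV. a i) * b * (1 / b' - 1 / b)"
      unfolding sum_distrib_right sum.distrib[symmetric] sum_subtractf[symmetric]
      by (intro sum.cong refl) (simp add: gap_def algebra_simps)
    moreover have "(\<Sum>i\<in>UNIV. a i) * b / b = (\<Sum>i\<in>UNIV. a i)" using pos by simp
    ultimately show ?thesis
      by (simp add: mg_log_lik_def mg_mean_def mg_log_partition_def a_def[symmetric] a'_def[symmetric]
          b_def[symmetric] b'_def[symmetric] right_diff_distrib)
  qed
  moreover have gap_pos: "gap i > 0" if "a i \<noteq> a' i \<or> b \<noteq> b'" for i
    using gamma_log_partition_bregman_gt[of "a i" "a' i" b b'] pos that by (simp add: gap_def)
  have gap_nonneg: "gap i \<ge> 0" for i
  proof (cases "a i \<noteq> a' i \<or> b \<noteq> b'")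
    case True
    then show ?thesis using gap_pos by (simp add: less_imp_le)
  next
    case False
    then show ?thesis by (simp add: gap_def)
  qed
  have "\<exists>i. a i \<noteq> a' i \<or> b \<noteq> b'"
  proof (rule ccontr)
    assume "\<nexists>i. a i \<noteq> a' i \<or> b \<noteq> b'"
    then have "\<theta>' $ j = \<theta> $ j" for j by (cases j) (auto simp: a_def a'_def b_def b'_def)
    then show False using neq by (simp add: vec_eq_iff)
  qed
  then obtain i where "gap i > 0" using gap_pos by blast
  then have "(\<Sum>i\<in>UNIV. gap i) > 0" using gap_nonneg by (intro sum_pos2[of _ i]) auto
  ultimately show ?thesis by linarith
qed

text \<open>Two parameters with the same mean would each have the strictly larger log-likelihood.\<close>

lemma inj_on_mg_mean: "inj_on mg_mean mg_params"
proof (rule inj_onI, rule ccontr)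
  fix \<theta> \<theta>' assume "\<theta> \<in> mg_params" "\<theta>' \<in> mg_params" "mg_mean \<theta> = mg_mean \<theta>'" "\<theta> \<noteq> \<theta>'"
  then show False using mg_log_lik_less[of \<theta> \<theta>'] mg_log_lik_less[of \<theta>' \<theta>] by simp
qed

text \<open>Sufficiency of the likelihood equation is \<open>mg_log_lik_less\<close>.  Necessity is Fermat's condition along
natural lines, where the log-likelihood has derivative \<open>u \<bullet> (t - mg_mean \<theta>)\<close>.\<close>

lemma mg_log_lik_maximal_iff:
  assumes \<theta>: "\<theta> \<in> mg_params"
  shows "(\<forall>\<theta>'\<in>mg_params. mg_log_lik \<theta>' t \<le> mg_log_lik \<theta> t) \<longleftrightarrow> mg_mean \<theta> = t"
proof
  assume max: "\<forall>\<theta>'\<in>mg_params. mg_log_lik \<theta>' t \<le> mg_log_lik \<theta> t"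
  have pos: "0 < \<theta> $ j" for j using \<theta> by (simp add: mg_params_def)
  have "u \<bullet> t = u \<bullet> mg_mean \<theta>" for u
  proof -
    obtain d where d: "d > 0" "\<And>s. \<bar>s\<bar> < d \<Longrightarrow> natural_curve \<theta> u s \<in> mg_params"
      "\<And>s i. \<bar>s\<bar> < d \<Longrightarrow> 0 < \<theta> $ Inl i + s * u $ Inl i"
      "\<And>s. \<bar>s\<bar> < d \<Longrightarrow> 0 < 1 / \<theta> $ Inr () - s * u $ Inr ()"
      using natural_curve_in_params[OF \<theta>] by blast
    have curve0: "natural_curve \<theta> u 0 = \<theta>" by (auto simp: natural_curve_def vec_eq_iff split: sum.split)
    define l where "l s = mg_log_lik \<theta> t + s * (u \<bullet> t) - log_partition_along \<theta> u s + mg_log_partition \<theta>" for s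
    have l: "l s = mg_log_lik (natural_curve \<theta> u s) t" if "\<bar>s\<bar> < d" for s
      using mg_log_lik_natural_curve[of \<theta> t s u] log_partition_natural_curve[OF d(4)[OF that]] by (simp add: l_def)
    have "(log_partition_along \<theta> u has_real_derivative log_partition_along' \<theta> u 0) (at 0)"
      by (rule log_partition_along_deriv) (use d(3)[of 0] d(4)[of 0] d(1) in auto)
    then have "(l has_real_derivative (u \<bullet> t - log_partition_along' \<theta> u 0)) (at 0)"
      unfolding l_def[abs_def] by (auto intro!: derivative_eq_intros)
    moreover have "l s \<le> l 0" if "\<bar>0 - s\<bar> < d" for s
      using l[of s] l[of 0] that d(1) max d(2)[of s] by (simp add: curve0)
    ultimately have "u \<bullet> t - log_partition_along' \<theta> u 0 = 0"
      using DERIV_local_max[OF _ d(1)] by blast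
    then show ?thesis using log_partition_along'_0[of \<theta> u] pos by simp
  qed
  then show "mg_mean \<theta> = t" using vector_eq_ldot by metis
next
  assume "mg_mean \<theta> = t"
  then show "\<forall>\<theta>'\<in>mg_params. mg_log_lik \<theta>' t \<le> mg_log_lik \<theta> t"
    using mg_log_lik_less[OF \<theta>] by (metis less_imp_le order_refl)
qed

lemma likelihood_mg_family:
  fixes \<theta> :: "real^('n::{finite,linorder} + unit)"
  assumes \<theta>: "\<theta> \<in> mg_params" and N: "N \<ge> 1" and x: "\<forall>n\<in>{1..N}. x n \<in> mg_support"
  shows "likelihood mg_family N x \<theta> = exp (real N * mg_log_lik \<theta> (sample_mean N (\<lambda>n. mg_stat (x n))))"
proof -
  define w :: "real^('n + unit)" where "w = (\<chi> j. case j of Inl i \<Rightarrow> \<theta> $ Inl i - 1 | Inr _ \<Rightarrow> - 1 / \<theta> $ Inr ())"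
  have w: "mg_log_lik \<theta> t = w \<bullet> t - mg_log_partition \<theta>" for t
    by (simp add: mg_log_lik_def w_def inner_vec_plus_unit)
  have "likelihood mg_family N x \<theta> = exp (\<Sum>n=1..N. mg_log_lik \<theta> (mg_stat (x n)))"
    unfolding likelihood_def exp_sum[OF finite_atLeastAtMost]
    by (intro prod.cong refl mg_family_eq_exp[OF \<theta>]) (use x in auto)
  also have "(\<Sum>n=1..N. mg_log_lik \<theta> (mg_stat (x n))) = real N * mg_log_lik \<theta> (sample_mean N (\<lambda>n. mg_stat (x n)))"
    using N by (simp add: w sample_mean_def sum_subtractf inner_sum_right right_diff_distrib)
  finally show ?thesis .
qed

lemma mg_equations_iff_mean: "mg_equations N x \<theta> \<longleftrightarrow> mg_mean \<theta> = sample_mean N (\<lambda>n. mg_stat (x n))"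
proof -
  have nth: "sample_mean N y $ j = sample_mean N (\<lambda>n. y n $ j)" for y :: "nat \<Rightarrow> real^('a + unit)" and j
    by (simp add: sample_mean_def)
  show ?thesis
    unfolding vec_eq_iff nth split_sum_all mg_equations_def
    by (auto simp: mg_mean_def mg_stat_def shape_of_def scale_of_def)
qed

lemma mg_maximizes_likelihood_iff:
  assumes N: "N \<ge> 1" and x: "\<forall>n\<in>{1..N}. x n \<in> mg_support"
  shows "maximizes_likelihood mg_family mg_params N x \<theta> \<longleftrightarrow>
    \<theta> \<in> mg_params \<and> mg_mean \<theta> = sample_mean N (\<lambda>n. mg_stat (x n))"
proof (cases "\<theta> \<in> mg_params")
  case True
  have "(\<forall>\<theta>'\<in>mg_params. likelihood mg_family N x \<theta>' \<le> likelihood mg_family N x \<theta>) \<longleftrightarrow>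
     (\<forall>\<theta>'\<in>mg_params. mg_log_lik \<theta>' (sample_mean N (\<lambda>n. mg_stat (x n))) \<le> mg_log_lik \<theta> (sample_mean N (\<lambda>n. mg_stat (x n))))"
    using N by (intro ball_cong refl) (simp add: likelihood_mg_family[OF _ N x] True)
  then show ?thesis using True mg_log_lik_maximal_iff[OF True] by (simp add: maximizes_likelihood_def)
qed (simp add: maximizes_likelihood_def)

lemma mg_mle_on_support:
  assumes N: "N \<ge> 1" and x: "\<forall>n\<in>{1..N}. x n \<in> mg_support"
  defines "t \<equiv> sample_mean N (\<lambda>n. mg_stat (x n))"
  shows "mg_mle N x = (if t \<in> mg_mean ` mg_params then Some (inv_into mg_params mg_mean t) else None)"
proof (cases "t \<in> mg_mean ` mg_params")
  case True
  have "maximizes_likelihood mg_family mg_params N x = (\<lambda>\<theta>. \<theta> = inv_into mg_params mg_mean t)"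
  proof
    fix \<theta> :: "real^('a + unit)"
    show "maximizes_likelihood mg_family mg_params N x \<theta> \<longleftrightarrow> \<theta> = inv_into mg_params mg_mean t"
    using mg_maximizes_likelihood_iff[OF N x, of \<theta>] inv_into_into[OF True] f_inv_into_f[OF True]
      inv_into_f_f[OF inj_on_mg_mean, of \<theta>] unfolding t_def by auto
  qed
  then show ?thesis using True by (simp add: mg_mle_def mle_def)
next
  case False
  then have "\<not> maximizes_likelihood mg_family mg_params N x \<theta>" for \<theta>
    using mg_maximizes_likelihood_iff[OF N x, of \<theta>] unfolding t_def by (metis image_eqI)
  then show ?thesis using False by (auto simp: mg_mle_def mle_def)
qed

text \<open>If an observation lies outside the support, the likelihood vanishes identically; every parameter
maximizes it, and there is no unique maximizer.\<close>

lemma mg_mle_outside_support: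
  assumes "n \<in> {1..N}" "x n \<notin> mg_support"
  shows "mg_mle N (x :: nat \<Rightarrow> real^'n::{finite,linorder}) = None"
proof -
  have "likelihood mg_family N x \<theta> = 0" for \<theta>
    unfolding likelihood_def
    by (intro prod_zero bexI[OF _ assms(1)]) (simp_all add: mg_family_outside assms(2))
  then have "maximizes_likelihood mg_family mg_params N x \<theta>" if "\<theta> \<in> mg_params" for \<theta>
    using that by (simp add: maximizes_likelihood_def)
  moreover have "(\<chi> j. 1) \<in> (mg_params :: (real^('n + unit)) set)" "(\<chi> j. 2) \<in> (mg_params :: (real^('n + unit)) set)"
    by (simp_all add: mg_params_def)
  moreover have "(\<chi> j. 1) \<noteq> ((\<chi> j. 2) :: real^('n + unit))" by (simp add: vec_eq_iff)
  ultimately have "\<not> (\<exists>!\<theta>. maximizes_likelihood mg_family mg_params N x \<theta>)" by blast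
  then show ?thesis by (simp add: mg_mle_def mle_def)
qed

text \<open>The vector-valued integral is obtained from its components, which are the mean-zero scores in the
basis directions.\<close>

lemma set_integral_mg_stat:
  assumes \<theta>: "\<theta> \<in> mg_params"
  shows "set_integrable (mg_law \<theta>) mg_support mg_stat"
    and "(LINT x:mg_support|mg_law \<theta>. mg_stat x) = mg_mean \<theta>"
proof -
  have "(\<integral>\<^sup>+x. ennreal (mg_family \<theta> x) \<partial>lborel) = 1"
    using nn_integral_mg_density[of "shape_of \<theta>" "scale_of \<theta>"] \<theta>
    by (simp add: mg_family_def mg_params_def shape_of_def scale_of_def)
  then have "emeasure (mg_law \<theta>) (space (mg_law \<theta>)) = 1"
    using borel_measurable_mg_family[OF \<theta>] unfolding mg_law_eq by (simp add: emeasure_density)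
  then interpret prob_space "mg_law \<theta>" by (rule prob_spaceI)
  define h where "h x = mg_mean \<theta> + (\<Sum>b\<in>Basis. (b \<bullet> (mg_stat x - mg_mean \<theta>)) *\<^sub>R b)" for x
  have h: "h x = mg_stat x" for x
    unfolding h_def by (subst inner_commute) (simp add: euclidean_representation)
  have "integrable (mg_law \<theta>) h" unfolding h_def
    by (intro Bochner_Integration.integrable_add integrable_const Bochner_Integration.integrable_sum
        Bochner_Integration.integrable_scaleR_left mg_score_moments(1)[OF \<theta>])
  then have int: "integrable (mg_law \<theta>) mg_stat" using ext[of h mg_stat, OF h] by simp
  have "(LINT x|mg_law \<theta>. h x) = mg_mean \<theta>"
    unfolding h_def using mg_score_moments(1,2)[OF \<theta>]
    by (simp add: prob_space)
  then have val: "(LINT x|mg_law \<theta>. mg_stat x) = mg_mean \<theta>" by (simp add: h)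
  have AE: "AE x in mg_law \<theta>. indicator mg_support x *\<^sub>R mg_stat x = mg_stat x"
    using AE_mg_law_support[OF \<theta>] by eventually_elim simp
  have meas: "mg_stat \<in> borel_measurable (mg_law \<theta>)" "(\<lambda>x. indicator mg_support x *\<^sub>R mg_stat x) \<in> borel_measurable (mg_law \<theta>)"
    by (auto simp: multivariate_gamma_def)
  show "set_integrable (mg_law \<theta>) mg_support mg_stat"
    unfolding set_integrable_def using int integrable_cong_AE[OF meas(2,1) AE] by blast
  show "(LINT x:mg_support|mg_law \<theta>. mg_stat x) = mg_mean \<theta>"
    unfolding set_lebesgue_integral_def using integral_cong_AE[OF meas(2,1) AE] val by simp
qed

text \<open>Off the image of the mean map, \<open>g\<close> takes the value 0 since this is not an admissible parameter; the
moment-type estimator then fails to exist exactly when the likelihood has no maximum.\<close>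

lemma mg_mle_moment_type:
  "moment_type_estimator mg_law mg_support mg_params mg_stat
     (\<lambda>t. if t \<in> mg_mean ` mg_params then inv_into mg_params mg_mean t else 0)
     (mg_mle :: nat \<Rightarrow> (nat \<Rightarrow> real^'n::{finite,linorder}) \<Rightarrow> _)"
  unfolding moment_type_estimator_def
proof (intro conjI ballI allI impI)
  show "set_integrable (mg_law \<theta>) mg_support mg_stat" if "\<theta> \<in> mg_params" for \<theta> :: "real^('n + unit)"
    by (rule set_integral_mg_stat) fact
  show "inj_on (\<lambda>\<theta>. LINT x:mg_support|mg_law \<theta>. mg_stat x) (mg_params :: (real^('n + unit)) set)"
    using inj_on_mg_mean by (subst inj_on_cong[of _ _ mg_mean]) (simp_all add: set_integral_mg_stat)
  show "(if (LINT x:mg_support|mg_law \<theta>. mg_stat x) \<in> mg_mean ` mg_params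
      then inv_into mg_params mg_mean (LINT x:mg_support|mg_law \<theta>. mg_stat x) else 0) = \<theta>"
    if "\<theta> \<in> mg_params" for \<theta> :: "real^('n + unit)"
    using that by (simp add: set_integral_mg_stat inv_into_f_f[OF inj_on_mg_mean])
  fix N :: nat and x :: "nat \<Rightarrow> (real, 'n) vec"
  assume "1 \<le> N" "\<forall>n\<in>{1..N}. x n \<in> mg_support"
  moreover have "(0 :: real^('n + unit)) \<notin> mg_params" by (simp add: mg_params_def)
  ultimately show "mg_mle N x = (let t = (if sample_mean N (\<lambda>n. mg_stat (x n)) \<in> mg_mean ` mg_params
        then inv_into mg_params mg_mean (sample_mean N (\<lambda>n. mg_stat (x n))) else 0)
      in if t \<in> mg_params then Some t else None)"
    by (simp add: mg_mle_on_support Let_def inv_into_into)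
qed

section \<open>The information matrix and the asymptotic covariance\<close>

lemma mg_block_matrix_mult:
  fixes \<alpha> :: "real^'n::{finite,linorder}"
  shows "(mg_block_matrix \<alpha> \<beta> *v t) $ Inl i = Polygamma 1 (\<alpha> $ i) * t $ Inl i + t $ Inr () / \<beta>"
    and "(mg_block_matrix \<alpha> \<beta> *v t) $ Inr () = (\<Sum>i\<in>UNIV. t $ Inl i) / \<beta> + (\<Sum>i\<in>UNIV. \<alpha> $ i) / \<beta>\<^sup>2 * t $ Inr ()"
  by (simp_all add: mg_block_matrix_def matrix_vector_mult_def sum_UNIV_plus_unit if_distrib[of "\<lambda>x. x * _"]
      sum_divide_distrib cong: if_cong)

text \<open>Positivity of the Schur complement of the diagonal block of the information matrix, up to the factor \<open>\<beta>\<^sup>-\<^sup>2\<close>.  It is the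
determinant condition for the matrix to be positive definite.\<close>

lemma sum_shape_minus_inverse_trigamma_pos:
  fixes \<alpha> :: "real^'n"
  assumes "\<forall>i. 0 < \<alpha> $ i"
  shows "0 < (\<Sum>i\<in>UNIV. \<alpha> $ i - 1 / Polygamma 1 (\<alpha> $ i))"
proof (rule sum_pos)
  fix i
  have "0 < 1 / \<alpha> $ i" "1 / \<alpha> $ i < Polygamma 1 (\<alpha> $ i)" using assms Polygamma_1_gt_inverse by auto
  moreover from this have "0 < Polygamma 1 (\<alpha> $ i)" by linarith
  ultimately show "0 < \<alpha> $ i - 1 / Polygamma 1 (\<alpha> $ i)" using assms by (simp add: field_simps)
qed auto

text \<open>The factor \<open>L\<close> comes from completing the squares
\<open>\<psi>\<^sub>1(\<alpha>\<^sub>i) u\<^sub>i\<^sup>2 + 2 u\<^sub>i v / \<beta> = \<psi>\<^sub>1(\<alpha>\<^sub>i) (u\<^sub>i + v / (\<beta> \<psi>\<^sub>1(\<alpha>\<^sub>i)))\<^sup>2 - v\<^sup>2 / (\<beta>\<^sup>2 \<psi>\<^sub>1(\<alpha>\<^sub>i))\<close>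
in the quadratic form of the matrix; the remaining multiple of \<open>v\<^sup>2\<close> is nonnegative by the
preceding lemma.\<close>

lemma mg_block_matrix_gram:
  fixes \<alpha> :: "real^'n::{finite,linorder}"
  assumes "\<forall>i. 0 < \<alpha> $ i" "0 < \<beta>"
  shows "\<exists>L :: real^('n + unit)^('n + unit). mg_block_matrix \<alpha> \<beta> = transpose L ** L"
proof -
  define p where "p i = Polygamma 1 (\<alpha> $ i)" for i
  define c where "c = (\<Sum>i\<in>UNIV. \<alpha> $ i - 1 / p i)"
  have p: "p i > 0" for i
    using Polygamma_1_gt_inverse[of "\<alpha> $ i"] assms(1) unfolding p_def by (meson less_trans zero_less_divide_1_iff)
  have p0: "p i \<noteq> 0" and pS: "Polygamma (Suc 0) (\<alpha> $ i) = p i" for i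
    using p[of i] by (simp_all add: p_def)
  have c: "c \<ge> 0" using sum_shape_minus_inverse_trigamma_pos[OF assms(1)] by (simp add: c_def p_def)
  define L :: "real^('n + unit)^('n + unit)" where "L = (\<chi> r k. case r of
       Inl i \<Rightarrow> (case k of Inl j \<Rightarrow> if i = j then sqrt (p i) else 0 | Inr _ \<Rightarrow> 1 / (\<beta> * sqrt (p i)))
     | Inr _ \<Rightarrow> (case k of Inl _ \<Rightarrow> 0 | Inr _ \<Rightarrow> sqrt c / \<beta>))"
  have "mg_block_matrix \<alpha> \<beta> $ r $ k = (\<Sum>l\<in>UNIV. L $ l $ r * L $ l $ k)" for r k
  proof -
    have "(\<Sum>i\<in>UNIV. 1 / (\<beta> * sqrt (p i)) * (1 / (\<beta> * sqrt (p i)))) = (\<Sum>i\<in>UNIV. 1 / p i) / \<beta>\<^sup>2"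
      unfolding sum_divide_distrib using p by (intro sum.cong refl) (simp add: power2_eq_square less_imp_le field_simps)
    moreover have "sqrt c / \<beta> * (sqrt c / \<beta>) = (\<Sum>i\<in>UNIV. \<alpha> $ i) / \<beta>\<^sup>2 - (\<Sum>i\<in>UNIV. 1 / p i) / \<beta>\<^sup>2"
      using c by (simp add: power2_eq_square diff_divide_distrib[symmetric]) (simp add: c_def sum_subtractf)
    moreover have "sqrt (p i) * (1 / (\<beta> * sqrt (p i))) = 1 / \<beta>" "sqrt (p i) * sqrt (p i) = p i" for i
      using p[of i] by auto
    ultimately show ?thesis
      by (cases r; cases k) (simp_all add: L_def mg_block_matrix_def sum_UNIV_plus_unit p0 pS
        if_distrib[of "\<lambda>x. x / _"] if_distrib[of "\<lambda>x. x * _"] if_distrib[of "\<lambda>x. _ * x"] cong: if_cong)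
  qed
  then have "mg_block_matrix \<alpha> \<beta> = transpose L ** L"
    by (simp add: vec_eq_iff matrix_matrix_mult_def transpose_def)
  then show ?thesis by blast
qed

lemma invertible_mg_block_matrix:
  fixes \<alpha> :: "real^'n::{finite,linorder}"
  assumes "\<forall>i. 0 < \<alpha> $ i" "0 < \<beta>"
  shows "invertible (mg_block_matrix \<alpha> \<beta>)"
  unfolding invertible_left_inverse matrix_left_invertible_ker
proof (intro allI impI)
  fix t assume 0: "mg_block_matrix \<alpha> \<beta> *v t = 0"
  define p where "p i = Polygamma 1 (\<alpha> $ i)" for i
  define v where "v = t $ Inr ()"
  have p: "p i > 0" for i
    using Polygamma_1_gt_inverse[of "\<alpha> $ i"] assms(1) unfolding p_def by (meson less_trans zero_less_divide_1_iff)
  have ti: "t $ Inl i = - (v / \<beta>) * (1 / p i)" for i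
  proof -
    have "p i * t $ Inl i + v / \<beta> = 0" using mg_block_matrix_mult(1)[of \<alpha> \<beta> t i] 0 by (simp add: p_def v_def)
    then have "p i * t $ Inl i = - (v / \<beta>)" by linarith
    then have "t $ Inl i = - (v / \<beta>) / p i" using p[of i] by (metis less_irrefl nonzero_mult_div_cancel_left)
    then show ?thesis by simp
  qed
  have "(\<Sum>i\<in>UNIV. t $ Inl i) / \<beta> + (\<Sum>i\<in>UNIV. \<alpha> $ i) / \<beta>\<^sup>2 * v = 0"
    using mg_block_matrix_mult(2)[of \<alpha> \<beta> t] 0 by (simp add: v_def)
  moreover have "(\<Sum>i\<in>UNIV. t $ Inl i) = - (v / \<beta>) * (\<Sum>i\<in>UNIV. 1 / p i)"
    unfolding ti sum_distrib_left ..
  ultimately have "v / \<beta>\<^sup>2 * (\<Sum>i\<in>UNIV. \<alpha> $ i - 1 / p i) = 0"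
    by (simp add: sum_subtractf power2_eq_square algebra_simps)
  then have "v = 0" using sum_shape_minus_inverse_trigamma_pos[OF assms(1)] assms(2) by (auto simp: p_def)
  then have "t $ j = 0" for j using ti by (cases j) (auto simp: v_def)
  then show "t = 0" by (simp add: vec_eq_iff)
qed

text \<open>The last component of \<open>mg_stat x - mg_mean \<theta>\<close> is the derivative of the log-density with respect to
\<open>- 1 / \<beta>\<close>; dividing it by \<open>\<beta>\<^sup>2\<close> turns it into the derivative with respect to \<open>\<beta>\<close>.  The rescaled
vector is therefore the score in the parametrization by \<open>(\<alpha>, \<beta>)\<close>.\<close>

definition rescale :: "real \<Rightarrow> real^('n::finite + unit) \<Rightarrow> real^('n + unit)" where
  "rescale \<beta> u = (\<chi> j. case j of Inl i \<Rightarrow> u $ Inl i | Inr _ \<Rightarrow> u $ Inr () / \<beta>\<^sup>2)"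

lemma linear_rescale: "linear (rescale \<beta>)"
  by (rule linearI) (auto simp: rescale_def vec_eq_iff add_divide_distrib split: sum.split)

lemma inner_rescale: "t \<bullet> rescale \<beta> w = rescale \<beta> t \<bullet> w"
  by (simp add: rescale_def inner_vec_plus_unit)

lemma inj_rescale: "0 < \<beta> \<Longrightarrow> inj (rescale \<beta>)"
proof (rule injI)
  fix u v :: "real^('a + unit)" assume \<beta>: "0 < \<beta>" and eq: "rescale \<beta> u = rescale \<beta> v"
  have "u $ j = v $ j" for j
    using arg_cong[OF eq, of "\<lambda>w. w $ j"] \<beta> by (cases j) (auto simp: rescale_def)
  then show "u = v" by (simp add: vec_eq_iff)
qed

text \<open>The covariance of the score is the block matrix.\<close>

lemma mg_variance_rescale:
  fixes \<alpha> :: "real^'n::{finite,linorder}"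
  assumes "0 < \<beta>"
  shows "mg_variance (param \<alpha> \<beta>) (rescale \<beta> t) = t \<bullet> (mg_block_matrix \<alpha> \<beta> *v t)"
proof -
  have "t \<bullet> (mg_block_matrix \<alpha> \<beta> *v t) = (\<Sum>i\<in>UNIV. t $ Inl i * (Polygamma 1 (\<alpha> $ i) * t $ Inl i + t $ Inr () / \<beta>))
      + t $ Inr () * ((\<Sum>i\<in>UNIV. t $ Inl i) / \<beta> + (\<Sum>i\<in>UNIV. \<alpha> $ i) / \<beta>\<^sup>2 * t $ Inr ())"
    by (simp only: inner_vec_plus_unit mg_block_matrix_mult)
  also have "\<dots> = (\<Sum>i\<in>UNIV. t $ Inl i * (Polygamma 1 (\<alpha> $ i) * t $ Inl i + t $ Inr () / \<beta>)
      + t $ Inr () * (t $ Inl i / \<beta> + \<alpha> $ i / \<beta>\<^sup>2 * t $ Inr ()))"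
    by (simp only: sum.distrib sum_distrib_left sum_distrib_right sum_divide_distrib distrib_left)
  also have "\<dots> = mg_variance (param \<alpha> \<beta>) (rescale \<beta> t)"
    unfolding mg_variance_def using assms
    by (intro sum.cong refl) (simp add: param_def rescale_def field_simps power2_eq_square)
  finally show ?thesis by simp
qed

text \<open>The derivative of the rescaled mean map is the block matrix as well, and in particular symmetric.\<close>

lemma has_derivative_mg_mean:
  fixes \<alpha> :: "real^'n::{finite,linorder}"
  assumes "\<forall>i. 0 < \<alpha> $ i" "0 < \<beta>"
  shows "((\<lambda>\<theta>. rescale \<beta> (mg_mean \<theta> - c)) has_derivative (\<lambda>u. mg_block_matrix \<alpha> \<beta> *v u)) (at (param \<alpha> \<beta>))"
  unfolding has_derivative_componentwise_within[of "\<lambda>\<theta>. rescale \<beta> (mg_mean \<theta> - c)"]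
proof
  fix b :: "real^('n + unit)" assume "b \<in> Basis"
  then obtain j where b: "b = axis j 1" by (auto simp: Basis_vec_def)
  have nth[derivative_intros]: "((\<lambda>\<theta>. \<theta> $ k) has_derivative (\<lambda>u. u $ k)) F" for k and F :: "(real^('n + unit)) filter"
    by (rule bounded_linear_imp_has_derivative[OF bounded_linear_vec_nth])
  show "((\<lambda>\<theta>. rescale \<beta> (mg_mean \<theta> - c) \<bullet> b) has_derivative (\<lambda>u. (mg_block_matrix \<alpha> \<beta> *v u) \<bullet> b)) (at (param \<alpha> \<beta>))"
  proof (cases j)
    case (Inl i)
    have npos: "param \<alpha> \<beta> $ Inl i \<notin> \<int>\<^sub>\<le>\<^sub>0" using assms(1) by (auto simp: param_def dest!: nonpos_Ints_nonpos) (meson not_le)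
    have "((\<lambda>\<theta>. Digamma (\<theta> $ Inl i)) has_derivative (\<lambda>u. Polygamma 1 (\<alpha> $ i) * u $ Inl i)) (at (param \<alpha> \<beta>))"
    proof -
      have "(Digamma has_derivative (*) (Polygamma (Suc 0) (param \<alpha> \<beta> $ Inl i))) (at (param \<alpha> \<beta> $ Inl i))"
        using has_field_derivative_Polygamma[OF npos, of 0 UNIV] by (simp add: has_field_derivative_def)
      from has_derivative_compose[OF nth this] show ?thesis by (simp add: param_def)
    qed
    moreover have "((\<lambda>\<theta>. ln (\<theta> $ Inr ())) has_derivative (\<lambda>u. u $ Inr () / \<beta>)) (at (param \<alpha> \<beta>))"
      using assms(2) by (auto intro!: derivative_eq_intros simp: param_def divide_inverse mult.commute)
    ultimately have "((\<lambda>\<theta>. Digamma (\<theta> $ Inl i) + ln (\<theta> $ Inr ()) - c $ Inl i) has_derivative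
        (\<lambda>u. Polygamma 1 (\<alpha> $ i) * u $ Inl i + u $ Inr () / \<beta>)) (at (param \<alpha> \<beta>))"
      by (rule has_derivative_eq_rhs[OF has_derivative_diff[OF has_derivative_add has_derivative_const]]) simp
    then show ?thesis by (simp add: b Inl inner_axis rescale_def mg_mean_def mg_block_matrix_mult)
  next
    case (Inr x)
    have "((\<lambda>\<theta>. ((\<Sum>i\<in>UNIV. \<theta> $ Inl i) * \<theta> $ Inr () - c $ Inr ()) / \<beta>\<^sup>2) has_derivative
        (\<lambda>u. (\<Sum>i\<in>UNIV. u $ Inl i) / \<beta> + (\<Sum>i\<in>UNIV. \<alpha> $ i) / \<beta>\<^sup>2 * u $ Inr ())) (at (param \<alpha> \<beta>))"
      using assms(2) by (auto intro!: derivative_eq_intros simp: param_def fun_eq_iff field_simps power2_eq_square)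
    then show ?thesis by (simp add: b Inr inner_axis rescale_def mg_mean_def mg_block_matrix_mult)
  qed
qed

lemma open_mg_params: "open (mg_params :: (real^('n::finite + unit)) set)"
proof -
  have "mg_params = (\<Inter>j. {\<theta> :: real^('n + unit). 0 < \<theta> $ j})" by (auto simp: mg_params_def)
  also have "open \<dots>" by (intro open_INT ballI open_Collect_less continuous_intros) auto
  finally show ?thesis .
qed

lemma continuous_on_mg_mean: "continuous_on mg_params (mg_mean :: real^('n::finite + unit) \<Rightarrow> _)"
proof -
  have "continuous_on mg_params (\<lambda>\<theta>. mg_mean \<theta> $ j)" for j :: "'n + unit"
  proof (cases j)
    case (Inl i)
    have "continuous_on (mg_params :: (real^('n + unit)) set) (\<lambda>\<theta>. Digamma (\<theta> $ Inl i))"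
    proof (rule continuous_on_compose2[OF continuous_on_Polygamma[of "{0<..}"]])
      show "{0<..} \<inter> \<int>\<^sub>\<le>\<^sub>0 = ({} :: real set)" by (auto dest: nonpos_Ints_nonpos)
    qed (auto simp: mg_params_def intro!: continuous_intros)
    then show ?thesis unfolding Inl mg_mean_def
      by (auto intro!: continuous_intros simp: mg_params_def less_imp_neq[symmetric])
  next
    case (Inr u)
    then show ?thesis unfolding mg_mean_def by (auto intro!: continuous_intros)
  qed
  then show ?thesis
    unfolding continuous_on_componentwise[of _ mg_mean] by (auto simp: Basis_vec_def inner_axis)
qed

text \<open>The maximum likelihood estimator solves \<open>m \<theta>' = \<close> mean score for the moment map
\<open>m \<theta>' = rescale \<beta> (mg_mean \<theta>' - mg_mean \<theta>)\<close>, whose derivative at \<open>\<theta>\<close> is the covariance of the score.\<close>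

theorem mg_mle_asymptotic_covariance:
  fixes M :: "'w measure" and X :: "nat \<Rightarrow> 'w \<Rightarrow> real^'n::{finite,linorder}"
  assumes "prob_space M" and \<alpha>: "\<forall>i. 0 < \<alpha> $ i" and \<beta>: "0 < \<beta>"
    and indep: "prob_space.indep_vars M (\<lambda>_. borel) X {1..}"
    and dist: "\<forall>n\<ge>1. distributed M lborel (X n) (\<lambda>x. ennreal (mg_density \<alpha> \<beta> x))"
  shows "asymptotic_covariance M X mg_mle (param \<alpha> \<beta>) (matrix_inv (mg_block_matrix \<alpha> \<beta>))"
proof -
  interpret prob_space M by fact
  define \<theta> where "\<theta> = param \<alpha> \<beta>"
  have \<theta>: "\<theta> \<in> mg_params" using \<alpha> \<beta> by (auto simp: \<theta>_def mg_params_def param_def split: sum.split)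
  have law: "mg_law \<theta> = multivariate_gamma \<alpha> \<beta>"
    by (simp add: \<theta>_def param_def shape_of_def scale_of_def)
  have X[measurable]: "X n \<in> borel_measurable M" if "n \<ge> 1" for n
    using dist that by (auto simp: distributed_def)
  have distr_X: "distr M borel (X n) = mg_law \<theta>" if "n \<ge> 1" for n
  proof -
    have "distr M borel (X n) = distr M lborel (X n)" by (rule distr_cong) auto
    then show ?thesis unfolding law using dist that by (simp add: distributed_def multivariate_gamma_def)
  qed
  define s :: "(real, 'n) vec \<Rightarrow> real^('n + unit)" where "s x = rescale \<beta> (mg_stat x - mg_mean \<theta>)" for x
  define m where "m \<theta>' = rescale \<beta> (mg_mean \<theta>' - mg_mean \<theta>)" for \<theta>' :: "real^('n + unit)"
  interpret rescale: bounded_linear "rescale \<beta> :: real^('n + unit) \<Rightarrow> _"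
    using linear_rescale by (rule linear_conv_bounded_linear[THEN iffD1])
  have s[measurable]: "s \<in> borel_measurable borel"
    unfolding s_def[abs_def] by (rule borel_measurable_continuous_on[OF linear_continuous_on]) (auto intro: rescale.bounded_linear_axioms)
  have score: "t \<bullet> s x = rescale \<beta> t \<bullet> (mg_stat x - mg_mean \<theta>)" for t x
    unfolding s_def by (rule inner_rescale)
  obtain L :: "real^('n + unit)^('n + unit)" where L: "mg_block_matrix \<alpha> \<beta> = transpose L ** L"
    using mg_block_matrix_gram[OF \<alpha> \<beta>] by blast
  define \<nu> where "\<nu> = distr (mg_law \<theta>) borel s"
  have sl: "s \<in> borel_measurable (mg_law \<theta>)" by (simp add: multivariate_gamma_def)
  have int\<nu>: "integrable \<nu> f = integrable (mg_law \<theta>) (\<lambda>x. f (s x))" "(LINT y|\<nu>. f y) = (LINT x|mg_law \<theta>. f (s x))"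
    if "f \<in> borel_measurable borel" for f :: "_ \<Rightarrow> real"
    unfolding \<nu>_def using that sl by (simp_all add: integrable_distr_eq integral_distr)
  show ?thesis
    unfolding \<theta>_def[symmetric]
  proof (rule asymptotic_covariance_inverse_moment_map[where s=s and m=m and L=L and \<nu>=\<nu> and S=mg_support and \<Theta>=mg_params])
    show "indep_vars (\<lambda>_. borel) (\<lambda>n \<omega>. s (X n \<omega>)) {1..}"
      by (rule indep_vars_compose2[OF indep]) simp
    show "distr M borel (\<lambda>\<omega>. s (X n \<omega>)) = \<nu>" if "n \<ge> 1" for n
      unfolding \<nu>_def distr_X[OF that, symmetric] using X[OF that] by (subst distr_distr) (auto simp: comp_def)
    show "(LINT y|\<nu>. t \<bullet> y) = 0" for t
      using mg_score_moments(2)[OF \<theta>] by (simp add: int\<nu> score)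
    show "integrable \<nu> (\<lambda>y. (t \<bullet> y)\<^sup>2)" for t
      using mg_score_moments(3)[OF \<theta>] by (simp add: int\<nu> score)
    show "(LINT y|\<nu>. (t \<bullet> y)\<^sup>2) = t \<bullet> (mg_block_matrix \<alpha> \<beta> *v t)" for t
      using mg_score_moments(4)[OF \<theta>] mg_variance_rescale[OF \<beta>] by (simp add: int\<nu> score \<theta>_def)
    show "mg_block_matrix \<alpha> \<beta> = transpose L ** L" by (rule L)
    show "invertible (mg_block_matrix \<alpha> \<beta>)" by (rule invertible_mg_block_matrix[OF \<alpha> \<beta>])
    show "open (mg_params :: (real^('n + unit)) set)" by (rule open_mg_params)
    show "continuous_on mg_params m" unfolding m_def[abs_def]
      by (intro rescale.continuous_on continuous_on_diff continuous_on_const continuous_on_mg_mean)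
    show "inj_on m mg_params"
    proof (rule inj_onI)
      fix x y assume "x \<in> mg_params" "y \<in> mg_params" "m x = m y"
      then show "x = y" using injD[OF inj_rescale[OF \<beta>]] inj_onD[OF inj_on_mg_mean] unfolding m_def by fastforce
    qed
    show "m \<theta> = 0" by (simp add: m_def rescale.zero)
    show "(m has_derivative (\<lambda>u. mg_block_matrix \<alpha> \<beta> *v u)) (at \<theta>)"
      unfolding m_def[abs_def] \<theta>_def by (rule has_derivative_mg_mean[OF \<alpha> \<beta>])
    show "{\<omega> \<in> space M. X n \<omega> \<in> mg_support} \<in> sets M" if "n \<ge> 1" for n
      using measurable_sets[OF X[OF that] mg_support_borel] by (simp add: vimage_def Int_def conj_commute)
    show "AE \<omega> in M. X n \<omega> \<in> mg_support" if "n \<ge> 1" for n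
      using AE_mg_law_support[OF \<theta>] unfolding distr_X[OF that, symmetric] by (rule AE_distrD[OF X[OF that]])
    show "mg_mle N (\<lambda>n. X n \<omega>) =
        (if (\<forall>n\<in>{1..N}. X n \<omega> \<in> mg_support) \<and> sample_mean N (\<lambda>n. s (X n \<omega>)) \<in> m ` mg_params
         then Some (inv_into mg_params m (sample_mean N (\<lambda>n. s (X n \<omega>)))) else None)" if N: "N \<ge> 1" for N \<omega>
    proof (cases "\<forall>n\<in>{1..N}. X n \<omega> \<in> mg_support")
      case True
      define t where "t = sample_mean N (\<lambda>n. mg_stat (X n \<omega>))"
      have mean: "sample_mean N (\<lambda>n. s (X n \<omega>)) = rescale \<beta> (t - mg_mean \<theta>)"
      proof -
        have "sample_mean N (\<lambda>n. s (X n \<omega>)) = rescale \<beta> ((1 / real N) *\<^sub>R (\<Sum>n=1..N. mg_stat (X n \<omega>) - mg_mean \<theta>))"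
          by (simp add: sample_mean_def s_def rescale.scaleR rescale.sum)
        also have "(1 / real N) *\<^sub>R (\<Sum>n=1..N. mg_stat (X n \<omega>) - mg_mean \<theta>) = t - mg_mean \<theta>"
          using N by (simp add: t_def sample_mean_def sum_subtractf scaleR_diff_right sum_constant_scaleR del: sum_constant)
        finally show ?thesis .
      qed
      have eq: "m \<theta>' = rescale \<beta> (t - mg_mean \<theta>) \<longleftrightarrow> mg_mean \<theta>' = t" for \<theta>'
        unfolding m_def using injD[OF inj_rescale[OF \<beta>]] by fastforce
      have "inv_into mg_params m (rescale \<beta> (t - mg_mean \<theta>)) = inv_into mg_params mg_mean t"
        unfolding inv_into_def eq ..
      moreover have "rescale \<beta> (t - mg_mean \<theta>) \<in> m ` mg_params \<longleftrightarrow> t \<in> mg_mean ` mg_params"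
        unfolding image_iff using eq by metis
      ultimately show ?thesis using True mg_mle_on_support[OF N True] by (simp add: mean t_def)
    next
      case False
      then obtain n where "n \<in> {1..N}" "X n \<omega> \<notin> mg_support" by blast
      then have "mg_mle N (\<lambda>n. X n \<omega>) = None" by (rule mg_mle_outside_support)
      then show ?thesis using False by (simp only: simp_thms if_False)
    qed
    show "prob_space M" "\<theta> \<in> mg_params" by fact+
  qed
qed

theorem proposition4p5:
  fixes M :: "'w measure"
    and X :: "nat \<Rightarrow> 'w \<Rightarrow> real^'n::{finite,linorder}"
    and \<alpha> :: "real^'n::{finite,linorder}" and \<beta> :: real
  assumes "prob_space M"
    and "\<forall>i. 0 < \<alpha> $ i" and "0 < \<beta>"
    and "prob_space.indep_vars M (\<lambda>_. borel) X {1..}"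
    and "\<forall>n\<ge>1. distributed M lborel (X n) (\<lambda>x. ennreal (mg_density \<alpha> \<beta> x))"
  shows
    "(\<forall>N\<ge>1. \<forall>x :: nat \<Rightarrow> real^'n::{finite,linorder}. (\<forall>n\<in>{1..N}. x n \<in> mg_support) \<longrightarrow>
        (\<forall>\<theta>. maximizes_likelihood mg_family mg_params N x \<theta>
              \<longleftrightarrow> \<theta> \<in> mg_params \<and> mg_equations N x \<theta>) \<and>
        ((\<exists>\<theta>. maximizes_likelihood mg_family mg_params N x \<theta>) \<longrightarrow>
              (\<exists>!\<theta>. \<theta> \<in> mg_params \<and> mg_equations N x \<theta>))) \<and>
     (\<exists>(h :: real^'n::{finite,linorder} \<Rightarrow> real^('n + unit)) g.
        moment_type_estimator (\<lambda>\<theta>. multivariate_gamma (shape_of \<theta>) (scale_of \<theta>))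
          mg_support mg_params h g mg_mle) \<and>
     invertible (mg_block_matrix \<alpha> \<beta>) \<and>
     asymptotic_covariance M X mg_mle (param \<alpha> \<beta>) (matrix_inv (mg_block_matrix \<alpha> \<beta>))"
proof (intro conjI)
  show "\<exists>(h :: (real, 'n) vec \<Rightarrow> real^('n + unit)) g.
      moment_type_estimator (\<lambda>\<theta>. multivariate_gamma (shape_of \<theta>) (scale_of \<theta>)) mg_support mg_params h g mg_mle"
    using mg_mle_moment_type by blast
  show "invertible (mg_block_matrix \<alpha> \<beta>)" by (rule invertible_mg_block_matrix[OF assms(2,3)])
  show "asymptotic_covariance M X mg_mle (param \<alpha> \<beta>) (matrix_inv (mg_block_matrix \<alpha> \<beta>))"
    by (rule mg_mle_asymptotic_covariance[OF assms])
  show "\<forall>N\<ge>1. \<forall>x :: nat \<Rightarrow> (real, 'n) vec. (\<forall>n\<in>{1..N}. x n \<in> mg_support) \<longrightarrow>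
        (\<forall>\<theta>. maximizes_likelihood mg_family mg_params N x \<theta> \<longleftrightarrow> \<theta> \<in> mg_params \<and> mg_equations N x \<theta>) \<and>
        ((\<exists>\<theta>. maximizes_likelihood mg_family mg_params N x \<theta>) \<longrightarrow>
              (\<exists>!\<theta>. \<theta> \<in> mg_params \<and> mg_equations N x \<theta>))"
  proof (intro allI impI)
    fix N :: nat and x :: "nat \<Rightarrow> (real, 'n) vec"
    assume "1 \<le> N" "\<forall>n\<in>{1..N}. x n \<in> mg_support"
    note max = mg_maximizes_likelihood_iff[OF this]
    show "(\<forall>\<theta>. maximizes_likelihood mg_family mg_params N x \<theta> \<longleftrightarrow> \<theta> \<in> mg_params \<and> mg_equations N x \<theta>) \<and>
        ((\<exists>\<theta>. maximizes_likelihood mg_family mg_params N x \<theta>) \<longrightarrow>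
              (\<exists>!\<theta>. \<theta> \<in> mg_params \<and> mg_equations N x \<theta>))"
      unfolding max mg_equations_iff_mean using inj_onD[OF inj_on_mg_mean] by metis
  qed
qed

end
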